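(* Assume $\omega_i/\omega_0\notin\mathbb{Z}$ for $i=1,\dots,n$. Then the backbone curve of the system $$\ddot x+\omega_0^2x+P(x,\mathbf{y})=0,\qquad\mathbf{M}\ddot{\mathbf{y}}+\mathbf{K}\mathbf{y}+\mathbf{Q}(x,\mathbf{y})=\mathbf{0}$$ can be approximated by $$\omega(r)=\omega_0+\omega_1r^2+\mathcal{O}(r^3),\qquad\omega_1=\frac{9(p_{30}+\hat p_{30})\omega_0^2-10p_{20}^2+3\hat s_{12}\omega_0^4}{24\omega_0^3},$$ where $p_{20}:=p_{2\mathbf{0}}$, $p_{30}:=p_{3\mathbf{0}}$, $\hat p_{30}:=\langle\mathbf{p}_{1\mathbf{I}},\mathbf{w}_{20}\rangle$ and $\hat s_{12}:=\langle\mathbf{p}_{1\mathbf{I}},\mathbf{w}_{02}\rangle$.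
   Context: Setting: a conservative (undamped, autonomous) mechanical system with $n+1$ degrees of freedom; $x\in\mathbb{R}$ and $\mathbf{y}\in\mathbb{R}^n$. $\mathbf{M}$ and $\mathbf{K}$ are the real $n\times n$ mass and stiffness matrices ($\mathbf{M}$ invertible), $\omega_0>0$ is the (linear) natural frequency of the $x$-mode, $\boldsymbol{\Omega}_{\mathrm p}^2:=\mathbf{M}^{-1}\mathbf{K}$, $\boldsymbol{\Omega}_{\mathrm p}^{-2}:=(\boldsymbol{\Omega}_{\mathrm p}^2)^{-1}$. The linearized $\mathbf{y}$-equation has the purely imaginary eigenvalues $\pm\mathrm{i}\omega_1,\dots,\pm\mathrm{i}\omega_n$ (so the eigenvalues of $\boldsymbol{\Omega}_{\mathrm p}^2$ are $\omega_1^2,\dots,\omega_n^2$); these natural frequencies $\omega_i$ appear only in the non-resonance condition and are unrelated to the coefficient $\omega_1$ in the expansion of $\omega(r)$. $P$ and $\mathbf{Q}$ are polynomials of degree at most $l$, $2\le l\le3$, without constant and linear terms: $P(x,\mathbf{y})=\sum_{j+|\mathbf{k}|=2}^{l}p_{j\mathbf{k}}x^jy_1^{k_1}\cdots y_n^{k_n}$, $\mathbf{Q}(x,\mathbf{y})=\sum_{j+|\mathbf{k}|=2}^{l}\mathbf{q}_{j\mathbf{k}}x^jy_1^{k_1}\cdots y_n^{k_n}$, $p_{j\mathbf{k}}\in\mathbb{R}$, $\mathbf{q}_{j\mathbf{k}}\in\mathbb{R}^n$, $\mathbf{k}\in\mathbb{N}^n$ (with $0\in\mathbb{N}$; coefficients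 of order higher than $l$ are zero). $\mathbf{0}$ is the zero index, $\mathbf{e}_j$ the $j$-th unit index, $\mathbf{p}_{1\mathbf{I}}:=[p_{1\mathbf{e}_1},\dots,p_{1\mathbf{e}_n}]^\top$, and $\langle\cdot,\cdot\rangle$ is the Euclidean inner product. Lyapunov subcenter manifold (LSM): it is known (Kelley) that under the non-resonance condition $\omega_i/\omega_0\notin\mathbb{Z}$, $i=1,\dots,n$, there is (near the origin) a unique, analytic, two-dimensional invariant manifold $\mathcal{W}=\{\mathbf{y}=\mathbf{w}(x,\dot x),\ \dot{\mathbf{y}}=\dot{\mathbf{w}}(x,\dot x)\}\subset\mathbb{R}^{2n+2}$, tangent to $\mathbf{y}=\dot{\mathbf{y}}=\mathbf{0}$ at the trivial fixed point and filled with periodic orbits ($\dot{\mathbf{w}}$ is the time derivative of $\mathbf{w}$ along trajectories in $\mathcal{W}$). Its Taylor coefficients are defined by $\mathbf{w}(x,\dot x)=\sum_{i+j\in\{2,3\}}\mathbf{w}_{ij}x^i\dot x^j+\mathcal{O}(|(x,\dot x)|^4)$, and explicitly $\mathbf{w}_{20}=-(\boldsymbol{\Omega}_{\mathrm p}^2-2\omega_0^2\mathbf{I})(\boldsymbol{\Omega}_{\mathrm p}^2-4\omega_0^2\mathbf{I})^{-1}\boldsymbol{\Omega}_{\mathrm p}^{-2}\mathbf{M}^{-1}\mathbf{q}_{2\mathbf{0}}$, $\mathbf{w}_{02}=2(\boldsymbol{\Omega}_{\mathrm p}^2-4\omega_0^2\mathbf{I})^{-1}\boldsymbol{\Omega}_{\mathrm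 p}^{-2}\mathbf{M}^{-1}\mathbf{q}_{2\mathbf{0}}$. Backbone curve: the set of ordered pairs $(r,\omega(r))$, where $\omega(r)$ is the angular frequency of the periodic orbit on $\mathcal{W}$ starting from the initial condition $(x,\dot x,\mathbf{y},\dot{\mathbf{y}})=(r,0,\mathbf{w}(r,0),\dot{\mathbf{w}}(r,0))\in\mathcal{W}$. *)

theory Defs
  imports "HOL-Analysis.Analysis" "HOL-Library.Landau_Symbols"
begin

section \<open>The mechanical system\<close>

text \<open>Multi-indices are functions \<open>'n \<Rightarrow> nat\<close> on the finite index type \<open>'n\<close>.\<close>

abbreviation multi_order :: "('n::finite \<Rightarrow> nat) \<Rightarrow> nat" where
  "multi_order k \<equiv> (\<Sum>i\<in>UNIV. k i)"

definition unit_index :: "'n \<Rightarrow> 'n \<Rightarrow> nat" where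
  "unit_index j = (\<lambda>i. if i = j then 1 else 0)"

definition poly_indices :: "nat \<Rightarrow> (nat \<times> ('n::finite \<Rightarrow> nat)) set" where
  "poly_indices l = {(j, k). 2 \<le> j + multi_order k \<and> j + multi_order k \<le> l}"

text \<open>The index set is finite, so the sum in \<open>nonlin_poly\<close> is not the default value of an
  infinite sum.\<close>

lemma finite_poly_indices: "finite (poly_indices l :: (nat \<times> ('n::finite \<Rightarrow> nat)) set)"
proof -
  have "k i \<le> l" if "j + multi_order k \<le> l" for i j and k :: "'n \<Rightarrow> nat"
    using member_le_sum[of i UNIV k] that by auto
  then have "poly_indices l \<subseteq> {..l} \<times> Pi\<^sub>E (UNIV :: 'n set) (\<lambda>_. {..l})"
    by (auto simp: poly_indices_def)
  moreover have "finite ({..l} \<times> Pi\<^sub>E (UNIV :: 'n set) (\<lambda>_. {..l}))"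
    by (intro finite_cartesian_product finite_PiE) auto
  ultimately show ?thesis
    by (rule finite_subset)
qed

text \<open>The same definition serves for the scalar \<open>P\<close> and the vector-valued \<open>Q\<close>.\<close>

definition nonlin_poly ::
  "nat \<Rightarrow> (nat \<Rightarrow> ('n::finite \<Rightarrow> nat) \<Rightarrow> 'b::real_vector) \<Rightarrow> real \<Rightarrow> real ^ 'n \<Rightarrow> 'b" where
  "nonlin_poly l c x y =
     (\<Sum>(j, k)\<in>poly_indices l. (x ^ j * (\<Prod>i\<in>UNIV. (y $ i) ^ k i)) *\<^sub>R c j k)"

text \<open>Eigenvalues of the linearized equation \<open>M y'' + K y = 0\<close>: the exponents \<open>\<mu>\<close> for which
  \<open>exp (\<mu> t) v\<close> is a solution for some nonzero complex \<open>v\<close>.\<close>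

definition linear_eigenvalues :: "real ^ 'n ^ 'n \<Rightarrow> real ^ 'n ^ 'n \<Rightarrow> complex set" where
  "linear_eigenvalues M K =
     {\<mu>. \<exists>v :: complex ^ 'n. v \<noteq> 0 \<and>
        (\<chi> i j. \<mu>\<^sup>2 * complex_of_real (M $ i $ j) + complex_of_real (K $ i $ j)) *v v = 0}"

type_synonym 'n state = "real \<times> real \<times> (real ^ 'n) \<times> (real ^ 'n)"

text \<open>A state is \<open>(x, x', y, y')\<close>. Derivatives are taken within \<open>J\<close>, hence one-sided at
  end points of \<open>J\<close> that belong to it.\<close>

definition mech_trajectory ::
  "real \<Rightarrow> real ^ 'n ^ 'n \<Rightarrow> real ^ 'n ^ 'n \<Rightarrow> (real \<Rightarrow> real ^ 'n \<Rightarrow> real) \<Rightarrow>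
   (real \<Rightarrow> real ^ 'n \<Rightarrow> real ^ 'n) \<Rightarrow> real set \<Rightarrow> (real \<Rightarrow> 'n::finite state) \<Rightarrow> bool" where
  "mech_trajectory \<omega>\<^sub>0 M K P Q J \<gamma> \<longleftrightarrow>
     (\<exists>x v y u. \<gamma> = (\<lambda>t. (x t, v t, y t, u t)) \<and>
       (\<forall>t\<in>J.
         (x has_real_derivative v t) (at t within J) \<and>
         (y has_vector_derivative u t) (at t within J) \<and>
         (\<exists>a. (v has_real_derivative a) (at t within J) \<and>
              a + \<omega>\<^sub>0\<^sup>2 * x t + P (x t) (y t) = 0) \<and>
         (\<exists>b. (u has_vector_derivative b) (at t within J) \<and>
              M *v b + K *v y t + Q (x t) (y t) = 0)))"

definition has_period :: "(real \<Rightarrow> 'a) \<Rightarrow> real \<Rightarrow> bool" where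
  "has_period f T \<longleftrightarrow> T > 0 \<and> (\<forall>t. f (t + T) = f t)"

definition has_minimal_period :: "(real \<Rightarrow> 'a) \<Rightarrow> real \<Rightarrow> bool" where
  "has_minimal_period f T \<longleftrightarrow> has_period f T \<and> (\<forall>S. has_period f S \<longrightarrow> T \<le> S)"


section \<open>Lyapunov subcenter manifold and backbone curve\<close>

text \<open>Real analyticity on a planar set: at every point, a locally convergent power series in two
  variables.\<close>

definition real_analytic2_on :: "(real \<times> real \<Rightarrow> real ^ 'n) \<Rightarrow> (real \<times> real) set \<Rightarrow> bool" where
  "real_analytic2_on f U \<longleftrightarrow>
     (\<forall>(x\<^sub>0, v\<^sub>0)\<in>U. \<exists>\<rho>>0. \<exists>a :: nat \<Rightarrow> nat \<Rightarrow> real ^ 'n.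
        \<forall>x v. \<bar>x - x\<^sub>0\<bar> < \<rho> \<and> \<bar>v - v\<^sub>0\<bar> < \<rho> \<longrightarrow>
          ((\<lambda>(i, j). ((x - x\<^sub>0) ^ i * (v - v\<^sub>0) ^ j) *\<^sub>R a i j) has_sum f (x, v)) UNIV)"

definition graph_manifold ::
  "(real \<times> real) set \<Rightarrow> (real \<times> real \<Rightarrow> real ^ 'n) \<Rightarrow> (real \<times> real \<Rightarrow> real ^ 'n) \<Rightarrow> 'n::finite state set"
  where "graph_manifold U w w' = {(x, v, w (x, v), w' (x, v)) | x v. (x, v) \<in> U}"

text \<open>The function \<open>w'\<close> is the one written as \<open>w\<close> with a dot. That it is the time derivative of
  \<open>w\<close> along trajectories in the manifold is a consequence of invariance, as the last component of a
  trajectory is the derivative of the third one.\<close>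

definition lyapunov_subcenter_manifold ::
  "real \<Rightarrow> real ^ 'n ^ 'n \<Rightarrow> real ^ 'n ^ 'n \<Rightarrow> (real \<Rightarrow> real ^ 'n \<Rightarrow> real) \<Rightarrow>
   (real \<Rightarrow> real ^ 'n \<Rightarrow> real ^ 'n) \<Rightarrow> (real \<times> real) set \<Rightarrow>
   (real \<times> real \<Rightarrow> real ^ 'n) \<Rightarrow> (real \<times> real \<Rightarrow> real ^ 'n::finite) \<Rightarrow> bool" where
  "lyapunov_subcenter_manifold \<omega>\<^sub>0 M K P Q U w w' \<longleftrightarrow>
     open U \<and> (0, 0) \<in> U \<and>
     real_analytic2_on w U \<and> real_analytic2_on w' U \<and>
     w (0, 0) = 0 \<and> w' (0, 0) = 0 \<and>
     (w has_derivative (\<lambda>_. 0)) (at (0, 0)) \<and> (w' has_derivative (\<lambda>_. 0)) (at (0, 0)) \<and>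
     (\<forall>J \<gamma>. is_interval J \<and> 0 \<in> J \<and> mech_trajectory \<omega>\<^sub>0 M K P Q J \<gamma> \<and>
        \<gamma> 0 \<in> graph_manifold U w w' \<longrightarrow> \<gamma> ` J \<subseteq> graph_manifold U w w') \<and>
     (\<forall>z\<in>graph_manifold U w w'. \<exists>\<gamma> T.
        mech_trajectory \<omega>\<^sub>0 M K P Q UNIV \<gamma> \<and> \<gamma> 0 = z \<and> has_period \<gamma> T)"

text \<open>The fixed point itself has no minimal period, so there is no pair with \<open>r = 0\<close>.\<close>

definition backbone_curve ::
  "real \<Rightarrow> real ^ 'n ^ 'n \<Rightarrow> real ^ 'n ^ 'n \<Rightarrow> (real \<Rightarrow> real ^ 'n \<Rightarrow> real) \<Rightarrow>
   (real \<Rightarrow> real ^ 'n \<Rightarrow> real ^ 'n) \<Rightarrow> (real \<times> real) set \<Rightarrow>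
   (real \<times> real \<Rightarrow> real ^ 'n) \<Rightarrow> (real \<times> real \<Rightarrow> real ^ 'n::finite) \<Rightarrow> (real \<times> real) set" where
  "backbone_curve \<omega>\<^sub>0 M K P Q U w w' =
     {(r, 2 * pi / T) | r T. (r, 0) \<in> U \<and>
        (\<exists>\<gamma>. mech_trajectory \<omega>\<^sub>0 M K P Q UNIV \<gamma> \<and> \<gamma> 0 = (r, 0, w (r, 0), w' (r, 0)) \<and>
             has_minimal_period \<gamma> T)}"

definition has_taylor_coeffs_2_3 ::
  "(real \<times> real \<Rightarrow> real ^ 'n) \<Rightarrow> (nat \<Rightarrow> nat \<Rightarrow> real ^ 'n) \<Rightarrow> bool" where
  "has_taylor_coeffs_2_3 w W \<longleftrightarrow>
     (\<lambda>(x, v). norm (w (x, v) - (\<Sum>(i, j) | i + j \<in> {2, 3}. (x ^ i * v ^ j) *\<^sub>R W i j)))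
       \<in> O[nhds (0, 0)](\<lambda>z. norm z ^ 4)"

end

theory Submission
  imports Defs
begin

text \<open>Write \<open>c = \<omega>\<^sub>0 x + \<i> v\<close> with \<open>v\<close> the velocity of \<open>x\<close>. On the manifold \<open>y = w (x, v)\<close>, so the motion there is a
planar equation \<open>c' = - \<i> (\<omega>\<^sub>0 c + F c)\<close> whose nonlinearity \<open>F c = P (x, w (x, v))\<close> vanishes to second
order. Three things have to be found: the second-order coefficients of \<open>w\<close>, the minimal period of
each small orbit, and the expansion of that period.

\<^item> Coefficients. For a start point of size \<open>r\<close> the orbit is a rotation up to \<open>O(r\<^sup>2)\<close>, so that along it \<open>y\<close>
  equals \<open>r\<^sup>2\<close> times the quadratic part of \<open>w\<close>, evaluated on a rotating unit vector, up to \<open>O(r\<^sup>3)\<close>. The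
  second difference of \<open>y\<close> in time is given by the equation of motion. Letting first \<open>r\<close> and then the time
  step tend to \<open>0\<close> gives a linear system for the coefficients (\<open>quadratic_invariance\<close>), which
  non-resonance makes uniquely solvable (\<open>quadratic_coefficients\<close>). In particular the coefficient
  \<open>w\<^sub>1\<^sub>1\<close> vanishes, so the planar equation has no term \<open>x\<^sup>2 v\<close> at third order.

\<^item> Minimal period. The orbits are known to be periodic, but nothing is known beforehand about the size
  of their periods. A small orbit starting on the positive axis turns around the origin and meets this
  axis again after a time close to \<open>2 \<pi> / \<omega>\<^sub>0\<close>. The map to this first return is strictly monotone
  (\<open>return_map_strict_mono\<close>), so an orbit that comes back inside its start point moves inwards at every
  further turn and can never close; applied to the reversed motion, the same argument excludes a return
  outside. Hence the orbit closes at the first return, and the time of this return is the minimal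
  period (\<open>minimal_period_is_first_return\<close>).

\<^item> Expansion. A near-identity polynomial change of variables \<open>\<zeta> = c + \<dots>\<close> removes all terms of order two and
  all terms of order three except the resonant one, \<open>c\<^sup>2 cnj c\<close>. Then \<open>\<zeta>' = - \<i> (\<omega>\<^sub>0 + \<sigma> |c|\<^sup>2) \<zeta>\<close> up to an
  error of order four, while \<open>|c|\<^sup>2\<close> is constant up to order three. After one period \<open>\<zeta>\<close> returns to its
  start value, so its phase is an exact multiple of \<open>2 \<pi>\<close>; this determines the period with a relative error
  \<open>O(r\<^sup>3)\<close> (\<open>return_time_expansion\<close>). The resonant coefficient \<open>\<sigma> \<omega>\<^sub>0\<^sup>2\<close> is the number claimed for \<open>\<omega>\<^sub>1\<close>.\<close>


section \<open>Weakly nonlinear oscillators in the plane\<close>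

text \<open>Scaling the position by \<open>\<omega>\<close> turns the linear part of \<open>x' = v\<close>, \<open>v' = - \<omega>\<^sup>2 x - F\<close> into a rigid clockwise
rotation of \<open>c = \<omega> x + \<i> v\<close>; the nonlinearity acts on the velocity only.\<close>

definition oscillation :: "real \<Rightarrow> (complex \<Rightarrow> real) \<Rightarrow> (real \<Rightarrow> complex) \<Rightarrow> bool" where
  "oscillation \<omega> F c \<longleftrightarrow>
     (\<forall>t. (c has_vector_derivative - \<i> * (of_real \<omega> * c t + of_real (F (c t)))) (at t))"

lemma norm_diff_le_of_vector_derivative:
  fixes g :: "real \<Rightarrow> 'a::real_normed_vector"
  assumes "p \<le> q"
    and "\<And>t. p \<le> t \<Longrightarrow> t \<le> q \<Longrightarrow> (g has_vector_derivative g' t) (at t)"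
    and "\<And>t. p \<le> t \<Longrightarrow> t \<le> q \<Longrightarrow> norm (g' t) \<le> B"
  shows "norm (g q - g p) \<le> B * (q - p)"
proof -
  have "norm (g q - g p) \<le> B * norm (q - p)"
  proof (rule differentiable_bound[of "{p..q}" g "\<lambda>t h. h *\<^sub>R g' t"])
    fix t assume t: "t \<in> {p..q}"
    show "(g has_derivative (\<lambda>h. h *\<^sub>R g' t)) (at t within {p..q})"
      using assms(2) t by (auto simp: has_vector_derivative_def intro: has_derivative_at_withinI)
    show "onorm (\<lambda>h. h *\<^sub>R g' t) \<le> B"
      using assms(3) t by (intro onorm_le) (auto simp: mult.commute[of B] intro!: mult_left_mono)
  qed (use assms in auto)
  then show ?thesis using assms(1) by simp
qed

lemma abs_le_two_abs_sin:
  fixes \<phi> :: real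
  assumes "\<bar>\<phi>\<bar> \<le> pi / 3"
  shows "\<bar>\<phi>\<bar> \<le> 2 * \<bar>sin \<phi>\<bar>"
proof -
  have *: "\<psi> \<le> 2 * sin \<psi>" if \<psi>: "0 \<le> \<psi>" "\<psi> \<le> pi / 3" for \<psi> :: real
  proof -
    have "2 * sin 0 - 0 \<le> 2 * sin \<psi> - \<psi>"
    proof (rule DERIV_nonneg_imp_nondecreasing[OF \<psi>(1)])
      fix x assume x: "0 \<le> x" "x \<le> \<psi>"
      have "cos x \<ge> cos (pi / 3)"
        using x \<psi> by (intro cos_monotone_0_pi_le) auto
      then have "0 \<le> 2 * cos x - 1" by (simp add: cos_60)
      moreover have "((\<lambda>x. 2 * sin x - x) has_real_derivative 2 * cos x - 1) (at x)"
        by (auto intro!: derivative_eq_intros)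
      ultimately show "\<exists>y. ((\<lambda>x. 2 * sin x - x) has_real_derivative y) (at x) \<and> 0 \<le> y"
        by blast
    qed
    then show ?thesis by simp
  qed
  show ?thesis
  proof (cases "\<phi> \<ge> 0")
    case True
    with *[of \<phi>] assms show ?thesis by auto
  next
    case False
    with *[of "- \<phi>"] assms show ?thesis by auto
  qed
qed

lemma oscillation_shift:
  assumes "oscillation \<omega> F c" shows "oscillation \<omega> F (\<lambda>t. c (a + t))"
  unfolding oscillation_def
proof
  fix t
  have "(c has_vector_derivative - \<i> * (of_real \<omega> * c (a + t) + of_real (F (c (a + t))))) (at (a + t))"
    using assms by (simp add: oscillation_def)
  moreover have "((\<lambda>t. a + t) has_vector_derivative 1) (at t)"
    by (auto intro!: derivative_eq_intros)
  ultimately show "((\<lambda>t. c (a + t)) has_vector_derivative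
      - \<i> * (of_real \<omega> * c (a + t) + of_real (F (c (a + t))))) (at t)"
    using vector_diff_chain_at[of "\<lambda>t. a + t" 1 t c] by (simp add: o_def)
qed

text \<open>The velocity changes sign under time reversal, so in the complex coordinate reversal is conjugation. It
only replaces \<open>F\<close> by \<open>F \<circ> cnj\<close>, hence statements about returning orbits also hold backwards in time.\<close>

lemma oscillation_reverse:
  assumes "oscillation \<omega> F c"
  shows "oscillation \<omega> (\<lambda>z. F (cnj z)) (\<lambda>t. cnj (c (a - t)))"
  unfolding oscillation_def
proof
  fix t
  have "(c has_vector_derivative - \<i> * (of_real \<omega> * c (a - t) + of_real (F (c (a - t))))) (at (a - t))"
    using assms by (simp add: oscillation_def)
  moreover have "((\<lambda>t. a - t) has_vector_derivative -1) (at t)"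
    by (auto intro!: derivative_eq_intros)
  ultimately have "((\<lambda>t. c (a - t)) has_vector_derivative
      \<i> * (of_real \<omega> * c (a - t) + of_real (F (c (a - t))))) (at t)"
    using vector_diff_chain_at[of "\<lambda>t. a - t" "-1" t c] by (fastforce simp: o_def)
  from has_vector_derivative_cnj[OF this]
  show "((\<lambda>t. cnj (c (a - t))) has_vector_derivative
      - \<i> * (of_real \<omega> * cnj (c (a - t)) + of_real (F (cnj (cnj (c (a - t))))))) (at t)"
    by simp
qed

text \<open>The half turn exchanges the two half-axes and will reduce negative start positions to positive ones.\<close>

lemma oscillation_uminus:
  assumes "oscillation \<omega> F c"
  shows "oscillation \<omega> (\<lambda>z. - F (- z)) (\<lambda>t. - c t)"
  unfolding oscillation_def
proof
  fix t
  have "((\<lambda>t. - c t) has_vector_derivative - (- \<i> * (of_real \<omega> * c t + of_real (F (c t))))) (at t)"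
    using assms by (intro has_vector_derivative_minus) (auto simp: oscillation_def)
  then show "((\<lambda>t. - c t) has_vector_derivative
      - \<i> * (of_real \<omega> * - c t + of_real (- F (- (- c t))))) (at t)"
    by (simp add: algebra_simps)
qed

lemma oscillation_continuous:
  assumes "oscillation \<omega> F c" shows "continuous_on A c"
  using assms unfolding oscillation_def
  by (intro continuous_at_imp_continuous_on) (blast intro: has_vector_derivative_continuous)

text \<open>The section is the open positive real half-axis, that is, zero velocity at a positive position.\<close>

definition first_return :: "(real \<Rightarrow> complex) \<Rightarrow> real \<Rightarrow> bool" where
  "first_return c \<tau> \<longleftrightarrow> \<tau> > 0 \<and> Im (c \<tau>) = 0 \<and> Re (c \<tau>) > 0 \<and>
     (\<forall>t. 0 < t \<and> t < \<tau> \<longrightarrow> \<not> (Im (c t) = 0 \<and> Re (c t) > 0))"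

lemma first_return_unique:
  assumes "first_return c \<tau>" "first_return c \<tau>'" shows "\<tau> = \<tau>'"
  using assms unfolding first_return_def by (metis linorder_neqE)

lemma has_period_reverse: "has_period c T \<Longrightarrow> has_period (\<lambda>t. cnj (c (a - t))) T"
  unfolding has_period_def by (metis add_diff_cancel_right' diff_add_cancel diff_diff_eq)

text \<open>A Lipschitz constant proportional to the radius is what a function with vanishing value and gradient at
\<open>0\<close> has. It makes the effect of \<open>F\<close> over a bounded time small relative to the linear motion, both for one
solution and for the difference of two.\<close>

locale weak_oscillator =
  fixes \<omega> L \<epsilon>\<^sub>0 :: real and F :: "complex \<Rightarrow> real"
  assumes \<omega>_pos: "\<omega> > 0" and L_pos: "L > 0" and \<epsilon>\<^sub>0_pos: "\<epsilon>\<^sub>0 > 0"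
    and F_0: "F 0 = 0"
    and F_lipschitz: "\<And>\<epsilon> a b. \<epsilon> \<le> \<epsilon>\<^sub>0 \<Longrightarrow> norm a \<le> \<epsilon> \<Longrightarrow> norm b \<le> \<epsilon> \<Longrightarrow>
                        \<bar>F a - F b\<bar> \<le> L * \<epsilon> * norm (a - b)"
begin

text \<open>One and a half periods of the linear motion: the first return to the positive axis happens within this
time, the second one does not.\<close>

definition horizon :: real where "horizon = 3 * pi / \<omega>"

text \<open>Solutions that start within radius \<open>s\<close> stay within \<open>2 s\<close>, which must not exceed \<open>\<epsilon>\<^sub>0\<close>. The factor \<open>400\<close> bounds
the accumulated effect of \<open>F\<close> over the whole horizon by one percent of the amplitude.\<close>

definition small_amplitude :: "real \<Rightarrow> bool" where
  "small_amplitude s \<longleftrightarrow> 0 < s \<and> 2 * s \<le> \<epsilon>\<^sub>0 \<and> 400 * (horizon * L) * s \<le> 1"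

lemma horizon_pos: "horizon > 0"
  using \<omega>_pos by (simp add: horizon_def)

lemma small_amplitude_mono: "small_amplitude s \<Longrightarrow> 0 < r \<Longrightarrow> r \<le> s \<Longrightarrow> small_amplitude r"
proof -
  assume a: "small_amplitude s" "0 < r" "r \<le> s"
  then have "400 * (horizon * L) * r \<le> 400 * (horizon * L) * s"
    using horizon_pos L_pos by (intro mult_left_mono) auto
  then show ?thesis using a by (auto simp: small_amplitude_def)
qed

lemma small_amplitude_le_\<omega>:
  assumes "small_amplitude s" shows "L * s \<le> \<omega> / 3600"
proof -
  have "400 * (horizon * L) * s \<le> 1" using assms by (simp add: small_amplitude_def)
  then have "1200 * pi * (L * s) \<le> \<omega>"
    using \<omega>_pos by (simp add: horizon_def field_simps)
  moreover have "1200 * 3 * (L * s) \<le> 1200 * pi * (L * s)"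
    using pi_gt3 L_pos assms by (intro mult_right_mono) (auto simp: small_amplitude_def)
  ultimately show ?thesis by (simp add: mult_ac)
qed

text \<open>In the frame that rotates with the linear motion only the nonlinearity moves a solution.\<close>

abbreviation rotating :: "(real \<Rightarrow> complex) \<Rightarrow> real \<Rightarrow> complex" where
  "rotating c t \<equiv> cis (\<omega> * t) * c t"

lemma rotating_derivative:
  assumes "oscillation \<omega> F c"
  shows "(rotating c has_vector_derivative - \<i> * cis (\<omega> * t) * of_real (F (c t))) (at t)"
proof -
  have "(c has_vector_derivative - \<i> * (of_real \<omega> * c t + of_real (F (c t)))) (at t)"
    using assms by (simp add: oscillation_def)
  moreover have "((\<lambda>t. cis (\<omega> * t)) has_vector_derivative \<omega> *\<^sub>R (\<i> * cis (\<omega> * t))) (at t)"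
    by (auto intro!: derivative_eq_intros simp: complex_eq_iff has_vector_derivative_complex_iff)
  ultimately have "(rotating c has_vector_derivative
      cis (\<omega> * t) * (- \<i> * (of_real \<omega> * c t + of_real (F (c t)))) + \<omega> *\<^sub>R (\<i> * cis (\<omega> * t)) * c t) (at t)"
    by (rule has_vector_derivative_mult[rotated])
  then show ?thesis by (simp add: algebra_simps scaleR_conv_of_real)
qed

lemma norm_rotating [simp]: "norm (rotating c t) = norm (c t)"
  by (simp add: norm_mult)

text \<open>Up to the first time at which the radius reaches \<open>2 s\<close> the rotating coordinate can have moved by at most
\<open>s / 100\<close>, which is not enough to reach \<open>2 s\<close> from \<open>s\<close>.\<close>

lemma stays_small:
  assumes c: "oscillation \<omega> F c" and s: "small_amplitude s" "norm (c 0) \<le> s"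
    and t: "0 \<le> t" "t \<le> horizon"
  shows "norm (c t) \<le> 2 * s"
proof (rule ccontr)
  assume "\<not> norm (c t) \<le> 2 * s"
  then have big: "norm (c t) > 2 * s" by simp
  have s0: "s > 0" "2 * s \<le> \<epsilon>\<^sub>0" "400 * (horizon * L) * s \<le> 1"
    using s by (auto simp: small_amplitude_def)
  have cont: "continuous_on A (\<lambda>t. norm (c t))" for A
    by (intro continuous_intros oscillation_continuous[OF c])
  define H where "H = {u \<in> {0..t}. norm (c u) = 2 * s}"
  have hit: "\<exists>u'. 0 \<le> u' \<and> u' \<le> u \<and> norm (c u') = 2 * s" if "0 \<le> u" "norm (c u) \<ge> 2 * s" for u
    using IVT'[of "\<lambda>t. norm (c t)" 0 "2 * s" u] that cont s s0 by auto
  have "H \<noteq> {}" using hit[of t] big t by (force simp: H_def)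
  moreover have "compact H"
  proof -
    have "closed H" unfolding H_def
      using continuous_closed_preimage_constant[OF cont, of "{0..t}" "2 * s"] by simp
    moreover have "bounded H" by (rule bounded_subset[of "{0..t}"]) (auto simp: H_def)
    ultimately show ?thesis by (simp add: compact_eq_bounded_closed)
  qed
  \<comment> \<open>The first time at which the radius equals \<open>2 s\<close>.\<close>
  ultimately obtain e where e: "e \<in> H" "\<And>u. u \<in> H \<Longrightarrow> e \<le> u"
    using compact_attains_inf[of H] by blast
  have le: "norm (c u) \<le> 2 * s" if "0 \<le> u" "u \<le> e" for u
  proof (rule ccontr)
    assume g: "\<not> norm (c u) \<le> 2 * s"
    with hit[of u] that obtain u' where "0 \<le> u'" "u' \<le> u" "norm (c u') = 2 * s" by auto
    with e that g have "u' = u" by (force simp: H_def)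
    with g \<open>norm (c u') = 2 * s\<close> show False by simp
  qed
  have "norm (rotating c e - rotating c 0) \<le> (L * (2 * s) * (2 * s)) * (e - 0)"
  proof (rule norm_diff_le_of_vector_derivative)
    fix u assume u: "0 \<le> u" "u \<le> e"
    show "(rotating c has_vector_derivative - \<i> * cis (\<omega> * u) * of_real (F (c u))) (at u)"
      by (rule rotating_derivative[OF c])
    have "\<bar>F (c u) - F 0\<bar> \<le> L * (2 * s) * norm (c u - 0)"
      using le[OF u] s0 by (intro F_lipschitz) auto
    also have "\<dots> \<le> L * (2 * s) * (2 * s)"
      using le[OF u] s0 L_pos by (intro mult_left_mono) auto
    finally show "norm (- \<i> * cis (\<omega> * u) * of_real (F (c u))) \<le> L * (2 * s) * (2 * s)"
      by (simp add: norm_mult F_0)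
  qed (use e in \<open>auto simp: H_def\<close>)
  also have "\<dots> \<le> (L * (2 * s) * (2 * s)) * horizon"
    using e t s0 L_pos by (intro mult_left_mono) (auto simp: H_def)
  also have "\<dots> = (400 * (horizon * L) * s) * (s / 100)" by (simp add: field_simps)
  also have "\<dots> \<le> 1 * (s / 100)" using s0 by (intro mult_right_mono) auto
  finally have "norm (rotating c e - rotating c 0) \<le> s / 100" by simp
  moreover have "norm (rotating c e) = 2 * s" "norm (rotating c 0) \<le> s"
    using e s by (auto simp: H_def norm_mult)
  ultimately show False
    using norm_triangle_ineq2[of "rotating c e" "rotating c 0"] s0 by linarith
qed

text \<open>The growth rate of the difference is proportional to the difference itself. Its maximum over the horizon
is attained, and as the rate is small the maximum is at most twice the initial difference; inserting this
into the integrated rate gives the bound. Comparison with the zero solution controls a single solution.\<close>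

lemma rotating_difference:
  assumes c1: "oscillation \<omega> F c1" and c2: "oscillation \<omega> F c2"
    and s: "small_amplitude s" "norm (c1 0) \<le> s" "norm (c2 0) \<le> s"
    and t: "0 \<le> t" "t \<le> horizon"
  shows "norm ((rotating c1 t - rotating c2 t) - (c1 0 - c2 0)) \<le> 4 * (horizon * L) * s * norm (c1 0 - c2 0)"
proof -
  define d where "d = (\<lambda>t. rotating c1 t - rotating c2 t)"
  define k where "k = horizon * L"
  have s0: "s > 0" "2 * s \<le> \<epsilon>\<^sub>0" "400 * k * s \<le> 1"
    using s by (auto simp: small_amplitude_def k_def)
  have k: "k > 0" using horizon_pos L_pos by (simp add: k_def)
  have nd: "norm (d t) = norm (c1 t - c2 t)" for t
    by (simp add: d_def right_diff_distrib[symmetric] norm_mult)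
  have "continuous_on {0..horizon} (\<lambda>t. norm (d t))"
    unfolding nd by (intro continuous_intros oscillation_continuous[OF c1] oscillation_continuous[OF c2])
  then obtain m where m: "m \<in> {0..horizon}" "\<And>u. u \<in> {0..horizon} \<Longrightarrow> norm (d u) \<le> norm (d m)"
    using continuous_attains_sup[of "{0..horizon}" "\<lambda>t. norm (d t)"] horizon_pos by auto
  have diff: "norm (d u - d 0) \<le> 2 * k * s * norm (d m)" if u: "0 \<le> u" "u \<le> horizon" for u
  proof -
    have "norm (d u - d 0) \<le> (L * (2 * s) * norm (d m)) * (u - 0)"
    proof (rule norm_diff_le_of_vector_derivative)
      fix v assume v: "0 \<le> v" "v \<le> u"
      show "(d has_vector_derivative - \<i> * cis (\<omega> * v) * of_real (F (c1 v)) -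
              - \<i> * cis (\<omega> * v) * of_real (F (c2 v))) (at v)"
        unfolding d_def
        by (intro has_vector_derivative_diff rotating_derivative c1 c2)
      have "norm (- \<i> * cis (\<omega> * v) * of_real (F (c1 v)) - - \<i> * cis (\<omega> * v) * of_real (F (c2 v)))
          = norm (- \<i> * cis (\<omega> * v) * of_real (F (c1 v) - F (c2 v)))"
        by (simp add: algebra_simps)
      also have "\<dots> = \<bar>F (c1 v) - F (c2 v)\<bar>"
        by (simp add: norm_mult del: of_real_diff)
      also have "\<dots> \<le> L * (2 * s) * norm (c1 v - c2 v)"
        using v u s s0 by (intro F_lipschitz stays_small c1 c2) auto
      also have "\<dots> \<le> L * (2 * s) * norm (d m)"
        using m(2)[of v] v u L_pos s0 by (intro mult_left_mono) (auto simp: nd)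
      finally show "norm (- \<i> * cis (\<omega> * v) * of_real (F (c1 v)) - - \<i> * cis (\<omega> * v) * of_real (F (c2 v)))
          \<le> L * (2 * s) * norm (d m)" .
    qed (use u in auto)
    also have "\<dots> \<le> (L * (2 * s) * norm (d m)) * horizon"
      using u s0 L_pos by (intro mult_left_mono) auto
    finally show ?thesis by (simp add: k_def mult_ac)
  qed
  have "k * s \<le> 1 / 4" using s0 by simp
  then have "2 * k * s * norm (d m) \<le> norm (d m) / 2"
    using mult_right_mono[of "k * s" "1/4" "2 * norm (d m)"] by (simp add: mult_ac)
  with diff[of m] m norm_triangle_ineq2[of "d m" "d 0"] have "norm (d m) \<le> 2 * norm (d 0)"
    by auto
  then have "2 * k * s * norm (d m) \<le> 2 * k * s * (2 * norm (d 0))"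
    using k s0 by (intro mult_left_mono) auto
  with diff[OF t] have "norm (d t - d 0) \<le> 4 * k * s * norm (d 0)" by linarith
  then show ?thesis by (simp add: d_def k_def)
qed

lemma zero_oscillation: "oscillation \<omega> F (\<lambda>_. 0)"
  by (simp add: oscillation_def F_0)

lemma rotating_almost_constant:
  assumes c: "oscillation \<omega> F c" and s: "small_amplitude s" "norm (c 0) \<le> s"
    and t: "0 \<le> t" "t \<le> horizon"
  shows "norm (rotating c t - c 0) \<le> 4 * (horizon * L) * s * norm (c 0)"
  using rotating_difference[OF c zero_oscillation s(1,2) _ t] s by (simp add: small_amplitude_def)

lemma rotating_almost_constant':
  assumes c: "oscillation \<omega> F c" and s: "small_amplitude s" "norm (c 0) \<le> s"
    and t: "0 \<le> t" "t \<le> horizon"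
  shows "norm (rotating c t - c 0) \<le> norm (c 0) / 100"
proof -
  have "4 * (horizon * L) * s * norm (c 0) \<le> norm (c 0) / 100"
    using mult_right_mono[of "400 * (horizon * L) * s" 1 "norm (c 0) / 100"] s
    by (simp add: small_amplitude_def mult_ac)
  then show ?thesis using rotating_almost_constant[OF assms] by linarith
qed

lemma oscillation_unique:
  assumes "oscillation \<omega> F c1" "oscillation \<omega> F c2" "small_amplitude s" "norm (c1 0) \<le> s" "c1 0 = c2 0"
    and "0 \<le> t" "t \<le> horizon"
  shows "c1 t = c2 t"
  using rotating_difference[OF assms(1-4) _ assms(6,7)] assms(4,5)
  by (auto simp: right_diff_distrib[symmetric])

lemma Im_derivative:
  assumes "oscillation \<omega> F c"
  shows "((\<lambda>t. Im (c t)) has_real_derivative - (\<omega> * Re (c t) + F (c t))) (at t)"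
  using assms unfolding oscillation_def has_vector_derivative_complex_iff by auto

lemma Re_derivative:
  assumes "oscillation \<omega> F c"
  shows "((\<lambda>t. Re (c t)) has_real_derivative \<omega> * Im (c t)) (at t)"
  using assms unfolding oscillation_def has_vector_derivative_complex_iff by auto

lemma unrotate:
  "Re (c t) = cos (\<omega> * t) * Re (rotating c t) + sin (\<omega> * t) * Im (rotating c t)"
  "Im (c t) = cos (\<omega> * t) * Im (rotating c t) - sin (\<omega> * t) * Re (rotating c t)"
proof -
  have "c t = cis (- (\<omega> * t)) * rotating c t"
    by (simp add: mult.assoc[symmetric] cis_mult)
  then show
    "Re (c t) = cos (\<omega> * t) * Re (rotating c t) + sin (\<omega> * t) * Im (rotating c t)"
    "Im (c t) = cos (\<omega> * t) * Im (rotating c t) - sin (\<omega> * t) * Re (rotating c t)"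
    by (metis Re_complex_of_real cis.simps complex_Re_of_int cos_minus diff_minus_eq_add minus_mult_left mult.commute sin_minus times_complex.sel(1),
        metis cis.simps cos_minus diff_minus_eq_add minus_mult_left sin_minus times_complex.sel(2) uminus_add_conv_diff add.commute)
qed


text \<open>Where the linear phase is within \<open>\<pi> / 3\<close> of the positive axis, the linear restoring force dominates \<open>F\<close>, so
the axis is crossed transversally and downwards.\<close>

lemma window_decreasing:
  assumes c: "oscillation \<omega> F c" "c 0 = of_real s" "small_amplitude s"
    and t: "0 \<le> t" "t \<le> horizon" "cos (\<omega> * t) \<ge> 1 / 2"
  shows "Re (c t) > 0" "\<omega> * Re (c t) + F (c t) \<ge> 3 / 10 * \<omega> * s"
proof -
  have s0: "s > 0" "2 * s \<le> \<epsilon>\<^sub>0" using c(3) by (auto simp: small_amplitude_def)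
  have n0: "norm (c 0) = s" using c s0 by simp
  have b: "norm (rotating c t - of_real s) \<le> s / 100"
    using rotating_almost_constant'[OF c(1,3) _ t(1,2)] n0 c(2) by simp
  have re: "Re (rotating c t) \<ge> 99 / 100 * s"
    using abs_Re_le_cmod[of "rotating c t - of_real s"] b by simp
  have im: "\<bar>Im (rotating c t)\<bar> \<le> s / 100"
    using abs_Im_le_cmod[of "rotating c t - of_real s"] b by simp
  have "\<bar>sin (\<omega> * t) * Im (rotating c t)\<bar> \<le> 1 * (s / 100)"
    unfolding abs_mult using im abs_sin_le_one s0 by (intro mult_mono) auto
  moreover have "cos (\<omega> * t) * Re (rotating c t) \<ge> (1 / 2) * (99 / 100 * s)"
    using re t s0 by (intro mult_mono) auto
  ultimately have x: "Re (c t) \<ge> 4 / 10 * s"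
    using s0 unfolding unrotate(1)[of c t] by linarith
  then show "Re (c t) > 0" using s0 by auto
  have "norm (c t) \<le> 2 * s" using stays_small[OF c(1,3) _ t(1,2)] n0 by simp
  then have "\<bar>F (c t) - F 0\<bar> \<le> L * (2 * s) * norm (c t - 0)"
    using s0 by (intro F_lipschitz) auto
  also have "\<dots> \<le> L * (2 * s) * (2 * s)"
    using \<open>norm (c t) \<le> 2 * s\<close> s0 L_pos by (intro mult_left_mono) auto
  also have "\<dots> = 4 * s * (L * s)" by simp
  also have "\<dots> \<le> 4 * s * (\<omega> / 3600)"
    using small_amplitude_le_\<omega>[OF c(3)] s0 by (intro mult_left_mono) auto
  finally have "\<bar>F (c t)\<bar> \<le> \<omega> * s / 900" by (simp add: F_0)
  moreover have "\<omega> * Re (c t) \<ge> \<omega> * (4 / 10 * s)"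
    using x \<omega>_pos by (intro mult_left_mono) auto
  moreover have "\<omega> * s > 0" using \<omega>_pos s0 by simp
  ultimately show "\<omega> * Re (c t) + F (c t) \<ge> 3 / 10 * \<omega> * s" by linarith
qed

text \<open>On the positive axis the rotating coordinate has phase \<open>\<omega> t\<close>, and it is close to its start value \<open>s > 0\<close>.\<close>

lemma crossing_in_window:
  assumes c: "oscillation \<omega> F c" "c 0 = of_real s" "small_amplitude s"
    and t: "0 \<le> t" "t \<le> horizon" "Im (c t) = 0" "Re (c t) > 0"
  shows "cos (\<omega> * t) > 1 / 2"
proof (rule ccontr)
  assume a: "\<not> cos (\<omega> * t) > 1 / 2"
  have s0: "s > 0" using c(3) by (auto simp: small_amplitude_def)
  have n0: "norm (c 0) = s" using c s0 by simp
  have b: "norm (rotating c t - of_real s) \<le> s / 100"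
    using rotating_almost_constant'[OF c(1,3) _ t(1,2)] n0 c(2) by simp
  have "Re (rotating c t) = cos (\<omega> * t) * Re (c t)" using t by simp
  also have "\<dots> \<le> 1 / 2 * Re (c t)" using a t by (intro mult_right_mono) auto
  finally have 1: "Re (rotating c t) \<le> 1 / 2 * norm (c t)"
    using complex_Re_le_cmod[of "c t"] by linarith
  have 2: "Re (rotating c t) \<ge> 99 / 100 * s"
    using abs_Re_le_cmod[of "rotating c t - of_real s"] b by simp
  have "norm (rotating c t) \<le> norm (rotating c t - of_real s) + norm (of_real s :: complex)"
    by (metis diff_add_cancel norm_triangle_ineq)
  then have "norm (c t) \<le> s / 100 + s" using b s0 unfolding norm_rotating by simp
  with 1 2 s0 show False by simp
qed

lemma Im_strictly_decreasing:
  assumes c: "oscillation \<omega> F c" "c 0 = of_real s" "small_amplitude s"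
    and t: "0 \<le> t1" "t1 \<le> t2" "t2 \<le> horizon"
    and w: "\<And>t. t1 \<le> t \<Longrightarrow> t \<le> t2 \<Longrightarrow> cos (\<omega> * t) \<ge> 1 / 2"
  shows "Im (c t1) - Im (c t2) \<ge> 3 / 10 * \<omega> * s * (t2 - t1)"
proof -
  have "Im (c t2) + 3 / 10 * \<omega> * s * t2 \<le> Im (c t1) + 3 / 10 * \<omega> * s * t1"
  proof (rule DERIV_nonpos_imp_nonincreasing[OF t(2)])
    fix t assume tt: "t1 \<le> t" "t \<le> t2"
    have "((\<lambda>t. Im (c t) + 3 / 10 * \<omega> * s * t) has_real_derivative
        - (\<omega> * Re (c t) + F (c t)) + 3 / 10 * \<omega> * s) (at t)"
      by (intro DERIV_add Im_derivative[OF c(1)]) (auto intro!: derivative_eq_intros)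
    moreover have "- (\<omega> * Re (c t) + F (c t)) + 3 / 10 * \<omega> * s \<le> 0"
      using window_decreasing(2)[OF c, of t] tt t w by auto
    ultimately show "\<exists>y. ((\<lambda>t. Im (c t) + 3 / 10 * \<omega> * s * t) has_real_derivative y) (at t) \<and> y \<le> 0"
      by blast
  qed
  then show ?thesis by (simp add: right_diff_distrib)
qed

lemma cos_ge_half_near_0: "\<bar>x\<bar> \<le> pi / 3 \<Longrightarrow> cos x \<ge> 1 / 2" for x :: real
  using cos_monotone_0_pi_le[of "\<bar>x\<bar>" "pi / 3"] by (simp add: cos_60)

lemma cos_ge_half_near_2pi: "\<bar>x - 2 * pi\<bar> \<le> pi / 3 \<Longrightarrow> cos x \<ge> 1 / 2" for x :: real
  using cos_ge_half_near_0[of "x - 2 * pi"] by (simp add: cos_diff)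

lemma cos_le_half_between: "pi / 3 \<le> x \<Longrightarrow> x \<le> 5 * pi / 3 \<Longrightarrow> cos x \<le> 1 / 2" for x :: real
proof -
  assume x: "pi / 3 \<le> x" "x \<le> 5 * pi / 3"
  have "cos (pi - \<bar>x - pi\<bar>) \<le> cos (pi / 3)"
    using x by (intro cos_monotone_0_pi_le) (auto simp: abs_if)
  moreover have "cos (pi - \<bar>x - pi\<bar>) = cos x"
    by (cases "x \<ge> pi") (auto simp: cos_diff)
  ultimately show ?thesis by (simp add: cos_60)
qed

text \<open>Crossings can only occur in the windows of phase around \<open>0\<close> and \<open>2 \<pi>\<close>. In each of them the imaginary part
decreases strictly; in the first it starts at \<open>0\<close> and is negative afterwards, in the second it changes
sign exactly once.\<close>

lemma first_return_exists:
  assumes c: "oscillation \<omega> F c" "c 0 = of_real s" "small_amplitude s"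
  obtains \<tau> where "first_return c \<tau>" "\<bar>\<omega> * \<tau> - 2 * pi\<bar> \<le> pi / 3"
proof -
  define t1 where "t1 = 5 * pi / (3 * \<omega>)"
  define t2 where "t2 = 7 * pi / (3 * \<omega>)"
  have w1: "\<omega> * t1 = 5 * pi / 3" "\<omega> * t2 = 7 * pi / 3"
    using \<omega>_pos by (auto simp: t1_def t2_def field_simps)
  have t12: "0 < t1" "t1 < t2" "t2 \<le> horizon"
    using \<omega>_pos by (auto simp: t1_def t2_def horizon_def field_simps)
  have win: "\<bar>\<omega> * t - 2 * pi\<bar> \<le> pi / 3" if "t1 \<le> t" "t \<le> t2" for t
    using mult_left_mono[OF that(1), of \<omega>] mult_left_mono[OF that(2), of \<omega>] \<omega>_pos
    unfolding w1 by linarith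
  have s0: "s > 0" using c(3) by (auto simp: small_amplitude_def)
  have b: "norm (rotating c t - of_real s) \<le> s / 100" if "0 \<le> t" "t \<le> horizon" for t
    using rotating_almost_constant'[OF c(1,3) _ that] c(2) s0 by simp
  have re: "Re (rotating c t) \<ge> 99 / 100 * s" "\<bar>Im (rotating c t)\<bar> \<le> s / 100"
    if "0 \<le> t" "t \<le> horizon" for t
    using abs_Re_le_cmod[of "rotating c t - of_real s"]
      abs_Im_le_cmod[of "rotating c t - of_real s"] b[OF that] by simp_all
  have sin1: "sin (\<omega> * t1) = - (sqrt 3 / 2)"
    using sin_diff[of "2 * pi" "pi / 3"] unfolding w1 by (simp add: sin_60 cos_60 field_simps)
  have sin2: "sin (\<omega> * t2) = sqrt 3 / 2"
    using sin_add[of "2 * pi" "pi / 3"] unfolding w1 by (simp add: sin_60 cos_60 field_simps)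
  have s3: "sqrt 3 > 1" by simp
  have cosim: "\<bar>cos (\<omega> * t) * Im (rotating c t)\<bar> \<le> 1 * (s / 100)" if "0 \<le> t" "t \<le> horizon" for t
    unfolding abs_mult using re(2)[OF that] abs_cos_le_one s0 by (intro mult_mono) auto
  have "(1 / 2) * (99 / 100 * s) \<le> (sqrt 3 / 2) * Re (rotating c t)" if "0 \<le> t" "t \<le> horizon" for t
    using re(1)[OF that] s3 s0 by (intro mult_mono) auto
  note big = this
  have im1: "Im (c t1) > 0"
    using big[of t1] cosim[of t1] t12 s0 unfolding unrotate(2)[of c t1] sin1
    by (simp del: times_complex.sel)
  have im2: "Im (c t2) < 0"
    using big[of t2] cosim[of t2] t12 s0 unfolding unrotate(2)[of c t2] sin2
    by (simp del: times_complex.sel)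
  have "\<exists>\<tau>\<ge>t1. \<tau> \<le> t2 \<and> Im (c \<tau>) = 0"
    using im1 im2 t12 by (intro IVT2') (auto intro!: continuous_intros oscillation_continuous[OF c(1)])
  then obtain \<tau> where \<tau>: "t1 \<le> \<tau>" "\<tau> \<le> t2" "Im (c \<tau>) = 0" by blast
  have "Re (c \<tau>) > 0"
    using window_decreasing(1)[OF c, of \<tau>] \<tau> t12 cos_ge_half_near_2pi[OF win[of \<tau>]] by auto
  moreover have "\<not> (Im (c t) = 0 \<and> Re (c t) > 0)" if t: "0 < t" "t < \<tau>" for t
  proof
    assume cr: "Im (c t) = 0 \<and> Re (c t) > 0"
    have th: "t \<le> horizon" using t \<tau> t12 by simp
    have "cos (\<omega> * t) > 1 / 2" using crossing_in_window[OF c] cr t th by auto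
    then consider "\<omega> * t < pi / 3" | "\<omega> * t > 5 * pi / 3"
      using cos_le_half_between[of "\<omega> * t"] by force
    then show False
    proof cases
      case 1
      have "Im (c 0) - Im (c t) \<ge> 3 / 10 * \<omega> * s * (t - 0)"
      proof (rule Im_strictly_decreasing[OF c])
        fix u assume u: "0 \<le> u" "u \<le> t"
        then have "0 \<le> \<omega> * u" "\<omega> * u \<le> \<omega> * t" using \<omega>_pos by auto
        then show "cos (\<omega> * u) \<ge> 1 / 2" using 1 by (intro cos_ge_half_near_0) auto
      qed (use t th in auto)
      moreover have "3 / 10 * \<omega> * s * (t - 0) > 0" using \<omega>_pos s0 t by simp
      ultimately show False using cr c(2) by simp
    next
      case 2
      have "\<omega> * t1 < \<omega> * t" using 2 unfolding w1 .
      then have "t1 < t" using \<omega>_pos by simp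
      have "Im (c t) - Im (c \<tau>) \<ge> 3 / 10 * \<omega> * s * (\<tau> - t)"
        using \<open>t1 < t\<close> t \<tau> t12 win
        by (intro Im_strictly_decreasing[OF c] cos_ge_half_near_2pi) auto
      moreover have "3 / 10 * \<omega> * s * (\<tau> - t) > 0" using \<omega>_pos s0 t by simp
      ultimately show False using cr \<tau> by simp
    qed
  qed
  ultimately have "first_return c \<tau>" using \<tau> t12 by (auto simp: first_return_def)
  with win[of \<tau>] \<tau> show ?thesis by (intro that) auto
qed

lemma first_return_window:
  assumes c: "oscillation \<omega> F c" "c 0 = of_real s" "small_amplitude s" and fr: "first_return c \<tau>"
  shows "\<bar>\<omega> * \<tau> - 2 * pi\<bar> \<le> pi / 3" "\<tau> \<le> horizon" "\<tau> \<ge> pi / \<omega>"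
    "norm (cis (\<omega> * \<tau>) - 1) \<le> 8 * (horizon * L) * s"
    "norm (c \<tau>) \<le> 101 / 100 * s"
proof -
  from first_return_exists[OF c] obtain \<tau>' where "first_return c \<tau>'" "\<bar>\<omega> * \<tau>' - 2 * pi\<bar> \<le> pi / 3"
    by blast
  with first_return_unique[OF fr] show w: "\<bar>\<omega> * \<tau> - 2 * pi\<bar> \<le> pi / 3" by auto
  then have "\<omega> * \<tau> \<le> 3 * pi" "\<omega> * \<tau> \<ge> pi" by linarith+
  then show h: "\<tau> \<le> horizon" and "\<tau> \<ge> pi / \<omega>"
    using \<omega>_pos by (auto simp: horizon_def field_simps)
  have s0: "s > 0" using c(3) by (auto simp: small_amplitude_def)
  have \<tau>0: "\<tau> > 0" "Im (c \<tau>) = 0" "Re (c \<tau>) > 0" using fr by (auto simp: first_return_def)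
  have b: "norm (rotating c \<tau> - of_real s) \<le> 4 * (horizon * L) * s * s"
    using rotating_almost_constant[OF c(1,3) _ _ h] c(2) \<tau>0 s0 by simp
  have b': "norm (rotating c \<tau> - of_real s) \<le> s / 100"
    using rotating_almost_constant'[OF c(1,3) _ _ h] c(2) \<tau>0 s0 by simp
  have cr: "c \<tau> = of_real (norm (c \<tau>))"
    using \<tau>0 by (auto simp: complex_eq_iff cmod_def)
  have "\<bar>norm (c \<tau>) - s\<bar> \<le> norm (rotating c \<tau> - of_real s)"
    using norm_triangle_ineq3[of "rotating c \<tau>" "of_real s"] s0 by (simp add: norm_mult)
  note nc = this
  with b' show "norm (c \<tau>) \<le> 101 / 100 * s" by linarith
  have "of_real s * (cis (\<omega> * \<tau>) - 1) = (rotating c \<tau> - of_real s) - of_real (norm (c \<tau>) - s) * cis (\<omega> * \<tau>)"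
    by (subst cr) (simp add: algebra_simps)
  then have "norm (of_real s * (cis (\<omega> * \<tau>) - 1)) \<le>
      norm (rotating c \<tau> - of_real s) + norm (of_real (norm (c \<tau>) - s) * cis (\<omega> * \<tau>))"
    by (metis norm_triangle_ineq4)
  also have "\<dots> = norm (rotating c \<tau> - of_real s) + \<bar>norm (c \<tau>) - s\<bar>"
    by (simp add: norm_mult del: of_real_diff)
  also have "\<dots> \<le> 8 * (horizon * L) * s * s" using nc b by linarith
  finally have "s * norm (cis (\<omega> * \<tau>) - 1) \<le> s * (8 * (horizon * L) * s)"
    using s0 by (simp add: norm_mult mult_ac)
  then show "norm (cis (\<omega> * \<tau>) - 1) \<le> 8 * (horizon * L) * s" using s0 by simp
qed

text \<open>At the return time of the inner solution the difference of the two solutions is almost the initial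
difference \<open>\<Delta>\<close>, because the rotation has almost completed a turn. The outer solution is then within \<open>O(\<Delta>)\<close>
of the axis, so it meets the axis after a time of order \<open>\<Delta> / s\<^sub>2\<close>, during which its real part changes only
by a small fraction of \<open>\<Delta>\<close>.\<close>

lemma return_map_strict_mono:
  assumes c1: "oscillation \<omega> F c1" "c1 0 = of_real s1" "small_amplitude s1" "first_return c1 \<tau>1"
    and c2: "oscillation \<omega> F c2" "c2 0 = of_real s2" "small_amplitude s2" "first_return c2 \<tau>2"
    and less: "s1 < s2"
  shows "Re (c1 \<tau>1) < Re (c2 \<tau>2)"
proof -
  define \<Delta> where "\<Delta> = s2 - s1"
  have s0: "s1 > 0" "s2 > 0" using c1 c2 by (auto simp: small_amplitude_def)
  have \<Delta>: "\<Delta> > 0" "\<Delta> \<le> s2" using s0 less by (auto simp: \<Delta>_def)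
  note w1 = first_return_window[OF c1] and w2 = first_return_window[OF c2]
  have \<tau>: "0 < \<tau>1" "Im (c1 \<tau>1) = 0" "0 < \<tau>2" "Im (c2 \<tau>2) = 0"
    using c1(4) c2(4) by (auto simp: first_return_def)
  have k: "8 * (horizon * L) * s1 \<le> 1 / 50" "4 * (horizon * L) * s2 \<le> 1 / 100"
    using c1(3) c2(3) by (auto simp: small_amplitude_def)
  define d where "d = rotating c2 \<tau>1 - rotating c1 \<tau>1"
  have "norm (d - of_real \<Delta>) \<le> 4 * (horizon * L) * s2 * norm (of_real \<Delta> :: complex)"
    using rotating_difference[OF c2(1) c1(1) c2(3) _ _ _ w1(2)] c1(2) c2(2) s0 less \<tau>
    by (simp add: d_def \<Delta>_def)
  also have "\<dots> \<le> 1 / 100 * \<Delta>" using k \<Delta> by (auto intro: mult_right_mono)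
  finally have d: "norm (d - of_real \<Delta>) \<le> 1 / 100 * \<Delta>" .
  have e: "norm (cis (- (\<omega> * \<tau>1)) - 1) \<le> 1 / 50"
  proof -
    have "cis (- (\<omega> * \<tau>1)) - 1 = cnj (cis (\<omega> * \<tau>1) - 1)" by (simp add: cis_cnj)
    then show ?thesis using w1(4) k by (metis complex_mod_cnj order_trans)
  qed
  have cd: "c2 \<tau>1 - c1 \<tau>1 = cis (- (\<omega> * \<tau>1)) * d"
    by (simp add: d_def mult.assoc[symmetric] cis_mult right_diff_distrib)
  have "c2 \<tau>1 - c1 \<tau>1 - of_real \<Delta> = cis (- (\<omega> * \<tau>1)) * (d - of_real \<Delta>) + of_real \<Delta> * (cis (- (\<omega> * \<tau>1)) - 1)"
    unfolding cd by (simp add: algebra_simps)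
  then have "norm (c2 \<tau>1 - c1 \<tau>1 - of_real \<Delta>) \<le>
      norm (cis (- (\<omega> * \<tau>1)) * (d - of_real \<Delta>)) + norm (of_real \<Delta> * (cis (- (\<omega> * \<tau>1)) - 1))"
    by (metis norm_triangle_ineq)
  also have "\<dots> = norm (d - of_real \<Delta>) + \<Delta> * norm (cis (- (\<omega> * \<tau>1)) - 1)"
    using \<Delta> by (simp add: norm_mult)
  also have "\<dots> \<le> 1 / 100 * \<Delta> + \<Delta> * (1 / 50)"
    using d e \<Delta> by (intro add_mono mult_left_mono) auto
  finally have close: "norm (c2 \<tau>1 - c1 \<tau>1 - of_real \<Delta>) \<le> 3 / 100 * \<Delta>" by simp
  have re: "Re (c2 \<tau>1) \<ge> Re (c1 \<tau>1) + 97 / 100 * \<Delta>"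
    using abs_Re_le_cmod[of "c2 \<tau>1 - c1 \<tau>1 - of_real \<Delta>"] close by simp
  have im: "\<bar>Im (c2 \<tau>1)\<bar> \<le> 3 / 100 * \<Delta>"
    using abs_Im_le_cmod[of "c2 \<tau>1 - c1 \<tau>1 - of_real \<Delta>"] close \<tau> by simp
  \<comment> \<open>Either return may come first; the outer solution is controlled on the interval between the two.\<close>
  define lo hi where "lo = min \<tau>1 \<tau>2" and "hi = max \<tau>1 \<tau>2"
  have lh: "0 \<le> lo" "lo \<le> hi" "hi \<le> horizon"
    using \<tau> w1(2) w2(2) by (auto simp: lo_def hi_def)
  have win: "cos (\<omega> * t) \<ge> 1 / 2" if "lo \<le> t" "t \<le> hi" for t
  proof (rule cos_ge_half_near_2pi)
    have "\<omega> * lo \<le> \<omega> * t" "\<omega> * t \<le> \<omega> * hi" using that \<omega>_pos by auto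
    moreover have "\<bar>\<omega> * lo - 2 * pi\<bar> \<le> pi / 3" "\<bar>\<omega> * hi - 2 * pi\<bar> \<le> pi / 3"
      using w1(1) w2(1) by (auto simp: lo_def hi_def min_def max_def)
    ultimately show "\<bar>\<omega> * t - 2 * pi\<bar> \<le> pi / 3" by linarith
  qed
  have dec: "Im (c2 u) - Im (c2 v) \<ge> 3 / 10 * \<omega> * s2 * (v - u)" if "lo \<le> u" "u \<le> v" "v \<le> hi" for u v
    using that lh by (intro Im_strictly_decreasing[OF c2(1-3)] win) auto
  have pos: "3 / 10 * \<omega> * s2 > 0" using \<omega>_pos s0 by simp
  have Imb: "\<bar>Im (c2 u)\<bar> \<le> 3 / 100 * \<Delta>" if u: "lo \<le> u" "u \<le> hi" for u
  proof -
    have "Im (c2 u) \<le> Im (c2 lo)" "Im (c2 hi) \<le> Im (c2 u)"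
      using dec[of lo u] dec[of u hi] u pos
      by (smt (verit) mult_nonneg_nonneg)+
    then show ?thesis
      using im \<tau> \<Delta> by (cases "\<tau>1 \<le> \<tau>2") (auto simp: lo_def hi_def)
  qed
  have "3 / 10 * \<omega> * s2 * (hi - lo) \<le> \<bar>Im (c2 \<tau>1)\<bar>"
    using dec[of lo hi] lh \<tau> by (cases "\<tau>1 \<le> \<tau>2") (auto simp: lo_def hi_def)
  also have "\<dots> \<le> 3 / 100 * \<Delta>" by (rule im)
  also have "\<dots> \<le> 3 / 100 * s2" using \<Delta> by simp
  finally have "\<omega> * (hi - lo) * s2 \<le> 1 / 10 * s2" by (simp add: algebra_simps)
  then have wl: "\<omega> * (hi - lo) \<le> 1 / 10" using s0 mult_le_cancel_right_pos by blast
  have "norm (Re (c2 hi) - Re (c2 lo)) \<le> (\<omega> * (3 / 100 * \<Delta>)) * (hi - lo)"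
  proof (rule norm_diff_le_of_vector_derivative[OF lh(2)])
    fix t assume t: "lo \<le> t" "t \<le> hi"
    show "((\<lambda>t. Re (c2 t)) has_vector_derivative \<omega> * Im (c2 t)) (at t)"
      using Re_derivative[OF c2(1)] by (simp add: has_real_derivative_iff_has_vector_derivative)
    show "norm (\<omega> * Im (c2 t)) \<le> \<omega> * (3 / 100 * \<Delta>)"
      using Imb[OF t] \<omega>_pos by (simp add: abs_mult)
  qed
  also have "\<dots> = 3 / 100 * \<Delta> * (\<omega> * (hi - lo))" by simp
  also have "\<dots> \<le> 3 / 100 * \<Delta> * (1 / 10)" using wl \<Delta> by (intro mult_left_mono) auto
  finally have "\<bar>Re (c2 hi) - Re (c2 lo)\<bar> \<le> 3 / 1000 * \<Delta>" by simp
  then have "\<bar>Re (c2 \<tau>2) - Re (c2 \<tau>1)\<bar> \<le> 3 / 1000 * \<Delta>"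
    by (cases "\<tau>1 \<le> \<tau>2") (auto simp: lo_def hi_def abs_minus_commute)
  with re \<Delta> show ?thesis by linarith
qed

text \<open>If the first return lies inside the start point then, by monotonicity of the return map, the second lies
inside the first, and so on. All later crossings stay below \<open>s\<close>, and as each turn takes at least time
\<open>\<pi> / \<omega>\<close> the solution never comes back to \<open>s\<close>, against periodicity.\<close>

lemma return_not_inside:
  assumes c: "oscillation \<omega> F c" "c 0 = of_real s" "small_amplitude s" "has_period c T"
    and fr: "first_return c \<tau>"
  shows "Re (c \<tau>) \<ge> s"
proof (rule ccontr)
  assume "\<not> Re (c \<tau>) \<ge> s"
  then have inside: "Re (c \<tau>) < s" by simp
  have s0: "s > 0" using c(3) by (simp add: small_amplitude_def)
  \<comment> \<open>The invariant after \<open>k\<close> turns: position \<open>\<rho>\<close> on the axis, a next return inside it, and no visit of \<open>s\<close> so far.\<close>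
  have "\<exists>t \<rho> \<tau>'. t \<ge> real k * (pi / \<omega>) \<and> 0 < \<rho> \<and> \<rho> \<le> s \<and> c t = of_real \<rho> \<and>
      first_return (\<lambda>u. c (t + u)) \<tau>' \<and> Re (c (t + \<tau>')) < \<rho> \<and> (\<forall>u. 0 < u \<and> u \<le> t \<longrightarrow> c u \<noteq> of_real s)" for k
  proof (induction k)
    case 0
    show ?case using fr inside s0 c by (intro exI[of _ 0] exI[of _ s] exI[of _ \<tau>]) auto
  next
    case (Suc k)
    then obtain t \<rho> \<tau>' where IH: "t \<ge> real k * (pi / \<omega>)" "0 < \<rho>" "\<rho> \<le> s" "c t = of_real \<rho>"
      "first_return (\<lambda>u. c (t + u)) \<tau>'" "Re (c (t + \<tau>')) < \<rho>" "\<And>u. 0 < u \<Longrightarrow> u \<le> t \<Longrightarrow> c u \<noteq> of_real s"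
      by blast
    define \<rho>' where "\<rho>' = Re (c (t + \<tau>'))"
    have \<rho>': "0 < \<rho>'" "\<rho>' < \<rho>" "c (t + \<tau>') = of_real \<rho>'" "\<tau>' > 0"
      using IH by (auto simp: \<rho>'_def first_return_def complex_eq_iff)
    have sm: "small_amplitude \<rho>" "small_amplitude \<rho>'"
      using IH \<rho>' small_amplitude_mono[OF c(3)] by auto
    have o1: "oscillation \<omega> F (\<lambda>u. c (t + u))" "oscillation \<omega> F (\<lambda>u. c (t + \<tau>' + u))"
      by (intro oscillation_shift c(1))+
    obtain \<tau>'' where fr2: "first_return (\<lambda>u. c (t + \<tau>' + u)) \<tau>''"
      using first_return_exists[OF o1(2) _ sm(2)] \<rho>' by auto
    have "Re (c (t + \<tau>' + \<tau>'')) < Re (c (t + \<tau>'))"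
      using return_map_strict_mono[OF o1(2) _ sm(2) fr2 o1(1) _ sm(1) IH(5)] \<rho>' IH by simp
    moreover have "t + \<tau>' \<ge> real (Suc k) * (pi / \<omega>)"
      using first_return_window(3)[OF o1(1) _ sm(1) IH(5)] IH by (simp add: algebra_simps)
    moreover have "c u \<noteq> of_real s" if u: "0 < u" "u \<le> t + \<tau>'" for u
    proof -
      consider "u \<le> t" | "t < u" "u < t + \<tau>'" | "u = t + \<tau>'" using u by linarith
      then show ?thesis
      proof cases
        case 1 then show ?thesis using IH(7) u by auto
      next
        case 2
        then have "\<not> (Im (c (t + (u - t))) = 0 \<and> Re (c (t + (u - t))) > 0)"
          using IH(5) unfolding first_return_def by (smt (verit))
        then show ?thesis using s0 by auto
      next
        case 3 then show ?thesis using \<rho>' IH by simp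
      qed
    qed
    ultimately show ?case
      using \<rho>' IH(3) fr2 by (intro exI[of _ "t + \<tau>'"] exI[of _ \<rho>'] exI[of _ \<tau>'']) auto
  qed
  note loops = this
  have T: "T > 0" "c (0 + T) = c 0" using c(4) by (auto simp: has_period_def simp del: add_0)
  obtain k :: nat where "real k > T / (pi / \<omega>)" using reals_Archimedean2 by blast
  then have "real k * (pi / \<omega>) > T" using \<omega>_pos by (simp add: field_simps)
  with loops[of k] T c(2) show False by force
qed

lemma reversed_oscillator: "weak_oscillator \<omega> L \<epsilon>\<^sub>0 (\<lambda>z. F (cnj z))"
proof
  fix \<epsilon> :: real and a b :: complex
  assume "\<epsilon> \<le> \<epsilon>\<^sub>0" "norm a \<le> \<epsilon>" "norm b \<le> \<epsilon>"
  then have "\<bar>F (cnj a) - F (cnj b)\<bar> \<le> L * \<epsilon> * norm (cnj a - cnj b)"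
    by (intro F_lipschitz) auto
  then show "\<bar>F (cnj a) - F (cnj b)\<bar> \<le> L * \<epsilon> * norm (a - b)"
    by (metis complex_cnj_diff complex_mod_cnj)
qed (use \<omega>_pos L_pos \<epsilon>\<^sub>0_pos F_0 in auto)

lemma reflected_oscillator: "weak_oscillator \<omega> L \<epsilon>\<^sub>0 (\<lambda>z. - F (- z))"
proof
  fix \<epsilon> :: real and a b :: complex
  assume "\<epsilon> \<le> \<epsilon>\<^sub>0" "norm a \<le> \<epsilon>" "norm b \<le> \<epsilon>"
  then have "\<bar>F (- a) - F (- b)\<bar> \<le> L * \<epsilon> * norm (- a - - b)"
    by (intro F_lipschitz) auto
  then show "\<bar>- F (- a) - - F (- b)\<bar> \<le> L * \<epsilon> * norm (a - b)"
    by (simp add: norm_minus_commute abs_minus_commute)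
qed (use \<omega>_pos L_pos \<epsilon>\<^sub>0_pos F_0 in auto)

text \<open>A return outside the start point is a return inside for the reversed motion that starts at the return
point. The factor \<open>2\<close> leaves room for the return point to be a little larger than \<open>s\<close>.\<close>

lemma closed_at_first_return:
  assumes c: "oscillation \<omega> F c" "c 0 = of_real s" "small_amplitude (2 * s)" "has_period c T"
    and fr: "first_return c \<tau>"
  shows "c \<tau> = c 0"
proof -
  have s0: "s > 0" using c(3) by (simp add: small_amplitude_def)
  have sm: "small_amplitude s" using small_amplitude_mono[OF c(3)] s0 by simp
  define \<rho> where "\<rho> = Re (c \<tau>)"
  have \<tau>: "\<tau> > 0" "c \<tau> = of_real \<rho>" "\<rho> > 0"
    using fr by (auto simp: first_return_def \<rho>_def complex_eq_iff)
  have "\<rho> \<ge> s" using return_not_inside[OF c(1,2) sm c(4) fr] by (simp add: \<rho>_def)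
  have "norm (c \<tau>) \<le> 101 / 100 * s" using first_return_window(5)[OF c(1,2) sm fr] .
  then have sm': "small_amplitude \<rho>"
    using \<tau> s0 by (intro small_amplitude_mono[OF c(3)]) auto
  interpret rev: weak_oscillator \<omega> L \<epsilon>\<^sub>0 "\<lambda>z. F (cnj z)" by (rule reversed_oscillator)
  have "first_return (\<lambda>t. cnj (c (\<tau> - t))) \<tau>"
    unfolding first_return_def
  proof (intro conjI allI impI)
    fix t assume t: "0 < t \<and> t < \<tau>"
    then have "\<not> (Im (c (\<tau> - t)) = 0 \<and> Re (c (\<tau> - t)) > 0)"
      using fr by (auto simp: first_return_def)
    then show "\<not> (Im (cnj (c (\<tau> - t))) = 0 \<and> 0 < Re (cnj (c (\<tau> - t))))" by simp
  qed (use \<tau> c s0 in auto)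
  then have "Re (cnj (c (\<tau> - \<tau>))) \<ge> \<rho>"
    using sm' \<tau> c(1,4) unfolding small_amplitude_def horizon_def
    by (intro rev.return_not_inside[where T = T] oscillation_reverse has_period_reverse)
       (auto simp: rev.small_amplitude_def rev.horizon_def)
  with \<open>\<rho> \<ge> s\<close> \<tau> c show ?thesis by simp
qed

text \<open>Once the solution is back at its start point, uniqueness makes it repeat for all positive times. Uniqueness
is available for forward time only; for negative times one first moves forward by a multiple of the
given period \<open>T\<close>.\<close>

lemma minimal_period_is_first_return:
  assumes c: "oscillation \<omega> F c" "c 0 = of_real s" "small_amplitude (2 * s)" "has_period c T"
    and fr: "first_return c \<tau>"
  shows "has_minimal_period c \<tau>"
proof -
  have s0: "s > 0" using c(3) by (simp add: small_amplitude_def)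
  have sm: "small_amplitude s" using small_amplitude_mono[OF c(3)] s0 by simp
  have \<tau>: "\<tau> > 0" "\<tau> \<le> horizon" using fr first_return_window(2)[OF c(1,2) sm fr] by (auto simp: first_return_def)
  have loops: "\<forall>t. 0 \<le> t \<and> t \<le> \<tau> \<longrightarrow> c (real k * \<tau> + t) = c t" for k
  proof (induction k)
    case (Suc k)
    have "c (real (Suc k) * \<tau>) = c \<tau>"
      using Suc[rule_format, of \<tau>] \<tau> by (simp add: algebra_simps)
    then have "c (real (Suc k) * \<tau> + 0) = c 0"
      using closed_at_first_return[OF c fr] by simp
    then show ?case
      using oscillation_unique[OF oscillation_shift[OF c(1), of "real (Suc k) * \<tau>"] c(1) sm] \<tau> c(2) s0
      by (auto simp del: of_nat_Suc)
  qed simp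
  have fwd: "c (t + \<tau>) = c t" if t: "t \<ge> 0" for t
  proof -
    define k where "k = nat \<lfloor>t / \<tau>\<rfloor>"
    have "real k \<le> t / \<tau>" "t / \<tau> \<le> real k + 1"
      using t \<tau> unfolding k_def by (auto intro: of_nat_floor simp: of_nat_nat)
    then have r: "0 \<le> t - real k * \<tau>" "t - real k * \<tau> \<le> \<tau>"
      using \<tau> by (auto simp: field_simps)
    have "c (real (Suc k) * \<tau> + (t - real k * \<tau>)) = c (real k * \<tau> + (t - real k * \<tau>))"
      using loops[rule_format, OF conjI[OF r], of k] loops[rule_format, OF conjI[OF r], of "Suc k"]
      by (simp only:)
    then show ?thesis by (simp add: algebra_simps)
  qed
  have T: "T > 0" "\<And>t. c (t + T) = c t" using c(4) by (auto simp: has_period_def)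
  have periods: "c (t + real n * T) = c t" for t n
  proof (induction n)
    case (Suc n)
    have "t + real (Suc n) * T = t + real n * T + T" by (simp add: algebra_simps)
    then show ?case using T(2)[of "t + real n * T"] Suc by (simp only:)
  qed simp
  have "c (t + \<tau>) = c t" for t
  proof -
    obtain n :: nat where "real n > - t / T" using reals_Archimedean2 by blast
    then have "t + real n * T \<ge> 0" using T by (simp add: field_simps)
    then have "c (t + real n * T + \<tau>) = c (t + real n * T)" by (rule fwd)
    moreover have "c (t + real n * T + \<tau>) = c (t + \<tau>)"
      using periods[of "t + \<tau>" n] by (simp add: algebra_simps)
    ultimately show ?thesis using periods by simp
  qed
  moreover have "\<tau> \<le> S" if "has_period c S" for S
  proof (rule ccontr)
    assume "\<not> \<tau> \<le> S"
    moreover have "S > 0" "c (0 + S) = c 0" using that by (auto simp: has_period_def simp del: add_0)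
    ultimately show False using fr c(2) s0 by (auto simp: first_return_def)
  qed
  ultimately show ?thesis using \<tau> by (auto simp: has_minimal_period_def has_period_def)
qed

end


section \<open>Normal form and expansion of the period\<close>

text \<open>The third-order Taylor polynomial that the planar force will turn out to have, in \<open>x = Re z / \<omega>\<close> and
\<open>v = Im z\<close>. A term \<open>x\<^sup>2 v\<close>, which would act as damping, is absent.\<close>

definition cubic_restoring :: "real \<Rightarrow> real \<Rightarrow> real \<Rightarrow> real \<Rightarrow> complex \<Rightarrow> real" where
  "cubic_restoring \<omega> \<alpha> \<beta> \<gamma> z =
     \<alpha> * (Re z / \<omega>)\<^sup>2 + \<beta> * (Re z / \<omega>) ^ 3 + \<gamma> * (Re z / \<omega>) * (Im z)\<^sup>2"

text \<open>With \<open>\<kappa> = \<alpha> / (4 \<omega>\<^sup>2)\<close> the quadratic force is \<open>\<alpha> x\<^sup>2 = \<kappa> (z\<^sup>2 + 2 z cnj z + (cnj z)\<^sup>2)\<close>. Under the rotation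
\<open>z' = - \<i> \<omega> z\<close> the three monomials have frequencies \<open>2 \<omega>\<close>, \<open>0\<close> and \<open>- 2 \<omega>\<close>; each coefficient here is minus that of
the force divided by this frequency less \<open>\<omega>\<close>, the frequency of \<open>z\<close>.\<close>

definition quad_part :: "real \<Rightarrow> real \<Rightarrow> complex \<Rightarrow> complex" where
  "quad_part \<omega> \<kappa> z = of_real (- \<kappa> / \<omega>) * (z * z) + of_real (2 * \<kappa> / \<omega>) * (z * cnj z)
     + of_real (\<kappa> / (3 * \<omega>)) * (cnj z * cnj z)"

text \<open>Directional derivative of \<open>quad_part\<close>, in the shape in which the product rule produces it.\<close>

definition quad_part_deriv :: "real \<Rightarrow> real \<Rightarrow> complex \<Rightarrow> complex \<Rightarrow> complex" where
  "quad_part_deriv \<omega> \<kappa> z h = of_real (- \<kappa> / \<omega>) * (z * h + h * z)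
     + of_real (2 * \<kappa> / \<omega>) * (z * cnj h + h * cnj z)
     + of_real (\<kappa> / (3 * \<omega>)) * (cnj z * cnj h + cnj h * cnj z)"

text \<open>The monomial \<open>z\<^sup>2 cnj z\<close> is left out: it has the same frequency as \<open>z\<close> and cannot be removed.\<close>

definition cubic_part :: "real \<Rightarrow> real \<Rightarrow> real \<Rightarrow> complex \<Rightarrow> complex" where
  "cubic_part A B C z = of_real A * (z * (z * z)) + of_real B * (z * (cnj z * cnj z))
     + of_real C * (cnj z * (cnj z * cnj z))"

definition cubic_part_deriv :: "real \<Rightarrow> real \<Rightarrow> real \<Rightarrow> complex \<Rightarrow> complex \<Rightarrow> complex" where
  "cubic_part_deriv A B C z h = of_real A * (z * (z * h + h * z) + h * (z * z))
     + of_real B * (z * (cnj z * cnj h + cnj h * cnj z) + h * (cnj z * cnj z))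
     + of_real C * (cnj z * (cnj z * cnj h + cnj h * cnj z) + cnj h * (cnj z * cnj z))"

text \<open>What remains of \<open>\<zeta>' + \<i> (\<omega> + \<sigma> |z|\<^sup>2) \<zeta>\<close> after the cancellations at order two and three, when the force at \<open>z\<close>
has the value \<open>f\<close>.\<close>

definition normal_form_residual ::
    "real \<Rightarrow> real \<Rightarrow> real \<Rightarrow> real \<Rightarrow> real \<Rightarrow> real \<Rightarrow> real \<Rightarrow> real \<Rightarrow> real \<Rightarrow> real \<Rightarrow> complex \<Rightarrow> complex" where
  "normal_form_residual \<omega> \<alpha> \<beta> \<gamma> \<kappa> \<sigma> A B C f z =
     - \<i> * of_real (f - cubic_restoring \<omega> \<alpha> \<beta> \<gamma> z)
       + quad_part_deriv \<omega> \<kappa> z (- \<i> * of_real (f - \<alpha> * (Re z / \<omega>)\<^sup>2))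
       + cubic_part_deriv A B C z (- \<i> * of_real f)
       + \<i> * of_real (\<sigma> * (norm z)\<^sup>2) * (quad_part \<omega> \<kappa> z + cubic_part A B C z)"

text \<open>This determines the normal form: \<open>\<kappa>\<close>, \<open>A\<close>, \<open>B\<close>, \<open>C\<close> are chosen such that all terms of order two and three of
the derivative of \<open>\<zeta> = z + quad_part z + cubic_part z\<close> cancel except those of the rotation with frequency
\<open>\<omega> + \<sigma> |z|\<^sup>2\<close>. In \<open>\<sigma>\<close> the terms with \<open>p\<close> and \<open>q\<close> come from the cubic force and the term with \<open>\<kappa>\<^sup>2\<close> from the quadratic
force acting on the quadratic part of \<open>\<zeta>\<close>. Every summand of the residual is of order four as soon as \<open>f\<close> agrees with
the cubic polynomial up to order four.\<close>

lemma homological_identity: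
  fixes \<omega> \<alpha> \<beta> \<gamma> f :: real and z :: complex
  assumes "\<omega> \<noteq> 0"
  defines "\<kappa> \<equiv> \<alpha> / (4 * \<omega>\<^sup>2)"
    and "p \<equiv> \<beta> / (8 * \<omega> ^ 3)" and "q \<equiv> \<gamma> / (8 * \<omega>)"
  defines "\<sigma> \<equiv> 3 * p + q - 20 * \<kappa>\<^sup>2 / (3 * \<omega>)"
    and "A \<equiv> (4 * \<kappa>\<^sup>2 / \<omega> - (p - q)) / (2 * \<omega>)"
    and "B \<equiv> ((3 * p + q) - 4 * \<kappa>\<^sup>2 / (3 * \<omega>)) / (2 * \<omega>)"
    and "C \<equiv> ((p - q) + 4 * \<kappa>\<^sup>2 / (3 * \<omega>)) / (4 * \<omega>)"
  defines "h \<equiv> - \<i> * (of_real \<omega> * z + of_real f)"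
  shows "h + quad_part_deriv \<omega> \<kappa> z h + cubic_part_deriv A B C z h
       + \<i> * of_real (\<omega> + \<sigma> * (norm z)\<^sup>2) * (z + quad_part \<omega> \<kappa> z + cubic_part A B C z)
     = normal_form_residual \<omega> \<alpha> \<beta> \<gamma> \<kappa> \<sigma> A B C f z"
proof -
  define x y where "x = Re z" and "y = Im z"
  have z: "z = Complex x y" by (simp add: x_def y_def)
  have n: "(norm z)\<^sup>2 = x\<^sup>2 + y\<^sup>2" by (simp add: z cmod_def)
  have 1: "\<alpha> = 4 * \<omega>\<^sup>2 * \<kappa>" "\<beta> = 8 * \<omega> ^ 3 * p" "\<gamma> = 8 * \<omega> * q"
    using assms(1) by (auto simp: \<kappa>_def p_def q_def)
  have 2: "cubic_restoring \<omega> \<alpha> \<beta> \<gamma> z = 4 * \<kappa> * x\<^sup>2 + 8 * p * x ^ 3 + 8 * q * x * y\<^sup>2"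
    "\<alpha> * (Re z / \<omega>)\<^sup>2 = 4 * \<kappa> * x\<^sup>2"
    using assms(1) unfolding cubic_restoring_def 1 by (auto simp: x_def y_def power_divide)
  show ?thesis
    unfolding normal_form_residual_def 2 n h_def quad_part_def quad_part_deriv_def cubic_part_def cubic_part_deriv_def
    unfolding z \<sigma>_def A_def B_def C_def
    using assms(1)
    by (simp add: complex_eq_iff, intro conjI)
       (simp_all add: field_simps, simp_all add: algebra_simps power2_eq_square power3_eq_cube power4_eq_xxxx)
qed


lemma quad_part_bounds:
  defines "M \<equiv> \<lambda>\<omega> \<kappa>. \<bar>\<kappa> / \<omega>\<bar> + \<bar>2 * \<kappa> / \<omega>\<bar> + \<bar>\<kappa> / (3 * \<omega>)\<bar>"
  shows "norm (quad_part \<omega> \<kappa> z) \<le> M \<omega> \<kappa> * norm z ^ 2"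
    and "norm (quad_part_deriv \<omega> \<kappa> z h) \<le> 2 * M \<omega> \<kappa> * norm z * norm h"
proof -
  have "norm (quad_part \<omega> \<kappa> z) \<le> \<bar>\<kappa> / \<omega>\<bar> * (norm z * norm z) + \<bar>2 * \<kappa> / \<omega>\<bar> * (norm z * norm z)
      + \<bar>\<kappa> / (3 * \<omega>)\<bar> * (norm z * norm z)"
    unfolding quad_part_def
    by (intro norm_triangle_le add_mono) (auto simp: norm_mult norm_divide abs_mult)
  then show "norm (quad_part \<omega> \<kappa> z) \<le> M \<omega> \<kappa> * norm z ^ 2"
    by (simp add: M_def algebra_simps power2_eq_square)
  have t: "norm (a + b) \<le> 2 * (norm z * norm h)"
    if "norm a = norm z * norm h" "norm b = norm z * norm h" for a b :: complex
    using norm_triangle_ineq[of a b] that by linarith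
  have "norm (quad_part_deriv \<omega> \<kappa> z h) \<le> \<bar>\<kappa> / \<omega>\<bar> * (2 * (norm z * norm h))
      + \<bar>2 * \<kappa> / \<omega>\<bar> * (2 * (norm z * norm h)) + \<bar>\<kappa> / (3 * \<omega>)\<bar> * (2 * (norm z * norm h))"
    unfolding quad_part_deriv_def
    by (intro norm_triangle_le add_mono; subst norm_mult; intro mult_mono t)
       (auto simp: norm_mult norm_divide abs_mult)
  then show "norm (quad_part_deriv \<omega> \<kappa> z h) \<le> 2 * M \<omega> \<kappa> * norm z * norm h"
    by (simp add: M_def algebra_simps)
qed

lemma cubic_part_bounds:
  defines "M \<equiv> \<lambda>A B C. \<bar>A\<bar> + \<bar>B\<bar> + \<bar>C\<bar>"
  shows "norm (cubic_part A B C z) \<le> M A B C * norm z ^ 3"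
    and "norm (cubic_part_deriv A B C z h) \<le> 3 * M A B C * norm z ^ 2 * norm h"
proof -
  have "norm (cubic_part A B C z) \<le> \<bar>A\<bar> * norm z ^ 3 + \<bar>B\<bar> * norm z ^ 3 + \<bar>C\<bar> * norm z ^ 3"
    unfolding cubic_part_def
    by (intro norm_triangle_le add_mono) (auto simp: norm_mult power3_eq_cube)
  then show "norm (cubic_part A B C z) \<le> M A B C * norm z ^ 3"
    by (simp add: M_def algebra_simps)
  let ?n = "norm z ^ 2 * norm h"
  have t: "norm (u * (v + w) + x) \<le> 3 * ?n"
    if "norm (u * v) = ?n" "norm (u * w) = ?n" "norm x = ?n" for u v w x :: complex
    using norm_triangle_ineq[of "u * v + u * w" x] norm_triangle_ineq[of "u * v" "u * w"] that
    unfolding distrib_left by linarith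
  have "norm (cubic_part_deriv A B C z h) \<le> \<bar>A\<bar> * (3 * ?n) + \<bar>B\<bar> * (3 * ?n) + \<bar>C\<bar> * (3 * ?n)"
    unfolding cubic_part_deriv_def
    by (intro norm_triangle_le add_mono; subst norm_mult; intro mult_mono t)
       (auto simp: norm_mult power2_eq_square)
  then show "norm (cubic_part_deriv A B C z h) \<le> 3 * M A B C * norm z ^ 2 * norm h"
    by (simp add: M_def algebra_simps)
qed

lemma normal_form_residual_bound:
  fixes \<omega> \<alpha> \<beta> \<gamma> \<kappa> \<sigma> A B C D :: real
  assumes "\<omega> > 0" "D \<ge> 0"
  shows "\<exists>M\<ge>0. (\<forall>z f. norm z \<le> 1 \<longrightarrow> \<bar>f - cubic_restoring \<omega> \<alpha> \<beta> \<gamma> z\<bar> \<le> D * norm z ^ 4 \<longrightarrow>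
       norm (normal_form_residual \<omega> \<alpha> \<beta> \<gamma> \<kappa> \<sigma> A B C f z) \<le> M * norm z ^ 4) \<and>
     (\<forall>z. norm z \<le> 1 \<longrightarrow> norm (quad_part \<omega> \<kappa> z + cubic_part A B C z) \<le> M * norm z ^ 2)"
proof -
  define Kq where "Kq = \<bar>\<kappa> / \<omega>\<bar> + \<bar>2 * \<kappa> / \<omega>\<bar> + \<bar>\<kappa> / (3 * \<omega>)\<bar>"
  define Kc where "Kc = \<bar>A\<bar> + \<bar>B\<bar> + \<bar>C\<bar>"
  define D3 where "D3 = D + \<bar>\<beta>\<bar> / \<omega> ^ 3 + \<bar>\<gamma>\<bar> / \<omega>"
  define D2 where "D2 = D3 + \<bar>\<alpha>\<bar> / \<omega>\<^sup>2"
  define M where "M = D + 2 * Kq * D3 + 3 * Kc * D2 + \<bar>\<sigma>\<bar> * (Kq + Kc) + (Kq + Kc)"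
  have nn: "Kq \<ge> 0" "Kc \<ge> 0" "D3 \<ge> 0" "D2 \<ge> 0"
    using assms by (auto simp: Kq_def Kc_def D3_def D2_def)
  have zz: "norm (quad_part \<omega> \<kappa> z + cubic_part A B C z) \<le> (Kq + Kc) * norm z ^ 2" if "norm z \<le> 1" for z
  proof -
    have "norm z ^ 3 \<le> norm z ^ 2" using that by (intro power_decreasing) auto
    then have "Kc * norm z ^ 3 \<le> Kc * norm z ^ 2" using nn by (intro mult_left_mono)
    then show ?thesis
      using quad_part_bounds(1)[of \<omega> \<kappa> z] cubic_part_bounds(1)[of A B C z]
        norm_triangle_ineq[of "quad_part \<omega> \<kappa> z" "cubic_part A B C z"]
      by (simp add: Kq_def Kc_def algebra_simps)
  qed
  show ?thesis
  proof (intro exI[of _ M] conjI allI impI)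
    show "M \<ge> 0" using nn assms by (auto simp: M_def)
  next
    fix z :: complex assume "norm z \<le> 1"
    have "(Kq + Kc) * norm z ^ 2 \<le> M * norm z ^ 2"
      using nn assms by (intro mult_right_mono) (auto simp: M_def)
    with zz[OF \<open>norm z \<le> 1\<close>]
    show "norm (quad_part \<omega> \<kappa> z + cubic_part A B C z) \<le> M * norm z ^ 2" by linarith
  next
    fix z :: complex and f :: real
    assume z: "norm z \<le> 1" and f: "\<bar>f - cubic_restoring \<omega> \<alpha> \<beta> \<gamma> z\<bar> \<le> D * norm z ^ 4"
    define n where "n = norm z"
    have n: "0 \<le> n" "n \<le> 1" using z by (auto simp: n_def)
    have re: "\<bar>Re z / \<omega>\<bar> \<le> n / \<omega>" and im: "\<bar>Im z\<bar> \<le> n"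
      using abs_Re_le_cmod[of z] abs_Im_le_cmod[of z] assms by (auto simp: n_def divide_right_mono)
    have "\<bar>Re z / \<omega>\<bar> ^ 3 \<le> (n / \<omega>) ^ 3" using re by (intro power_mono) auto
    then have 3: "\<bar>\<beta> * (Re z / \<omega>) ^ 3\<bar> \<le> \<bar>\<beta>\<bar> * (n / \<omega>) ^ 3"
      unfolding abs_mult power_abs by (intro mult_left_mono) auto
    have "\<bar>Re z / \<omega>\<bar> ^ 2 \<le> (n / \<omega>) ^ 2" using re by (intro power_mono) auto
    then have 2: "\<bar>\<alpha> * (Re z / \<omega>) ^ 2\<bar> \<le> \<bar>\<alpha>\<bar> * (n / \<omega>) ^ 2"
      unfolding abs_mult power_abs by (intro mult_left_mono) auto
    have "\<bar>Im z\<bar> ^ 2 \<le> n ^ 2" using im by (intro power_mono) auto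
    then have 4: "\<bar>\<gamma> * (Re z / \<omega>) * (Im z)\<^sup>2\<bar> \<le> \<bar>\<gamma>\<bar> * (n / \<omega>) * n ^ 2"
      using re n assms unfolding abs_mult power_abs by (intro mult_mono) auto
    have "n ^ 4 \<le> n ^ 3" "n ^ 3 \<le> n ^ 2" using n by (auto intro!: power_decreasing)
    then have d: "D * n ^ 4 \<le> D * n ^ 3" "D3 * n ^ 3 \<le> D3 * n ^ 2"
      using assms nn by (auto intro: mult_left_mono)
    have f3: "\<bar>f - \<alpha> * (Re z / \<omega>)\<^sup>2\<bar> \<le> D3 * n ^ 3"
    proof -
      have "\<bar>f - \<alpha> * (Re z / \<omega>)\<^sup>2\<bar> \<le> D * n ^ 3 + \<bar>\<beta>\<bar> * (n / \<omega>) ^ 3 + \<bar>\<gamma>\<bar> * (n / \<omega>) * n ^ 2"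
        using f 3 4 d(1) unfolding cubic_restoring_def n_def[symmetric] by linarith
      also have "\<dots> = D3 * n ^ 3"
        by (simp add: D3_def algebra_simps power_divide power3_eq_cube power2_eq_square)
      finally show ?thesis .
    qed
    have f2: "\<bar>f\<bar> \<le> D2 * n ^ 2"
    proof -
      have "\<bar>f\<bar> \<le> D3 * n ^ 2 + \<bar>\<alpha>\<bar> * (n / \<omega>) ^ 2" using f3 2 d(2) by linarith
      also have "\<dots> = D2 * n ^ 2" by (simp add: D2_def algebra_simps power_divide)
      finally show ?thesis .
    qed
    have t1: "norm (- \<i> * of_real (f - cubic_restoring \<omega> \<alpha> \<beta> \<gamma> z)) \<le> D * n ^ 4"
      using f by (simp add: norm_mult n_def del: of_real_diff)
    have "norm (quad_part_deriv \<omega> \<kappa> z (- \<i> * of_real (f - \<alpha> * (Re z / \<omega>)\<^sup>2)))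
        \<le> 2 * Kq * n * \<bar>f - \<alpha> * (Re z / \<omega>)\<^sup>2\<bar>"
      using quad_part_bounds(2)[of \<omega> \<kappa> z "- \<i> * of_real (f - \<alpha> * (Re z / \<omega>)\<^sup>2)"]
      by (simp add: norm_mult Kq_def n_def del: of_real_diff)
    also have "\<dots> \<le> 2 * Kq * n * (D3 * n ^ 3)" using f3 nn n by (intro mult_left_mono) auto
    finally have t2: "norm (quad_part_deriv \<omega> \<kappa> z (- \<i> * of_real (f - \<alpha> * (Re z / \<omega>)\<^sup>2)))
        \<le> 2 * Kq * D3 * n ^ 4" by (simp add: power_numeral_reduce mult_ac)
    have "norm (cubic_part_deriv A B C z (- \<i> * of_real f)) \<le> 3 * Kc * n ^ 2 * \<bar>f\<bar>"
      using cubic_part_bounds(2)[of A B C z "- \<i> * of_real f"] by (simp add: norm_mult Kc_def n_def)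
    also have "\<dots> \<le> 3 * Kc * n ^ 2 * (D2 * n ^ 2)" using f2 nn n by (intro mult_left_mono) auto
    finally have t3: "norm (cubic_part_deriv A B C z (- \<i> * of_real f)) \<le> 3 * Kc * D2 * n ^ 4"
      by (simp add: power_numeral_reduce mult_ac)
    have "norm (\<i> * of_real (\<sigma> * (norm z)\<^sup>2) * (quad_part \<omega> \<kappa> z + cubic_part A B C z))
        = \<bar>\<sigma>\<bar> * n ^ 2 * norm (quad_part \<omega> \<kappa> z + cubic_part A B C z)"
      by (simp add: norm_mult n_def norm_power)
    also have "\<dots> \<le> \<bar>\<sigma>\<bar> * n ^ 2 * ((Kq + Kc) * n ^ 2)"
      using zz[OF z] by (intro mult_left_mono) (auto simp: n_def)
    finally have t4: "norm (\<i> * of_real (\<sigma> * (norm z)\<^sup>2) * (quad_part \<omega> \<kappa> z + cubic_part A B C z))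
        \<le> \<bar>\<sigma>\<bar> * (Kq + Kc) * n ^ 4" by (simp add: power_numeral_reduce mult_ac)
    have "norm (normal_form_residual \<omega> \<alpha> \<beta> \<gamma> \<kappa> \<sigma> A B C f z)
       \<le> D * n ^ 4 + 2 * Kq * D3 * n ^ 4 + 3 * Kc * D2 * n ^ 4 + \<bar>\<sigma>\<bar> * (Kq + Kc) * n ^ 4"
      unfolding normal_form_residual_def by (intro norm_triangle_le add_mono t1 t2 t3 t4)
    also have "\<dots> = (D + 2 * Kq * D3 + 3 * Kc * D2 + \<bar>\<sigma>\<bar> * (Kq + Kc)) * n ^ 4"
      by (simp add: algebra_simps)
    also have "\<dots> \<le> M * n ^ 4" using nn by (intro mult_right_mono) (auto simp: M_def)
    finally show "norm (normal_form_residual \<omega> \<alpha> \<beta> \<gamma> \<kappa> \<sigma> A B C f z) \<le> M * norm z ^ 4"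
      by (simp add: n_def)
  qed
qed

lemma normal_form_derivative:
  assumes "(c has_vector_derivative h) (at t)"
  shows "((\<lambda>t. c t + quad_part \<omega> \<kappa> (c t) + cubic_part A B C (c t)) has_vector_derivative
     h + quad_part_deriv \<omega> \<kappa> (c t) h + cubic_part_deriv A B C (c t) h) (at t)"
  unfolding quad_part_def quad_part_deriv_def cubic_part_def cubic_part_deriv_def
  by (intro has_vector_derivative_add has_vector_derivative_mult has_vector_derivative_mult_right
      has_vector_derivative_cnj assms)

lemma norm_cis_minus_1_ge:
  assumes "\<bar>\<phi> - 2 * pi\<bar> \<le> pi / 3"
  shows "\<bar>\<phi> - 2 * pi\<bar> \<le> 2 * norm (cis \<phi> - 1)"
proof -
  have "\<bar>sin (\<phi> - 2 * pi)\<bar> \<le> norm (cis \<phi> - 1)"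
    using abs_Im_le_cmod[of "cis \<phi> - 1"] by (simp add: sin_diff)
  with abs_le_two_abs_sin[OF assms] show ?thesis by linarith
qed

context weak_oscillator
begin

text \<open>Along a solution of amplitude \<open>s\<close> the quantity \<open>|c|\<^sup>2\<close> differs from \<open>s\<^sup>2\<close> by \<open>O(s\<^sup>3)\<close>, so that \<open>\<zeta>\<close> rotates with the
constant frequency \<open>\<Omega> = \<omega> + \<sigma> s\<^sup>2\<close> up to an error \<open>O(s\<^sup>4)\<close> of its derivative. As \<open>\<zeta>\<close> is of size \<open>s\<close> and returns to its
start value, \<open>cis (\<Omega> T)\<close> is \<open>1\<close> up to \<open>O(s\<^sup>3)\<close>; the rough bound on \<open>\<omega> T\<close> singles out the first turn.\<close>

lemma return_time_expansion:
  fixes \<alpha> \<beta> \<gamma> D \<epsilon> :: real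
  defines "\<sigma> \<equiv> 3 * (\<beta> / (8 * \<omega> ^ 3)) + \<gamma> / (8 * \<omega>) - 20 * (\<alpha> / (4 * \<omega>\<^sup>2))\<^sup>2 / (3 * \<omega>)"
  assumes \<epsilon>: "\<epsilon> > 0" and D: "D \<ge> 0"
    and F: "\<And>z. norm z \<le> \<epsilon> \<Longrightarrow> \<bar>F z - cubic_restoring \<omega> \<alpha> \<beta> \<gamma> z\<bar> \<le> D * norm z ^ 4"
  shows "\<exists>K \<delta>. \<delta> > 0 \<and> (\<forall>c T. oscillation \<omega> F c \<and> c 0 \<noteq> 0 \<and> norm (c 0) \<le> \<delta> \<and>
       T \<le> horizon \<and> c T = c 0 \<and> \<bar>\<omega> * T - 2 * pi\<bar> \<le> 1 / 2 \<longrightarrow>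
       \<bar>2 * pi / T - (\<omega> + \<sigma> * norm (c 0) ^ 2)\<bar> \<le> K * norm (c 0) ^ 3)"
proof -
  define \<kappa> where "\<kappa> = \<alpha> / (4 * \<omega>\<^sup>2)"
  define p q where "p = \<beta> / (8 * \<omega> ^ 3)" and "q = \<gamma> / (8 * \<omega>)"
  have \<sigma>: "\<sigma> = 3 * p + q - 20 * \<kappa>\<^sup>2 / (3 * \<omega>)" by (simp add: \<sigma>_def \<kappa>_def p_def q_def)
  define A B C where "A = (4 * \<kappa>\<^sup>2 / \<omega> - (p - q)) / (2 * \<omega>)"
    and "B = ((3 * p + q) - 4 * \<kappa>\<^sup>2 / (3 * \<omega>)) / (2 * \<omega>)"
    and "C = ((p - q) + 4 * \<kappa>\<^sup>2 / (3 * \<omega>)) / (4 * \<omega>)"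
  from normal_form_residual_bound[OF \<omega>_pos D, of \<alpha> \<beta> \<gamma> \<kappa> \<sigma> A B C]
  obtain M where M': "M \<ge> 0" "\<forall>z f. norm z \<le> 1 \<longrightarrow> \<bar>f - cubic_restoring \<omega> \<alpha> \<beta> \<gamma> z\<bar> \<le> D * norm z ^ 4 \<longrightarrow>
       norm (normal_form_residual \<omega> \<alpha> \<beta> \<gamma> \<kappa> \<sigma> A B C f z) \<le> M * norm z ^ 4"
    "\<forall>z. norm z \<le> 1 \<longrightarrow> norm (quad_part \<omega> \<kappa> z + cubic_part A B C z) \<le> M * norm z ^ 2"
    by (elim exE conjE, intro that)
  note M = M'(1) M'(2)[rule_format] M'(3)[rule_format]
  define k where "k = 4 * (horizon * L)"
  have k: "k > 0" using horizon_pos L_pos by (simp add: k_def)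
  define N where "N = 16 * M + \<bar>\<sigma>\<bar> * (3 * k) * (2 + 4 * M)"
  have N: "N \<ge> 0" using M(1) k by (auto simp: N_def)
  define K where "K = 4 * N * horizon * (\<omega> / pi)"
  define \<delta> where "\<delta> = Min {\<epsilon>\<^sub>0 / 2, 1 / (400 * (horizon * L)), \<epsilon> / 2, 1 / 2, 1 / (2 * (M + 1)),
                            1 / (4 * (\<bar>\<sigma>\<bar> + 1) * horizon), 1}"
  have \<delta>: "\<delta> > 0" using \<epsilon>\<^sub>0_pos horizon_pos L_pos \<epsilon> M(1) unfolding \<delta>_def by (subst Min_gr_iff) auto
  show ?thesis
  proof (rule exI[of _ K], rule exI[of _ \<delta>], intro conjI allI impI \<delta>, elim conjE)
    fix c T
    assume c: "oscillation \<omega> F c" "c 0 \<noteq> 0" "norm (c 0) \<le> \<delta>" and T: "T \<le> horizon" "c T = c 0"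
      and wT: "\<bar>\<omega> * T - 2 * pi\<bar> \<le> 1 / 2"
    define s where "s = norm (c 0)"
    have s: "s > 0" using c by (simp add: s_def)
    have "s \<le> \<delta>" using c by (simp add: s_def)
    have "\<delta> \<le> \<epsilon>\<^sub>0 / 2" "\<delta> \<le> 1 / (400 * (horizon * L))" "\<delta> \<le> \<epsilon> / 2" "\<delta> \<le> 1 / 2"
      "\<delta> \<le> 1 / (2 * (M + 1))" "\<delta> \<le> 1 / (4 * (\<bar>\<sigma>\<bar> + 1) * horizon)" "\<delta> \<le> 1"
      unfolding \<delta>_def by (rule Min_le, simp, blast)+
    with \<open>s \<le> \<delta>\<close> have sd: "2 * s \<le> \<epsilon>\<^sub>0" "s \<le> 1 / (400 * (horizon * L))" "2 * s \<le> \<epsilon>" "2 * s \<le> 1"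
      "s \<le> 1 / (2 * (M + 1))" "s \<le> 1 / (4 * (\<bar>\<sigma>\<bar> + 1) * horizon)" "s \<le> 1"
      by linarith+
    have sm: "small_amplitude s"
      using sd(1,2) s horizon_pos L_pos by (auto simp: small_amplitude_def field_simps)
    have "\<omega> * T \<ge> pi" using wT pi_gt3 by linarith
    then have "\<omega> * T > 0" using pi_gt_zero by linarith
    then have Tp: "T \<ge> pi / \<omega>" "T > 0"
      using \<omega>_pos \<open>\<omega> * T \<ge> pi\<close> by (auto simp: field_simps zero_less_mult_iff)
    define \<Omega> where "\<Omega> = \<omega> + \<sigma> * s ^ 2"
    define \<zeta> where "\<zeta> = (\<lambda>t. c t + quad_part \<omega> \<kappa> (c t) + cubic_part A B C (c t))"
    define h where "h = (\<lambda>t. - \<i> * (of_real \<omega> * c t + of_real (F (c t))))"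
    define \<zeta>' where "\<zeta>' = (\<lambda>t. h t + quad_part_deriv \<omega> \<kappa> (c t) (h t) + cubic_part_deriv A B C (c t) (h t))"
    have d\<zeta>: "(\<zeta> has_vector_derivative \<zeta>' t) (at t)" for t
      unfolding \<zeta>_def \<zeta>'_def using c(1)
      by (intro normal_form_derivative) (simp add: oscillation_def h_def)
    \<comment> \<open>The frequency at the current radius is replaced by the one at the initial radius.\<close>
    have main: "norm (\<zeta>' t + \<i> * of_real \<Omega> * \<zeta> t) \<le> N * s ^ 4" if t: "0 \<le> t" "t \<le> T" for t
    proof -
      have th: "t \<le> horizon" using t T by simp
      define n where "n = norm (c t)"
      have n: "n \<le> 2 * s" "n \<ge> 0" using stays_small[OF c(1) sm _ t(1) th] by (auto simp: s_def n_def)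
      have n1: "n \<le> 1" "n \<le> \<epsilon>" using n sd by linarith+
      have "\<bar>n - s\<bar> \<le> norm (rotating c t - c 0)"
        using norm_triangle_ineq3[of "rotating c t" "c 0"] by (simp add: n_def s_def norm_mult)
      also have "\<dots> \<le> k * s * s"
        using rotating_almost_constant[OF c(1) sm _ t(1) th] by (simp add: s_def k_def)
      finally have ns: "\<bar>n - s\<bar> \<le> k * s * s" .
      have "\<bar>n ^ 2 - s ^ 2\<bar> = \<bar>(n - s) * (n + s)\<bar>"
        by (simp add: power2_eq_square algebra_simps)
      also have "\<dots> = \<bar>n - s\<bar> * (n + s)" using n s by (simp add: abs_mult)
      also have "\<dots> \<le> (k * s * s) * (3 * s)" using ns n s k by (intro mult_mono) auto
      finally have n2: "\<bar>n ^ 2 - s ^ 2\<bar> \<le> 3 * k * s ^ 3" by (simp add: power3_eq_cube mult_ac)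
      have nz: "norm (\<zeta> t) \<le> (2 + 4 * M) * s"
      proof -
        have "norm (\<zeta> t) \<le> n + norm (quad_part \<omega> \<kappa> (c t) + cubic_part A B C (c t))"
          unfolding \<zeta>_def n_def add.assoc by (rule norm_triangle_ineq)
        also have "\<dots> \<le> n + M * n ^ 2" using M(3)[of "c t"] n1 by (simp add: n_def)
        also have "\<dots> \<le> 2 * s + M * (2 * s) ^ 2" using n M(1) by (intro add_mono mult_left_mono power_mono) auto
        also have "(2 * s) ^ 2 = 4 * (s * s)" by (simp add: power2_eq_square)
        also have "2 * s + M * (4 * (s * s)) \<le> 2 * s + M * (4 * (1 * s))"
          using sd s M(1) by (intro add_mono mult_left_mono mult_right_mono) auto
        finally show ?thesis by (simp add: algebra_simps)
      qed
      have id: "\<zeta>' t + \<i> * of_real (\<omega> + \<sigma> * n\<^sup>2) * \<zeta> t =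
          normal_form_residual \<omega> \<alpha> \<beta> \<gamma> \<kappa> \<sigma> A B C (F (c t)) (c t)"
        using homological_identity[of \<omega> "c t" "F (c t)" \<alpha> \<beta> \<gamma>] \<omega>_pos
        unfolding n_def \<zeta>_def \<zeta>'_def h_def \<sigma> A_def B_def C_def \<kappa>_def p_def q_def by simp
      have "norm (\<zeta>' t + \<i> * of_real (\<omega> + \<sigma> * n\<^sup>2) * \<zeta> t) \<le> M * n ^ 4"
        using M(2)[of "c t" "F (c t)"] F[of "c t"] n1 unfolding id unfolding n_def by blast
      also have "\<dots> \<le> M * (2 * s) ^ 4" using n M(1) by (intro mult_left_mono power_mono) auto
      finally have r1: "norm (\<zeta>' t + \<i> * of_real (\<omega> + \<sigma> * n\<^sup>2) * \<zeta> t) \<le> 16 * M * s ^ 4"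
        by (simp add: power_mult_distrib)
      have "norm (\<i> * of_real (\<sigma> * (n\<^sup>2 - s\<^sup>2)) * \<zeta> t) = \<bar>\<sigma>\<bar> * \<bar>n\<^sup>2 - s\<^sup>2\<bar> * norm (\<zeta> t)"
        by (simp add: norm_mult abs_mult del: of_real_diff of_real_mult)
      also have "\<dots> \<le> \<bar>\<sigma>\<bar> * (3 * k * s ^ 3) * ((2 + 4 * M) * s)"
        using n2 nz k s by (intro mult_mono) auto
      finally have r2: "norm (\<i> * of_real (\<sigma> * (n\<^sup>2 - s\<^sup>2)) * \<zeta> t) \<le> \<bar>\<sigma>\<bar> * (3 * k) * (2 + 4 * M) * s ^ 4"
        by (simp add: power_numeral_reduce mult_ac)
      have "\<zeta>' t + \<i> * of_real \<Omega> * \<zeta> t = (\<zeta>' t + \<i> * of_real (\<omega> + \<sigma> * n\<^sup>2) * \<zeta> t) - \<i> * of_real (\<sigma> * (n\<^sup>2 - s\<^sup>2)) * \<zeta> t"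
        by (simp add: \<Omega>_def algebra_simps)
      then have "norm (\<zeta>' t + \<i> * of_real \<Omega> * \<zeta> t) \<le> norm (\<zeta>' t + \<i> * of_real (\<omega> + \<sigma> * n\<^sup>2) * \<zeta> t)
          + norm (\<i> * of_real (\<sigma> * (n\<^sup>2 - s\<^sup>2)) * \<zeta> t)" by (metis norm_triangle_ineq4)
      with r1 r2 show ?thesis by (simp add: N_def distrib_right)
    qed
    have "norm (cis (\<Omega> * T) * \<zeta> T - cis (\<Omega> * 0) * \<zeta> 0) \<le> (N * s ^ 4) * (T - 0)"
    proof (rule norm_diff_le_of_vector_derivative)
      fix t assume t: "0 \<le> t" "t \<le> T"
      have dc: "((\<lambda>t. cis (\<Omega> * t)) has_vector_derivative \<i> * of_real \<Omega> * cis (\<Omega> * t)) (at t)"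
        by (auto intro!: derivative_eq_intros simp: complex_eq_iff has_vector_derivative_complex_iff)
      have "((\<lambda>t. cis (\<Omega> * t) * \<zeta> t) has_vector_derivative
          cis (\<Omega> * t) * \<zeta>' t + (\<i> * of_real \<Omega> * cis (\<Omega> * t)) * \<zeta> t) (at t)"
        by (rule has_vector_derivative_mult[OF dc d\<zeta>])
      then show "((\<lambda>t. cis (\<Omega> * t) * \<zeta> t) has_vector_derivative
          cis (\<Omega> * t) * (\<zeta>' t + \<i> * of_real \<Omega> * \<zeta> t)) (at t)"
        by (simp add: algebra_simps)
      show "norm (cis (\<Omega> * t) * (\<zeta>' t + \<i> * of_real \<Omega> * \<zeta> t)) \<le> N * s ^ 4"
        using main[OF t] by (simp add: norm_mult)
    qed (use Tp in auto)
    also have "\<dots> \<le> N * s ^ 4 * horizon" using T N s by (intro mult_left_mono) auto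
    also have "cis (\<Omega> * T) * \<zeta> T - cis (\<Omega> * 0) * \<zeta> 0 = (cis (\<Omega> * T) - 1) * \<zeta> 0"
      using T by (simp add: \<zeta>_def algebra_simps)
    finally have e1: "norm (cis (\<Omega> * T) - 1) * norm (\<zeta> 0) \<le> N * s ^ 4 * horizon"
      by (simp add: norm_mult)
    have "norm (\<zeta> 0) \<ge> s / 2"
    proof -
      have "norm (quad_part \<omega> \<kappa> (c 0) + cubic_part A B C (c 0)) \<le> M * s ^ 2"
        using M(3)[of "c 0"] sd(7) by (simp add: s_def)
      moreover have "M * s ^ 2 \<le> s / 2"
      proof -
        have "M * s \<le> (M + 1) * s" using s by simp
        also have "\<dots> \<le> 1 / 2" using sd(5) M(1) by (simp add: field_simps)
        finally show ?thesis using mult_right_mono[of "M * s" "1/2" s] s by (simp add: power2_eq_square)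
      qed
      ultimately show ?thesis
        using norm_triangle_ineq4[of "\<zeta> 0" "quad_part \<omega> \<kappa> (c 0) + cubic_part A B C (c 0)"]
        by (simp add: \<zeta>_def s_def)
    qed
    then have "norm (cis (\<Omega> * T) - 1) * (s / 2) \<le> N * s ^ 4 * horizon"
      using e1 mult_left_mono[of "s / 2" "norm (\<zeta> 0)" "norm (cis (\<Omega> * T) - 1)"] by simp
    also have "\<dots> = 2 * N * horizon * s ^ 3 * (s / 2)" by (simp add: power_numeral_reduce)
    finally have e2: "norm (cis (\<Omega> * T) - 1) \<le> 2 * N * horizon * s ^ 3"
      using s mult_le_cancel_right_pos[of "s / 2"] by simp
    have "\<bar>\<sigma> * s ^ 2 * T\<bar> \<le> 1 / 2"
    proof -
      have "\<bar>\<sigma> * s ^ 2 * T\<bar> = \<bar>\<sigma>\<bar> * (s * s) * T" using Tp by (simp add: abs_mult power2_eq_square)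
      also have "\<dots> \<le> (\<bar>\<sigma>\<bar> + 1) * (1 * s) * horizon"
        using T Tp s sd(7) by (intro mult_mono) auto
      also have "\<dots> \<le> 1 / 4"
      proof -
        have pos: "4 * (\<bar>\<sigma>\<bar> + 1) * horizon > 0" using horizon_pos by (intro mult_pos_pos) auto
        with sd(6) have "s * (4 * (\<bar>\<sigma>\<bar> + 1) * horizon) \<le> 1"
          by (simp only: pos_le_divide_eq[OF pos])
        then show ?thesis by (simp add: mult_ac)
      qed
      finally show ?thesis by simp
    qed
    moreover have "\<Omega> * T = \<omega> * T + \<sigma> * s ^ 2 * T" by (simp add: \<Omega>_def algebra_simps)
    ultimately have "\<bar>\<Omega> * T - 2 * pi\<bar> \<le> pi / 3" using wT pi_gt3 by linarith
    from norm_cis_minus_1_ge[OF this] e2 have e3: "\<bar>\<Omega> * T - 2 * pi\<bar> \<le> 4 * N * horizon * s ^ 3" by simp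
    have "\<bar>2 * pi / T - \<Omega>\<bar> = \<bar>\<Omega> * T - 2 * pi\<bar> / T"
      using Tp by (simp add: field_simps abs_if)
    also have "\<dots> \<le> (4 * N * horizon * s ^ 3) / (pi / \<omega>)"
      using e3 Tp \<omega>_pos by (intro frac_le) auto
    also have "\<dots> = K * s ^ 3" by (simp add: K_def)
    finally show "\<bar>2 * pi / T - (\<omega> + \<sigma> * norm (c 0) ^ 2)\<bar> \<le> K * norm (c 0) ^ 3"
      by (simp add: \<Omega>_def s_def)
  qed
qed

end


section \<open>Power series and polynomials near the origin\<close>

lemma abs_summable_on_cart:
  fixes f :: "'a \<Rightarrow> real ^ 'n"
  assumes "f summable_on A" shows "(\<lambda>x. norm (f x)) summable_on A"
proof (rule Infinite_Sum.abs_summable_on_comparison_test')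
  have k: "(\<lambda>x. \<bar>f x $ k\<bar>) summable_on A" for k
  proof -
    have "(\<lambda>x. f x $ k) summable_on A"
      by (rule summable_on_bounded_linear[OF bounded_linear_vec_nth assms])
    then show ?thesis
      using summable_on_iff_abs_summable_on_real by fastforce
  qed
  have "(\<lambda>x. \<Sum>k\<in>I. \<bar>f x $ k\<bar>) summable_on A" if "finite I" for I
    using that by (induction I) (auto intro: summable_on_add k)
  then show "(\<lambda>x. \<Sum>k\<in>UNIV. \<bar>f x $ k\<bar>) summable_on A" by simp
  show "norm (f x) \<le> (\<Sum>k\<in>UNIV. \<bar>f x $ k\<bar>)" for x
    by (rule norm_le_l1_cart)
qed

lemma abs_le_of_products:
  fixes a p q r s :: real
  assumes "a = p * q + r * s"
  shows "\<bar>a\<bar> \<le> \<bar>p\<bar> * \<bar>q\<bar> + \<bar>r\<bar> * \<bar>s\<bar>"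
  using abs_triangle_ineq[of "p * q" "r * s"] by (simp add: assms abs_mult)

lemma power_diff_le:
  fixes x y r :: real
  assumes "\<bar>x\<bar> \<le> r" "\<bar>y\<bar> \<le> r"
  shows "r * \<bar>x ^ n - y ^ n\<bar> \<le> real n * r ^ n * \<bar>x - y\<bar>"
proof (induction n)
  case (Suc n)
  have r: "r \<ge> 0" using assms by linarith
  have "x ^ Suc n - y ^ Suc n = x * (x ^ n - y ^ n) + (x - y) * y ^ n"
    by (simp add: algebra_simps)
  then have "\<bar>x ^ Suc n - y ^ Suc n\<bar> \<le> \<bar>x\<bar> * \<bar>x ^ n - y ^ n\<bar> + \<bar>x - y\<bar> * \<bar>y\<bar> ^ n"
    unfolding power_abs[symmetric] by (rule abs_le_of_products)
  also have "\<dots> \<le> r * \<bar>x ^ n - y ^ n\<bar> + \<bar>x - y\<bar> * r ^ n"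
    using assms by (intro add_mono mult_right_mono mult_left_mono power_mono) auto
  also have "\<dots> \<le> real n * r ^ n * \<bar>x - y\<bar> + \<bar>x - y\<bar> * r ^ n"
    using Suc by simp
  also have "\<dots> = real (Suc n) * r ^ n * \<bar>x - y\<bar>" by (simp add: algebra_simps)
  finally have "r * \<bar>x ^ Suc n - y ^ Suc n\<bar> \<le> r * (real (Suc n) * r ^ n * \<bar>x - y\<bar>)"
    using r by (rule mult_left_mono)
  then show ?case by (simp add: mult_ac)
qed simp

lemma monomial2_diff_le:
  fixes x y v u r :: real
  assumes "\<bar>x\<bar> \<le> r" "\<bar>y\<bar> \<le> r" "\<bar>v\<bar> \<le> r" "\<bar>u\<bar> \<le> r"
  shows "r * \<bar>x ^ i * v ^ j - y ^ i * u ^ j\<bar> \<le> real (i + j) * r ^ (i + j) * (\<bar>x - y\<bar> + \<bar>v - u\<bar>)"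
proof -
  have r: "r \<ge> 0" using assms by linarith
  have "x ^ i * v ^ j - y ^ i * u ^ j = (x ^ i - y ^ i) * v ^ j + y ^ i * (v ^ j - u ^ j)"
    by (simp add: algebra_simps)
  then have "\<bar>x ^ i * v ^ j - y ^ i * u ^ j\<bar> \<le> \<bar>x ^ i - y ^ i\<bar> * \<bar>v\<bar> ^ j + \<bar>y\<bar> ^ i * \<bar>v ^ j - u ^ j\<bar>"
    unfolding power_abs[symmetric] by (rule abs_le_of_products)
  also have "\<dots> \<le> \<bar>x ^ i - y ^ i\<bar> * r ^ j + r ^ i * \<bar>v ^ j - u ^ j\<bar>"
    using assms by (intro add_mono mult_right_mono mult_left_mono power_mono) auto
  finally have "r * \<bar>x ^ i * v ^ j - y ^ i * u ^ j\<bar> \<le>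
      (r * \<bar>x ^ i - y ^ i\<bar>) * r ^ j + r ^ i * (r * \<bar>v ^ j - u ^ j\<bar>)"
    using mult_left_mono[OF _ r] by (fastforce simp: algebra_simps)
  also have "\<dots> \<le> (real i * r ^ i * \<bar>x - y\<bar>) * r ^ j + r ^ i * (real j * r ^ j * \<bar>v - u\<bar>)"
    using r assms by (intro add_mono mult_right_mono mult_left_mono power_diff_le) auto
  also have "\<dots> = (real i * r ^ (i + j)) * \<bar>x - y\<bar> + (real j * r ^ (i + j)) * \<bar>v - u\<bar>"
    by (simp add: power_add mult_ac)
  also have "\<dots> \<le> (real (i + j) * r ^ (i + j)) * \<bar>x - y\<bar> + (real (i + j) * r ^ (i + j)) * \<bar>v - u\<bar>"
    using r by (intro add_mono mult_right_mono) auto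
  finally show ?thesis by (simp add: algebra_simps)
qed

text \<open>On half the radius \<open>s\<close> of a square on which the series converges absolutely, the Lipschitz constant of a
monomial of degree \<open>i + j\<close> is at most \<open>(i + j) / 2 ^ (i + j)\<close> times a multiple of \<open>s ^ (i + j)\<close>, and the first
factor is bounded by \<open>1\<close>.\<close>

lemma analytic_imp_lipschitz_near_0:
  fixes f :: "real \<times> real \<Rightarrow> real ^ 'n"
  assumes "real_analytic2_on f U" "(0, 0) \<in> U"
  obtains L \<delta> where "L > 0" "\<delta> > 0"
    "\<And>x v y u. \<bar>x\<bar> \<le> \<delta> \<Longrightarrow> \<bar>v\<bar> \<le> \<delta> \<Longrightarrow> \<bar>y\<bar> \<le> \<delta> \<Longrightarrow> \<bar>u\<bar> \<le> \<delta> \<Longrightarrow>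
       norm (f (x, v) - f (y, u)) \<le> L * (\<bar>x - y\<bar> + \<bar>v - u\<bar>)"
proof -
  obtain \<rho> a where \<rho>: "\<rho> > 0" and ps: "\<And>x v. \<bar>x\<bar> < \<rho> \<Longrightarrow> \<bar>v\<bar> < \<rho> \<Longrightarrow>
      ((\<lambda>(i, j). (x ^ i * v ^ j) *\<^sub>R a i j) has_sum f (x, v)) UNIV"
    using assms unfolding real_analytic2_on_def by fastforce
  define s where "s = \<rho> / 2"
  define r where "r = s / 2"
  have sr: "s > 0" "r > 0" "s = 2 * r" "s < \<rho>" "r < \<rho>" using \<rho> by (auto simp: s_def r_def)
  define g where "g = (\<lambda>(i, j). norm ((s ^ i * s ^ j) *\<^sub>R a i j))"
  have "(\<lambda>(i, j). (s ^ i * s ^ j) *\<^sub>R a i j) summable_on UNIV"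
    using ps[of s s] sr by (auto intro: has_sum_imp_summable)
  from abs_summable_on_cart[OF this] have "g summable_on UNIV"
    by (simp add: g_def case_prod_unfold)
  then obtain G where G: "(g has_sum G) UNIV" by (auto simp: summable_on_def)
  have "G \<ge> 0" by (rule has_sum_nonneg[OF G]) (auto simp: g_def)
  show ?thesis
  proof (rule that[of "G / r + 1" r])
    show "G / r + 1 > 0" using \<open>G \<ge> 0\<close> sr by (simp add: add_nonneg_pos)
    fix x v y u assume b: "\<bar>x\<bar> \<le> r" "\<bar>v\<bar> \<le> r" "\<bar>y\<bar> \<le> r" "\<bar>u\<bar> \<le> r"
    define m where "m = \<bar>x - y\<bar> + \<bar>v - u\<bar>"
    have m: "m \<ge> 0" by (simp add: m_def)
    have d: "((\<lambda>p. (case p of (i, j) \<Rightarrow> (x ^ i * v ^ j) *\<^sub>R a i j) + - (case p of (i, j) \<Rightarrow> (y ^ i * u ^ j) *\<^sub>R a i j))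
        has_sum (f (x, v) + - f (y, u))) UNIV"
      using b sr ps[of x v] ps[of y u] by (intro has_sum_add) (auto simp: has_sum_uminus)
    have "norm (f (x, v) - f (y, u)) \<le> (m / r) * G"
    proof (rule norm_infsum_le[OF d[unfolded add_uminus_conv_diff] has_sum_cmult_right[OF G]])
      fix p :: "nat \<times> nat"
      obtain i j where p: "p = (i, j)" by force
      have "r * \<bar>x ^ i * v ^ j - y ^ i * u ^ j\<bar> \<le> real (i + j) * r ^ (i + j) * m"
        using b unfolding m_def by (intro monomial2_diff_le) auto
      also have "\<dots> \<le> 2 ^ (i + j) * r ^ (i + j) * m"
        using of_nat_less_two_power[of "i + j", where 'a = real] m sr
        by (intro mult_right_mono) auto
      also have "\<dots> = s ^ i * s ^ j * m"
        unfolding sr(3) by (simp add: power_add power_mult_distrib)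
      finally have "\<bar>x ^ i * v ^ j - y ^ i * u ^ j\<bar> \<le> (m / r) * (s ^ i * s ^ j)"
        using sr by (simp add: field_simps)
      then have "\<bar>x ^ i * v ^ j - y ^ i * u ^ j\<bar> * norm (a i j) \<le> (m / r) * (s ^ i * s ^ j) * norm (a i j)"
        by (rule mult_right_mono) auto
      then show "norm ((case p of (i, j) \<Rightarrow> (x ^ i * v ^ j) *\<^sub>R a i j) - (case p of (i, j) \<Rightarrow> (y ^ i * u ^ j) *\<^sub>R a i j))
          \<le> m / r * g p"
        using sr by (simp add: p g_def abs_mult flip: scaleR_left_diff_distrib)
    qed
    also have "\<dots> \<le> (G / r + 1) * m" using m by (simp add: algebra_simps)
    finally show "norm (f (x, v) - f (y, u)) \<le> (G / r + 1) * (\<bar>x - y\<bar> + \<bar>v - u\<bar>)"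
      by (simp add: m_def)
  qed (use sr in auto)
qed

abbreviation monomial :: "nat \<Rightarrow> ('n::finite \<Rightarrow> nat) \<Rightarrow> real \<Rightarrow> real ^ 'n \<Rightarrow> real" where
  "monomial j k x y \<equiv> x ^ j * (\<Prod>i\<in>UNIV. (y $ i) ^ k i)"

lemma monomial_lipschitz_unit:
  fixes y u :: "real ^ 'n"
  assumes "\<bar>x\<bar> \<le> 1" "\<bar>v\<bar> \<le> 1" "norm y \<le> 1" "norm u \<le> 1"
  shows "\<bar>monomial j k x y - monomial j k v u\<bar> \<le> real (j + multi_order k) * (\<bar>x - v\<bar> + norm (y - u))"
proof -
  have c: "\<bar>y $ i\<bar> \<le> 1" "\<bar>u $ i\<bar> \<le> 1" "\<bar>y $ i - u $ i\<bar> \<le> norm (y - u)" for i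
    using component_le_norm_cart[of y i] component_le_norm_cart[of u i]
      component_le_norm_cart[of "y - u" i] assms by auto
  have "norm ((\<Prod>i\<in>UNIV. (y $ i) ^ k i) - (\<Prod>i\<in>UNIV. (u $ i) ^ k i))
      \<le> (\<Sum>i\<in>UNIV. norm ((y $ i) ^ k i - (u $ i) ^ k i))"
    using c by (intro norm_prod_diff) (auto simp: power_abs power_le_one)
  also have "\<dots> \<le> (\<Sum>i\<in>UNIV. real (k i) * norm (y - u))"
  proof (rule sum_mono)
    fix i
    have "norm ((y $ i) ^ k i - (u $ i) ^ k i) \<le> real (k i) * norm (y $ i - u $ i)"
      using c by (intro norm_power_diff) auto
    also have "\<dots> \<le> real (k i) * norm (y - u)" using c by (intro mult_left_mono) auto
    finally show "norm ((y $ i) ^ k i - (u $ i) ^ k i) \<le> real (k i) * norm (y - u)" .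
  qed
  also have "\<dots> = real (multi_order k) * norm (y - u)" by (simp add: sum_distrib_right)
  finally have b: "\<bar>(\<Prod>i\<in>UNIV. (y $ i) ^ k i) - (\<Prod>i\<in>UNIV. (u $ i) ^ k i)\<bar> \<le> real (multi_order k) * norm (y - u)"
    by simp
  have a: "\<bar>x ^ j - v ^ j\<bar> \<le> real j * \<bar>x - v\<bar>"
    using norm_power_diff[of x v j] assms by simp
  have B: "\<bar>\<Prod>i\<in>UNIV. (y $ i) ^ k i\<bar> \<le> 1"
    unfolding abs_prod using c by (intro prod_le_1) (auto simp: power_abs power_le_one)
  have A: "\<bar>v ^ j\<bar> \<le> 1" using assms by (simp add: power_abs power_le_one)
  have "monomial j k x y - monomial j k v u
     = (x ^ j - v ^ j) * (\<Prod>i\<in>UNIV. (y $ i) ^ k i)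
      + v ^ j * ((\<Prod>i\<in>UNIV. (y $ i) ^ k i) - (\<Prod>i\<in>UNIV. (u $ i) ^ k i))"
    by (simp add: algebra_simps)
  then have "\<bar>monomial j k x y - monomial j k v u\<bar>
     \<le> \<bar>x ^ j - v ^ j\<bar> * \<bar>\<Prod>i\<in>UNIV. (y $ i) ^ k i\<bar>
      + \<bar>v ^ j\<bar> * \<bar>(\<Prod>i\<in>UNIV. (y $ i) ^ k i) - (\<Prod>i\<in>UNIV. (u $ i) ^ k i)\<bar>"
    by (rule abs_le_of_products)
  also have "\<dots> \<le> (real j * \<bar>x - v\<bar>) * 1 + 1 * (real (multi_order k) * norm (y - u))"
    using a b A B by (intro add_mono mult_mono) auto
  also have "\<dots> \<le> real (j + multi_order k) * \<bar>x - v\<bar> + real (j + multi_order k) * norm (y - u)"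
    unfolding mult_1 mult_1_right by (intro add_mono mult_right_mono) (auto simp del: of_nat_sum)
  finally show ?thesis by (simp add: distrib_left)
qed

lemma monomial_scale:
  "monomial j k (e * x) (e *\<^sub>R y) = e ^ (j + multi_order k) * monomial j k x y"
  by (simp add: power_mult_distrib prod.distrib power_add power_sum mult_ac)

text \<open>Scaling reduces the ball of radius \<open>e\<close> to the unit ball. Of the powers of \<open>e\<close> gained from a degree of at least
two, one is lost by scaling the arguments back.\<close>

lemma monomial_lipschitz:
  fixes y u :: "real ^ 'n"
  assumes "\<bar>x\<bar> \<le> e" "\<bar>v\<bar> \<le> e" "norm y \<le> e" "norm u \<le> e" "0 < e" "e \<le> 1" "2 \<le> j + multi_order k"
  shows "\<bar>monomial j k x y - monomial j k v u\<bar> \<le> real (j + multi_order k) * e * (\<bar>x - v\<bar> + norm (y - u))"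
proof -
  define N where "N = j + multi_order k"
  have sc: "monomial j k x y = e ^ N * monomial j k (x / e) (y /\<^sub>R e)" for x and y :: "real ^ 'n"
    using monomial_scale[where e = e and j = j and k = k and x = "x / e" and y = "y /\<^sub>R e"] assms by (simp add: N_def)
  have "\<bar>monomial j k x y - monomial j k v u\<bar>
      = e ^ N * \<bar>monomial j k (x / e) (y /\<^sub>R e) - monomial j k (v / e) (u /\<^sub>R e)\<bar>"
    unfolding sc[of x] sc[of v] right_diff_distrib[symmetric] abs_mult using assms by simp
  also have "\<dots> \<le> e ^ N * (real N * (\<bar>x / e - v / e\<bar> + norm (y /\<^sub>R e - u /\<^sub>R e)))"
    unfolding N_def using assms
    by (intro mult_left_mono monomial_lipschitz_unit) (auto simp: divide_simps)
  also have "\<bar>x / e - v / e\<bar> + norm (y /\<^sub>R e - u /\<^sub>R e) = (\<bar>x - v\<bar> + norm (y - u)) / e"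
    using assms by (simp add: divide_simps flip: diff_divide_distrib scaleR_diff_right)
  also have "e ^ N * (real N * ((\<bar>x - v\<bar> + norm (y - u)) / e)) = e ^ N * (real N * (\<bar>x - v\<bar> + norm (y - u)) / e)"
    by simp
  also have "\<dots> \<le> e ^ 2 * (real N * (\<bar>x - v\<bar> + norm (y - u)) / e)"
    using assms by (intro mult_right_mono power_decreasing divide_nonneg_pos mult_nonneg_nonneg)
      (simp_all add: N_def del: of_nat_add of_nat_sum)
  also have "\<dots> = real N * e * (\<bar>x - v\<bar> + norm (y - u))"
    using assms by (simp add: power2_eq_square)
  finally show ?thesis by (simp add: N_def)
qed

lemma nonlin_poly_lipschitz:
  fixes c :: "nat \<Rightarrow> ('n::finite \<Rightarrow> nat) \<Rightarrow> 'b::real_normed_vector"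
  obtains C where "C > 0"
    "\<And>e x v y u. \<bar>x\<bar> \<le> e \<Longrightarrow> \<bar>v\<bar> \<le> e \<Longrightarrow> norm y \<le> e \<Longrightarrow> norm u \<le> e \<Longrightarrow> 0 < e \<Longrightarrow> e \<le> 1 \<Longrightarrow>
      norm (nonlin_poly l c x y - nonlin_poly l c v u) \<le> C * e * (\<bar>x - v\<bar> + norm (y - u))"
proof -
  define C where "C = (\<Sum>(j, k)\<in>poly_indices l. real (j + multi_order k) * norm (c j k))"
  have C: "C \<ge> 0" unfolding C_def
    by (intro sum_nonneg) (auto simp del: of_nat_add of_nat_sum intro!: mult_nonneg_nonneg)
  show ?thesis
  proof (rule that[of "C + 1"])
    fix e x v :: real and y u :: "real ^ 'n"
    assume b: "\<bar>x\<bar> \<le> e" "\<bar>v\<bar> \<le> e" "norm y \<le> e" "norm u \<le> e" "0 < e" "e \<le> 1"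
    define m where "m = \<bar>x - v\<bar> + norm (y - u)"
    have "norm (nonlin_poly l c x y - nonlin_poly l c v u)
      = norm (\<Sum>(j, k)\<in>poly_indices l. (monomial j k x y - monomial j k v u) *\<^sub>R c j k)"
      unfolding nonlin_poly_def
      by (simp add: sum_subtractf[symmetric] case_prod_unfold scaleR_left_diff_distrib)
    also have "\<dots> \<le> (\<Sum>(j, k)\<in>poly_indices l. (real (j + multi_order k) * norm (c j k)) * (e * m))"
    proof (rule sum_norm_le)
      fix jk :: "nat \<times> ('n \<Rightarrow> nat)" assume jk: "jk \<in> poly_indices l"
      obtain j k where [simp]: "jk = (j, k)" by force
      have "\<bar>monomial j k x y - monomial j k v u\<bar> \<le> real (j + multi_order k) * e * m"
        unfolding m_def using jk b by (intro monomial_lipschitz) (auto simp: poly_indices_def)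
      from mult_right_mono[OF this, of "norm (c j k)"]
      show "norm (case jk of (j, k) \<Rightarrow> (monomial j k x y - monomial j k v u) *\<^sub>R c j k)
        \<le> (case jk of (j, k) \<Rightarrow> (real (j + multi_order k) * norm (c j k)) * (e * m))"
        by (simp add: mult_ac)
    qed
    also have "\<dots> = C * (e * m)" by (simp add: C_def sum_distrib_right case_prod_unfold)
    also have "\<dots> \<le> (C + 1) * (e * m)" using b by (intro mult_right_mono) (auto simp: m_def)
    finally show "norm (nonlin_poly l c x y - nonlin_poly l c v u) \<le> (C + 1) * e * (\<bar>x - v\<bar> + norm (y - u))"
      by (simp add: m_def mult_ac)
  qed (use C in auto)
qed

lemma unit_index_props:
  shows "multi_order (unit_index i :: 'n::finite \<Rightarrow> nat) = 1"
    and "(\<Prod>i'\<in>UNIV. (y $ i') ^ unit_index i i') = (y $ i :: real)"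
    and "inj (unit_index :: 'n \<Rightarrow> 'n \<Rightarrow> nat)"
proof -
  show "multi_order (unit_index i :: 'n::finite \<Rightarrow> nat) = 1" by (simp add: unit_index_def)
  have "(\<Prod>i'\<in>UNIV. (y $ i') ^ unit_index i i') = (\<Prod>i'\<in>UNIV. if i' = i then y $ i' else 1)"
    by (intro prod.cong) (auto simp: unit_index_def)
  then show "(\<Prod>i'\<in>UNIV. (y $ i') ^ unit_index i i') = (y $ i :: real)" by simp
  show "inj (unit_index :: 'n \<Rightarrow> 'n \<Rightarrow> nat)"
    by (rule injI) (metis unit_index_def zero_neq_one)
qed

lemma multi_order_1_iff: "multi_order k = 1 \<longleftrightarrow> (\<exists>i::'n::finite. k = unit_index i)"
proof
  assume "multi_order k = 1"
  then obtain i where i: "k i = 1" "\<And>j. j \<noteq> i \<Longrightarrow> k j = 0"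
    by (metis (no_types, lifting) UNIV_I finite sum_eq_1_iff)
  then have "k = unit_index i" by (auto simp: unit_index_def)
  then show "\<exists>i. k = unit_index i" ..
qed (auto simp: unit_index_props)

text \<open>Here \<open>x\<close> has weight one and \<open>y\<close> weight two, because \<open>y = w (x, v)\<close> is of second order. The monomials of weight at
most three are \<open>x\<^sup>2\<close>, \<open>x\<^sup>3\<close> and \<open>x y\<^sub>i\<close>.\<close>

definition low_order_part ::
    "(nat \<Rightarrow> ('n::finite \<Rightarrow> nat) \<Rightarrow> 'b::real_vector) \<Rightarrow> real \<Rightarrow> real ^ 'n \<Rightarrow> 'b" where
  "low_order_part c x y = x\<^sup>2 *\<^sub>R c 2 (\<lambda>_. 0) + x ^ 3 *\<^sub>R c 3 (\<lambda>_. 0)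
     + (\<Sum>i\<in>UNIV. (x * y $ i) *\<^sub>R c 1 (unit_index i))"

lemma nonlin_poly_expansion:
  fixes c :: "nat \<Rightarrow> ('n::finite \<Rightarrow> nat) \<Rightarrow> 'b::real_normed_vector"
  assumes l: "l \<le> 3" and c: "\<And>j k. l < j + multi_order k \<Longrightarrow> c j k = 0" and B: "B \<ge> 1"
  obtains C where "C \<ge> 0"
    "\<And>n x y. 0 \<le> n \<Longrightarrow> n \<le> 1 \<Longrightarrow> \<bar>x\<bar> \<le> n \<Longrightarrow> norm y \<le> B * n\<^sup>2 \<Longrightarrow>
      norm (nonlin_poly l c x y - low_order_part c x y) \<le> C * n ^ 4"
proof -
  define S1 :: "(nat \<times> ('n \<Rightarrow> nat)) set" where "S1 = range (\<lambda>i. (1, unit_index i))"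
  define S :: "(nat \<times> ('n \<Rightarrow> nat)) set" where "S = insert (2, \<lambda>_. 0) (insert (3, \<lambda>_. 0) S1)"
  have S: "S \<subseteq> poly_indices 3" "finite S"
    by (auto simp: S_def S1_def poly_indices_def unit_index_props)
  define C where "C = (\<Sum>(j, k)\<in>poly_indices 3 - S. B ^ 3 * norm (c j k))"
  have C: "C \<ge> 0" using B unfolding C_def by (intro sum_nonneg) auto
  show ?thesis
  proof (rule that[OF C])
    fix n x :: real and y :: "real ^ 'n"
    assume n: "0 \<le> n" "n \<le> 1" and x: "\<bar>x\<bar> \<le> n" and y: "norm y \<le> B * n\<^sup>2"
    let ?t = "\<lambda>(j, k). monomial j k x y *\<^sub>R c j k"
    have "nonlin_poly l c x y = sum ?t (poly_indices 3)"
      unfolding nonlin_poly_def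
    proof (intro sum.mono_neutral_left finite_poly_indices ballI)
      fix jk :: "nat \<times> ('n \<Rightarrow> nat)" assume "jk \<in> poly_indices 3 - poly_indices l"
      then show "?t jk = 0" using c[of "fst jk" "snd jk"] by (fastforce simp: poly_indices_def)
    qed (use l in \<open>auto simp: poly_indices_def\<close>)
    also have "\<dots> = sum ?t (poly_indices 3 - S) + sum ?t S"
      using S finite_poly_indices by (intro sum.subset_diff)
    also have "sum ?t S = x\<^sup>2 *\<^sub>R c 2 (\<lambda>_. 0) + (x ^ 3 *\<^sub>R c 3 (\<lambda>_. 0) + sum ?t S1)"
    proof -
      have "finite S1" "(2, \<lambda>_. 0) \<notin> insert (3, \<lambda>_. 0) S1" "(3, \<lambda>_. 0) \<notin> S1"
        by (auto simp: S1_def)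
      then show ?thesis unfolding S_def by simp
    qed
    also have "sum ?t S1 = (\<Sum>i\<in>UNIV. (x * y $ i) *\<^sub>R c 1 (unit_index i))"
      unfolding S1_def
      by (subst sum.reindex) (auto simp: inj_on_def unit_index_props dest: injD[OF unit_index_props(3)])
    finally have "nonlin_poly l c x y - low_order_part c x y = sum ?t (poly_indices 3 - S)"
      by (simp add: low_order_part_def algebra_simps)
    also have "norm \<dots> \<le> (\<Sum>(j, k)\<in>poly_indices 3 - S. (B ^ 3 * norm (c j k)) * n ^ 4)"
    proof (rule sum_norm_le)
      fix jk :: "nat \<times> ('n \<Rightarrow> nat)" assume jk: "jk \<in> poly_indices 3 - S"
      obtain j k where jk_eq [simp]: "jk = (j, k)" by force
      have ord: "2 \<le> j + multi_order k" "j + multi_order k \<le> 3"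
        using jk by (auto simp: poly_indices_def)
      \<comment> \<open>Outside \<open>S\<close> the weight is at least four; the power of \<open>B\<close> is at most three as the order is.\<close>
      have four: "4 \<le> j + 2 * multi_order k"
      proof (rule ccontr)
        assume "\<not> 4 \<le> j + 2 * multi_order k"
        with ord consider "multi_order k = 0" "j = 2 \<or> j = 3" | "multi_order k = 1" "j = 1"
          by linarith
        then show False
        proof cases
          case 1
          then have "k = (\<lambda>_. 0)" by auto
          with 1 jk show False by (auto simp: S_def)
        next
          case 2
          then obtain i where "k = unit_index i" using multi_order_1_iff by blast
          with 2 jk show False by (auto simp: S_def S1_def)
        qed
      qed
      have yc: "\<bar>y $ i\<bar> \<le> B * n\<^sup>2" for i using component_le_norm_cart[of y i] y by linarith
      have "\<bar>monomial j k x y\<bar> = \<bar>x\<bar> ^ j * (\<Prod>i\<in>UNIV. \<bar>y $ i\<bar> ^ k i)"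
        by (simp add: abs_mult abs_prod power_abs)
      also have "\<dots> \<le> n ^ j * (\<Prod>i\<in>UNIV. (B * n\<^sup>2) ^ k i)"
        using x yc n by (intro mult_mono prod_mono power_mono conjI) (auto intro!: prod_nonneg)
      also have "\<dots> = B ^ multi_order k * n ^ (j + 2 * multi_order k)"
        unfolding power_sum[symmetric] by (simp add: power_mult_distrib power_add power_mult mult.left_commute)
      also have "\<dots> \<le> B ^ 3 * n ^ 4"
        using B n ord four by (intro mult_mono power_increasing power_decreasing) auto
      finally have "\<bar>monomial j k x y\<bar> \<le> B ^ 3 * n ^ 4" .
      from mult_right_mono[OF this, of "norm (c j k)"]
      show "norm (?t jk) \<le> (case jk of (j, k) \<Rightarrow> (B ^ 3 * norm (c j k)) * n ^ 4)"
        by (simp add: mult_ac)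
    qed
    also have "\<dots> = C * n ^ 4" by (simp add: C_def sum_distrib_right case_prod_unfold)
    finally show "norm (nonlin_poly l c x y - low_order_part c x y) \<le> C * n ^ 4" .
  qed
qed

lemma taylor_quadratic:
  fixes W :: "nat \<Rightarrow> nat \<Rightarrow> real ^ 'n"
  assumes "has_taylor_coeffs_2_3 w W"
  obtains C \<delta> where "C \<ge> 0" "\<delta> > 0"
    "\<And>n x v. \<bar>x\<bar> \<le> n \<Longrightarrow> \<bar>v\<bar> \<le> n \<Longrightarrow> n \<le> \<delta> \<Longrightarrow>
       norm (w (x, v) - (x\<^sup>2 *\<^sub>R W 2 0 + (x * v) *\<^sub>R W 1 1 + v\<^sup>2 *\<^sub>R W 0 2)) \<le> C * n ^ 3"
proof -
  obtain D where D: "D > 0" "\<forall>\<^sub>F z in nhds (0, 0).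
      norm (case z of (x, v) \<Rightarrow> norm (w (x, v) - (\<Sum>(i, j) | i + j \<in> {2, 3}. (x ^ i * v ^ j) *\<^sub>R W i j)))
        \<le> D * norm (norm z ^ 4)"
    using assms unfolding has_taylor_coeffs_2_3_def by (elim landau_o.bigE) auto
  then obtain d where d: "d > 0" "\<And>z. dist z (0, 0) < d \<Longrightarrow>
      norm (case z of (x, v) \<Rightarrow> norm (w (x, v) - (\<Sum>(i, j) | i + j \<in> {2, 3}. (x ^ i * v ^ j) *\<^sub>R W i j)))
        \<le> D * norm (norm z ^ 4)"
    unfolding eventually_nhds_metric by blast
  have set: "{(i, j). i + j \<in> {2, 3}} = {(2, 0), (1, 1), (0, 2), (3, 0), (2, 1), (1, 2), (0, 3 :: nat)}"
    (is "?A = ?B")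
  proof
    show "?A \<subseteq> ?B"
    proof
      fix p :: "nat \<times> nat" assume "p \<in> ?A"
      then obtain i j where p: "p = (i, j)" "i + j = 2 \<or> i + j = 3" by auto
      from p(2) have "i = 2 \<and> j = 0 \<or> i = 1 \<and> j = 1 \<or> i = 0 \<and> j = 2 \<or>
        i = 3 \<and> j = 0 \<or> i = 2 \<and> j = 1 \<or> i = 1 \<and> j = 2 \<or> i = 0 \<and> j = 3" by presburger
      then show "p \<in> ?B" by (auto simp: p(1))
    qed
  qed auto
  define E where "E = norm (W 3 0) + norm (W 2 1) + norm (W 1 2) + norm (W 0 3)"
  define \<delta> where "\<delta> = min 1 (d / 3)"
  show ?thesis
  proof (rule that[of "16 * D + E" \<delta>])
    show "16 * D + E \<ge> 0" "\<delta> > 0" using D d by (auto simp: E_def \<delta>_def)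
    fix n x v :: real assume b: "\<bar>x\<bar> \<le> n" "\<bar>v\<bar> \<le> n" "n \<le> \<delta>"
    have n: "0 \<le> n" "n \<le> 1" "3 * n \<le> d" using b d by (auto simp: \<delta>_def)
    have nz: "norm (x, v) \<le> 2 * n" using norm_Pair_le[of x v] b by simp
    define R where "R = w (x, v) - (\<Sum>(i, j) | i + j \<in> {2, 3}. (x ^ i * v ^ j) *\<^sub>R W i j)"
    have R: "norm R \<le> 16 * D * n ^ 3"
    proof -
      have "dist (x, v) (0, 0) < d" using nz n d(1) by (simp add: dist_norm)
      from d(2)[OF this] have "norm R \<le> D * norm (x, v) ^ 4" by (simp add: R_def)
      also have "\<dots> \<le> D * (2 * n) ^ 4" using nz D by (intro mult_left_mono power_mono) auto
      also have "\<dots> = 16 * D * n ^ 4" by (simp add: power_mult_distrib)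
      also have "\<dots> \<le> 16 * D * n ^ 3" using D n by (intro mult_left_mono power_decreasing) auto
      finally show ?thesis .
    qed
    have m: "\<bar>x ^ i * v ^ j\<bar> \<le> n ^ 3" if "i + j = 3" for i j
    proof -
      have "\<bar>x\<bar> ^ i * \<bar>v\<bar> ^ j \<le> n ^ i * n ^ j" using b n by (intro mult_mono power_mono) auto
      then show ?thesis by (simp add: abs_mult power_abs that flip: power_add)
    qed
    have "w (x, v) - (x\<^sup>2 *\<^sub>R W 2 0 + (x * v) *\<^sub>R W 1 1 + v\<^sup>2 *\<^sub>R W 0 2)
      = R + ((x ^ 3 * v ^ 0) *\<^sub>R W 3 0 + (x ^ 2 * v ^ 1) *\<^sub>R W 2 1 + (x ^ 1 * v ^ 2) *\<^sub>R W 1 2 + (x ^ 0 * v ^ 3) *\<^sub>R W 0 3)"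
      unfolding R_def set by (simp add: algebra_simps)
    also have "norm \<dots> \<le> 16 * D * n ^ 3 + (n ^ 3 * norm (W 3 0) + n ^ 3 * norm (W 2 1) + n ^ 3 * norm (W 1 2) + n ^ 3 * norm (W 0 3))"
      by (intro norm_triangle_le add_mono R; subst norm_scaleR; intro mult_right_mono m; simp)
    also have "\<dots> = (16 * D + E) * n ^ 3" by (simp add: E_def algebra_simps)
    finally show "norm (w (x, v) - (x\<^sup>2 *\<^sub>R W 2 0 + (x * v) *\<^sub>R W 1 1 + v\<^sup>2 *\<^sub>R W 0 2)) \<le> (16 * D + E) * n ^ 3" .
  qed
qed


section \<open>Quadratic forms and second differences\<close>

definition quad_form :: "real \<Rightarrow> 'a \<Rightarrow> 'a \<Rightarrow> 'a \<Rightarrow> complex \<Rightarrow> 'a::real_normed_vector" where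
  "quad_form \<omega> A B C z = (Re z / \<omega>)\<^sup>2 *\<^sub>R A + (Re z / \<omega> * Im z) *\<^sub>R B + (Im z)\<^sup>2 *\<^sub>R C"

lemma quad_form_lipschitz:
  assumes "\<omega> > 0"
  obtains L where "L \<ge> 0"
    "\<And>y z. norm (quad_form \<omega> A B C y - quad_form \<omega> A B C z) \<le> L * (norm y + norm z) * norm (y - z)"
proof -
  define L where "L = norm A / \<omega>\<^sup>2 + norm B / \<omega> + norm C"
  show ?thesis
  proof (rule that[of L])
    show "L \<ge> 0" using assms by (auto simp: L_def)
    fix y z :: complex
    define m where "m = (norm y + norm z) * norm (y - z)"
    have b: "\<bar>Re y\<bar> \<le> norm y" "\<bar>Re z\<bar> \<le> norm z" "\<bar>Im y\<bar> \<le> norm y" "\<bar>Im z\<bar> \<le> norm z"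
      "\<bar>Re y - Re z\<bar> \<le> norm (y - z)" "\<bar>Im y - Im z\<bar> \<le> norm (y - z)"
      using abs_Re_le_cmod[of "y - z"] abs_Im_le_cmod[of "y - z"]
      by (auto simp: abs_Re_le_cmod abs_Im_le_cmod)
    have 1: "\<bar>a * b - a' * b'\<bar> \<le> m"
      if "\<bar>a\<bar> \<le> norm y" "\<bar>b'\<bar> \<le> norm z" "\<bar>a - a'\<bar> \<le> norm (y - z)" "\<bar>b - b'\<bar> \<le> norm (y - z)"
      for a b a' b' :: real
    proof -
      have "\<bar>a * b - a' * b'\<bar> \<le> \<bar>a\<bar> * \<bar>b - b'\<bar> + \<bar>b'\<bar> * \<bar>a - a'\<bar>"
        by (rule abs_le_of_products) (simp add: algebra_simps)
      also have "\<dots> \<le> norm y * norm (y - z) + norm z * norm (y - z)"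
        using that by (intro add_mono mult_mono) auto
      finally show ?thesis by (simp add: m_def algebra_simps)
    qed
    have "quad_form \<omega> A B C y - quad_form \<omega> A B C z =
        ((Re y * Re y - Re z * Re z) / \<omega>\<^sup>2) *\<^sub>R A + ((Re y * Im y - Re z * Im z) / \<omega>) *\<^sub>R B
        + (Im y * Im y - Im z * Im z) *\<^sub>R C"
      by (simp add: quad_form_def power2_eq_square diff_divide_distrib scaleR_left_diff_distrib)
    also have "norm \<dots> \<le> m / \<omega>\<^sup>2 * norm A + m / \<omega> * norm B + m * norm C"
    proof (intro norm_triangle_le add_mono; subst norm_scaleR; intro mult_right_mono)
      show "\<bar>(Re y * Re y - Re z * Re z) / \<omega>\<^sup>2\<bar> \<le> m / \<omega>\<^sup>2" "\<bar>(Re y * Im y - Re z * Im z) / \<omega>\<bar> \<le> m / \<omega>"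
        unfolding abs_divide using assms b by (auto intro!: divide_right_mono 1)
      show "\<bar>Im y * Im y - Im z * Im z\<bar> \<le> m" using b by (intro 1)
    qed auto
    also have "\<dots> = L * m" by (simp add: L_def algebra_simps)
    finally show "norm (quad_form \<omega> A B C y - quad_form \<omega> A B C z) \<le> L * (norm y + norm z) * norm (y - z)"
      by (simp add: m_def mult_ac)
  qed
qed

lemma quad_form_scale: "quad_form \<omega> A B C (of_real r * z) = r\<^sup>2 *\<^sub>R quad_form \<omega> A B C z"
  by (simp add: quad_form_def power_mult_distrib scaleR_add_right power2_eq_square mult_ac)

text \<open>A quadratic form along a rotation has frequencies \<open>0\<close> and \<open>\<plusminus> 2 \<omega>\<close> only, so its second difference is exactly
proportional to \<open>(sin \<theta>)\<^sup>2\<close>. The new form is, up to the factor \<open>\<omega>\<^sup>2\<close>, the second derivative along the linear flow.\<close>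

lemma quad_form_second_difference:
  assumes "\<omega> \<noteq> 0"
  shows "quad_form \<omega> A B C (cis (- \<theta>) * e) - 2 *\<^sub>R quad_form \<omega> A B C e + quad_form \<omega> A B C (cis \<theta> * e)
     = (sin \<theta>)\<^sup>2 *\<^sub>R quad_form \<omega> ((-2) *\<^sub>R A + (2 * \<omega>\<^sup>2) *\<^sub>R C) ((-4) *\<^sub>R B) ((2 / \<omega>\<^sup>2) *\<^sub>R A - 2 *\<^sub>R C) e"
proof -
  define a b s c where "a = Re e" and "b = Im e" and "s = sin \<theta>" and "c = cos \<theta>"
  have c: "c\<^sup>2 = 1 - s\<^sup>2" by (simp add: c_def s_def cos_squared_eq)
  have 1: "((c * a + s * b) / \<omega>)\<^sup>2 - 2 * (a / \<omega>)\<^sup>2 + ((c * a - s * b) / \<omega>)\<^sup>2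
      = s\<^sup>2 * ((a / \<omega>)\<^sup>2 * (-2) + b\<^sup>2 * (2 / \<omega>\<^sup>2))"
  proof -
    have "((c * a + s * b) / \<omega>)\<^sup>2 - 2 * (a / \<omega>)\<^sup>2 + ((c * a - s * b) / \<omega>)\<^sup>2
       = (2 * c\<^sup>2 * a\<^sup>2 + 2 * s\<^sup>2 * b\<^sup>2 - 2 * a\<^sup>2) / \<omega>\<^sup>2"
      by (simp add: power_divide power2_eq_square add_divide_distrib diff_divide_distrib algebra_simps)
    also have "\<dots> = s\<^sup>2 * ((a / \<omega>)\<^sup>2 * (-2) + b\<^sup>2 * (2 / \<omega>\<^sup>2))"
      unfolding c by (simp add: power_divide add_divide_distrib diff_divide_distrib algebra_simps)
    finally show ?thesis .
  qed
  have 2: "(c * a + s * b) / \<omega> * (c * b - s * a) - 2 * (a / \<omega> * b) + (c * a - s * b) / \<omega> * (c * b + s * a)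
      = s\<^sup>2 * (a / \<omega> * b * (-4))"
  proof -
    have "(c * a + s * b) / \<omega> * (c * b - s * a) - 2 * (a / \<omega> * b) + (c * a - s * b) / \<omega> * (c * b + s * a)
       = (2 * c\<^sup>2 - 2 * s\<^sup>2 - 2) * (a * b) / \<omega>"
      by (simp add: power2_eq_square add_divide_distrib diff_divide_distrib algebra_simps)
    also have "\<dots> = s\<^sup>2 * (a / \<omega> * b * (-4))" unfolding c by simp
    finally show ?thesis .
  qed
  have 3: "(c * b - s * a)\<^sup>2 - 2 * b\<^sup>2 + (c * b + s * a)\<^sup>2
      = s\<^sup>2 * ((a / \<omega>)\<^sup>2 * (2 * \<omega>\<^sup>2) + b\<^sup>2 * (-2))"
  proof -
    have "(c * b - s * a)\<^sup>2 - 2 * b\<^sup>2 + (c * b + s * a)\<^sup>2 = 2 * c\<^sup>2 * b\<^sup>2 + 2 * s\<^sup>2 * a\<^sup>2 - 2 * b\<^sup>2"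
      by (simp add: power2_eq_square algebra_simps)
    also have "\<dots> = s\<^sup>2 * ((a / \<omega>)\<^sup>2 * (2 * \<omega>\<^sup>2) + b\<^sup>2 * (-2))"
      unfolding c using assms by (simp add: power_divide algebra_simps)
    finally show ?thesis .
  qed
  have "quad_form \<omega> A B C (cis (- \<theta>) * e) - 2 *\<^sub>R quad_form \<omega> A B C e + quad_form \<omega> A B C (cis \<theta> * e)
     = (((c * a + s * b) / \<omega>)\<^sup>2 - 2 * (a / \<omega>)\<^sup>2 + ((c * a - s * b) / \<omega>)\<^sup>2) *\<^sub>R A
     + ((c * a + s * b) / \<omega> * (c * b - s * a) - 2 * (a / \<omega> * b) + (c * a - s * b) / \<omega> * (c * b + s * a)) *\<^sub>R B
     + ((c * b - s * a)\<^sup>2 - 2 * b\<^sup>2 + (c * b + s * a)\<^sup>2) *\<^sub>R C"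
    by (simp add: quad_form_def a_def b_def c_def s_def scaleR_add_left scaleR_diff_left
        scaleR_add_right)
  also have "\<dots> = s\<^sup>2 *\<^sub>R quad_form \<omega> ((-2) *\<^sub>R A + (2 * \<omega>\<^sup>2) *\<^sub>R C) ((-4) *\<^sub>R B) ((2 / \<omega>\<^sup>2) *\<^sub>R A - 2 *\<^sub>R C) e"
    unfolding 1 2 3 quad_form_def a_def[symmetric] b_def[symmetric]
    by (simp add: algebra_simps)
  finally show ?thesis by (simp add: s_def)
qed

text \<open>The vectors \<open>1\<close>, \<open>\<i>\<close> and \<open>(3 + 4 \<i>) / 5\<close> separate the three coefficients.\<close>

lemma quad_form_eq_0D:
  assumes "\<omega> > 0" and 0: "\<And>e. norm e = 1 \<Longrightarrow> quad_form \<omega> A B C e = 0"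
  shows "A = 0" "B = 0" "C = 0"
proof -
  show A: "A = 0" using 0[of 1] assms(1) by (simp add: quad_form_def)
  show C: "C = 0" using 0[of \<i>] by (simp add: quad_form_def)
  have "norm (Complex (3/5) (4/5)) = 1" by (simp add: cmod_def power2_eq_square)
  from 0[OF this] show "B = 0" using assms(1) A C by (simp add: quad_form_def)
qed

lemma second_difference_bound:
  fixes y :: "real \<Rightarrow> 'a::real_normed_vector"
  assumes h: "h \<ge> 0"
    and y: "\<And>t. 0 \<le> t \<Longrightarrow> t \<le> 2 * h \<Longrightarrow> (y has_vector_derivative u t) (at t)"
    and u: "\<And>t. 0 \<le> t \<Longrightarrow> t \<le> 2 * h \<Longrightarrow> (u has_vector_derivative a t) (at t)"
    and a: "\<And>t. 0 \<le> t \<Longrightarrow> t \<le> 2 * h \<Longrightarrow> norm (a t - g) \<le> B"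
  shows "norm (y 0 - 2 *\<^sub>R y h + y (2 * h) - h\<^sup>2 *\<^sub>R g) \<le> B * h\<^sup>2"
proof -
  have u1: "norm ((u (t + h) - (t + h) *\<^sub>R g) - (u t - t *\<^sub>R g)) \<le> B * (t + h - t)" if "0 \<le> t" "t \<le> h" for t
    using that h
    by (intro norm_diff_le_of_vector_derivative[where g' = "\<lambda>s. a s - g"])
       (auto intro!: derivative_eq_intros u a)
  have "norm ((y (h + h) - y h - (h * h) *\<^sub>R g) - (y (0 + h) - y 0 - (h * 0) *\<^sub>R g)) \<le> (B * h) * (h - 0)"
  proof (rule norm_diff_le_of_vector_derivative[OF h])
    fix t assume t: "0 \<le> t" "t \<le> h"
    have "((\<lambda>t. t + h) has_vector_derivative 1) (at t)"
      by (auto intro!: derivative_eq_intros)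
    then have "((\<lambda>t. y (t + h)) has_vector_derivative u (t + h)) (at t)"
      using vector_diff_chain_at[of "\<lambda>t. t + h" 1 t y "u (t + h)"] y[of "t + h"] t h
      by (simp add: o_def)
    then show "((\<lambda>t. y (t + h) - y t - (h * t) *\<^sub>R g) has_vector_derivative
        u (t + h) - u t - h *\<^sub>R g) (at t)"
      using t h by (auto intro!: derivative_eq_intros y)
    have e: "u (t + h) - u t - h *\<^sub>R g = (u (t + h) - (t + h) *\<^sub>R g) - (u t - t *\<^sub>R g)"
      by (simp add: algebra_simps)
    show "norm (u (t + h) - u t - h *\<^sub>R g) \<le> B * h" using u1[OF t] unfolding e by simp
  qed
  then show ?thesis by (simp add: algebra_simps power2_eq_square scaleR_2)
qed

lemma le_of_small_error:
  fixes a b c d :: real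
  assumes "d > 0" "\<And>r. 0 < r \<Longrightarrow> r \<le> d \<Longrightarrow> a \<le> b + c * r"
  shows "a \<le> b"
proof (rule field_le_epsilon)
  fix e :: real assume e: "e > 0"
  define r where "r = min d (e / (\<bar>c\<bar> + 1))"
  have r: "0 < r" "r \<le> d" "r \<le> e / (\<bar>c\<bar> + 1)" using assms(1) e by (auto simp: r_def)
  have "c * r \<le> (\<bar>c\<bar> + 1) * r" using r by (intro mult_right_mono) auto
  also have "\<dots> \<le> e" using r(3) by (simp add: pos_le_divide_eq mult.commute)
  finally show "a \<le> b + e" using assms(2)[OF r(1,2)] by simp
qed

lemma quadratic_coefficient_limit:
  fixes n g :: "'a::real_normed_vector"
  assumes "h0 > 0" and bound: "\<And>h. 0 < h \<Longrightarrow> h \<le> h0 \<Longrightarrow> norm ((sin (\<omega> * h))\<^sup>2 *\<^sub>R n + h\<^sup>2 *\<^sub>R g) \<le> K * h ^ 3"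
  shows "\<omega>\<^sup>2 *\<^sub>R n + g = 0"
proof -
  have "((\<lambda>h. sin (\<omega> * h)) has_real_derivative \<omega>) (at 0)"
    by (auto intro!: derivative_eq_intros)
  then have "((\<lambda>h. sin (\<omega> * h) / h) \<longlongrightarrow> \<omega>) (at 0)"
    unfolding DERIV_def by simp
  then have lim: "((\<lambda>h. sin (\<omega> * h) / h) \<longlongrightarrow> \<omega>) (at_right 0)"
    by (rule filterlim_mono) (auto simp: at_le)
  have "((\<lambda>h. norm ((sin (\<omega> * h) / h)\<^sup>2 *\<^sub>R n + g)) \<longlongrightarrow> norm (\<omega>\<^sup>2 *\<^sub>R n + g)) (at_right 0)"
    by (intro tendsto_intros lim)
  moreover have "((\<lambda>h. K * h) \<longlongrightarrow> K * 0) (at_right 0)"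
    by (intro tendsto_intros)
  moreover have "\<forall>\<^sub>F h in at_right 0. norm ((sin (\<omega> * h) / h)\<^sup>2 *\<^sub>R n + g) \<le> K * h"
  proof -
    have "\<forall>\<^sub>F h in at_right 0. h < h0" "\<forall>\<^sub>F h in at_right (0::real). h > 0"
      using assms(1) by (auto intro: eventually_at_right_less order_tendstoD simp: eventually_at_right_field)
    then show ?thesis
    proof eventually_elim
      case (elim h)
      have "h\<^sup>2 *\<^sub>R ((sin (\<omega> * h) / h)\<^sup>2 *\<^sub>R n + g) = (sin (\<omega> * h))\<^sup>2 *\<^sub>R n + h\<^sup>2 *\<^sub>R g"
        using elim by (simp add: scaleR_add_right power_divide)
      then have "h\<^sup>2 * norm ((sin (\<omega> * h) / h)\<^sup>2 *\<^sub>R n + g) \<le> h\<^sup>2 * (K * h)"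
        using bound[of h] elim norm_scaleR[of "h\<^sup>2" "(sin (\<omega> * h) / h)\<^sup>2 *\<^sub>R n + g"]
        by (simp add: power2_eq_square power3_eq_cube mult_ac)
      then show ?case using elim by simp
    qed
  qed
  ultimately have "norm (\<omega>\<^sup>2 *\<^sub>R n + g) \<le> K * 0"
    by (intro tendsto_le[of "at_right 0" "\<lambda>h. K * h" _ "\<lambda>h. norm ((sin (\<omega> * h) / h)\<^sup>2 *\<^sub>R n + g)"]) auto
  then show ?thesis by simp
qed

lemma mat_mult_vec: "mat s *v v = s *\<^sub>R (v :: real ^ 'n)"
  by (simp add: matrix_vector_mult_def mat_def vec_eq_iff if_distrib if_distribR sum.delta cong: if_cong)

lemma invertible_iff_ker: "invertible (A :: real ^ 'n ^ 'n) \<longleftrightarrow> (\<forall>v. A *v v = 0 \<longrightarrow> v = 0)"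
  unfolding invertible_left_inverse matrix_left_invertible_ker ..


section \<open>Reduction to the subcenter manifold\<close>

lemma
  assumes "invertible A"
  shows matrix_inv_right: "A ** matrix_inv A = mat 1" and matrix_inv_left: "matrix_inv A ** A = mat 1"
  using someI_ex[OF assms[unfolded invertible_def]] unfolding matrix_inv_def by auto

locale subcenter_manifold =
  fixes \<omega>\<^sub>0 :: real
    and M K \<Omega>2 :: "real ^ 'n ^ 'n"
    and \<omega>y :: "'n \<Rightarrow> real"
    and l :: nat
    and p :: "nat \<Rightarrow> ('n \<Rightarrow> nat) \<Rightarrow> real"
    and q :: "nat \<Rightarrow> ('n \<Rightarrow> nat) \<Rightarrow> real ^ 'n"
    and P :: "real \<Rightarrow> real ^ 'n \<Rightarrow> real"
    and Q :: "real \<Rightarrow> real ^ 'n \<Rightarrow> real ^ 'n"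
    and U :: "(real \<times> real) set"
    and w w' :: "real \<times> real \<Rightarrow> real ^ 'n"
    and W :: "nat \<Rightarrow> nat \<Rightarrow> real ^ 'n"
  assumes \<omega>\<^sub>0_pos: "\<omega>\<^sub>0 > 0"
    and M_invertible: "invertible M"
    and \<Omega>2_eq: "\<Omega>2 = matrix_inv M ** K"
    and eigenvalues: "linear_eigenvalues M K = (\<Union>i. {\<i> * complex_of_real (\<omega>y i), - \<i> * complex_of_real (\<omega>y i)})"
    and nonresonance: "\<And>i. \<omega>y i / \<omega>\<^sub>0 \<notin> \<int>"
    and l_le: "l \<le> 3"
    and p_high: "\<And>j k. l < j + multi_order k \<Longrightarrow> p j k = 0"
    and q_high: "\<And>j k. l < j + multi_order k \<Longrightarrow> q j k = 0"
    and P_eq: "P = nonlin_poly l p"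
    and Q_eq: "Q = nonlin_poly l q"
    and lsm: "lyapunov_subcenter_manifold \<omega>\<^sub>0 M K P Q U w w'"
    and taylor: "has_taylor_coeffs_2_3 w W"
begin

text \<open>A vector in the kernel would satisfy \<open>K v = (m \<omega>\<^sub>0)\<^sup>2 M v\<close> and make \<open>\<i> m \<omega>\<^sub>0\<close> an eigenvalue of the linearization. The
cases \<open>m = 0\<close> and \<open>m = 2\<close> will be used.\<close>

lemma nonresonance_invertible: "invertible (\<Omega>2 - mat ((of_int m * \<omega>\<^sub>0)\<^sup>2))"
  unfolding invertible_iff_ker
proof (intro allI impI, rule ccontr)
  fix v assume v: "(\<Omega>2 - mat ((of_int m * \<omega>\<^sub>0)\<^sup>2)) *v v = 0" "v \<noteq> 0"
  define s where "s = (of_int m * \<omega>\<^sub>0)\<^sup>2"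
  have "\<Omega>2 *v v = s *\<^sub>R v"
    using v(1) by (simp add: matrix_vector_mult_diff_rdistrib mat_mult_vec s_def)
  then have "M *v (matrix_inv M *v (K *v v)) = s *\<^sub>R (M *v v)"
    unfolding \<Omega>2_eq by (simp add: matrix_vector_mul_assoc[symmetric] vector_scaleR_matrix_ac matrix_vector_mult_scaleR)
  then have Kv: "K *v v = s *\<^sub>R (M *v v)"
    using matrix_inv_right[OF M_invertible] by (simp add: matrix_vector_mul_assoc matrix_mul_assoc)
  define \<mu> where "\<mu> = \<i> * complex_of_real (of_int m * \<omega>\<^sub>0)"
  have \<mu>2: "\<mu>\<^sup>2 = - complex_of_real s" by (simp add: \<mu>_def s_def power_mult_distrib)
  define z :: "complex ^ 'n" where "z = (\<chi> i. complex_of_real (v $ i))"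
  have "z \<noteq> 0" using v(2) by (auto simp: z_def vec_eq_iff)
  moreover have "(\<chi> i j. \<mu>\<^sup>2 * complex_of_real (M $ i $ j) + complex_of_real (K $ i $ j)) *v z = 0"
  proof -
    have "(\<Sum>j\<in>UNIV. (- complex_of_real s * complex_of_real (M $ i $ j) + complex_of_real (K $ i $ j)) * complex_of_real (v $ j)) = 0" for i
    proof -
      have "(\<Sum>j\<in>UNIV. (- complex_of_real s * complex_of_real (M $ i $ j) + complex_of_real (K $ i $ j)) * complex_of_real (v $ j))
        = complex_of_real (- s * (\<Sum>j\<in>UNIV. M $ i $ j * v $ j) + (\<Sum>j\<in>UNIV. K $ i $ j * v $ j))"
        by (simp add: sum_distrib_left left_diff_distrib sum_subtractf sum_negf mult.assoc)
      also have "\<dots> = complex_of_real (- s * (M *v v) $ i + (K *v v) $ i)"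
        by (simp add: matrix_vector_mult_def)
      also have "\<dots> = 0" by (simp add: Kv)
      finally show ?thesis .
    qed
    then show ?thesis by (simp add: matrix_vector_mult_def vec_eq_iff \<mu>2 z_def)
  qed
  ultimately have "\<mu> \<in> linear_eigenvalues M K"
    unfolding linear_eigenvalues_def by blast
  then obtain i where "\<mu> = \<i> * complex_of_real (\<omega>y i) \<or> \<mu> = - \<i> * complex_of_real (\<omega>y i)"
    unfolding eigenvalues by blast
  then have "Im \<mu> = \<omega>y i \<or> Im \<mu> = - \<omega>y i" by auto
  then have "of_int m * \<omega>\<^sub>0 = \<omega>y i \<or> of_int m * \<omega>\<^sub>0 = - \<omega>y i" by (simp add: \<mu>_def)
  then have "\<omega>y i / \<omega>\<^sub>0 = of_int m \<or> \<omega>y i / \<omega>\<^sub>0 = of_int (- m)"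
    using \<omega>\<^sub>0_pos by (auto simp: field_simps)
  then show False using nonresonance[of i] by (metis Ints_of_int)
qed

definition chart :: "complex \<Rightarrow> real \<times> real" where
  "chart z = (Re z / \<omega>\<^sub>0, Im z)"

definition F :: "complex \<Rightarrow> real" where
  "F z = P (Re z / \<omega>\<^sub>0) (w (chart z))"

text \<open>The second time derivative of \<open>y\<close> that the equation of motion prescribes on the manifold.\<close>

definition accel :: "complex \<Rightarrow> real ^ 'n" where
  "accel z = - (\<Omega>2 *v w (chart z) + matrix_inv M *v Q (Re z / \<omega>\<^sub>0) (w (chart z)))"

definition state_of :: "complex \<Rightarrow> 'n state" where
  "state_of z = (Re z / \<omega>\<^sub>0, Im z, w (chart z), w' (chart z))"

lemma state_of_inject: "state_of y = state_of z \<longleftrightarrow> y = z"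
  using \<omega>\<^sub>0_pos by (auto simp: state_of_def complex_eq_iff chart_def)

text \<open>Invariance keeps the trajectory on the graph. Therefore the last two components are functions of the first
two, which satisfy an autonomous equation in the plane, and the equation for \<open>y\<close> becomes a statement
on \<open>w\<close> along planar solutions.\<close>

lemma trajectory_in_chart:
  assumes \<gamma>: "mech_trajectory \<omega>\<^sub>0 M K P Q UNIV \<gamma>" and start: "\<gamma> 0 \<in> graph_manifold U w w'"
  obtains c where "\<gamma> = (\<lambda>t. state_of (c t))" "oscillation \<omega>\<^sub>0 F c"
    "\<And>t. ((\<lambda>t. w (chart (c t))) has_vector_derivative w' (chart (c t))) (at t)"
    "\<And>t. ((\<lambda>t. w' (chart (c t))) has_vector_derivative accel (c t)) (at t)"
proof -
  obtain x v y u where \<gamma>_eq: "\<gamma> = (\<lambda>t. (x t, v t, y t, u t))"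
    and x: "\<And>t. (x has_real_derivative v t) (at t)"
    and y: "\<And>t. (y has_vector_derivative u t) (at t)"
    and v: "\<And>t. \<exists>a. (v has_real_derivative a) (at t) \<and> a + \<omega>\<^sub>0\<^sup>2 * x t + P (x t) (y t) = 0"
    and u: "\<And>t. \<exists>b. (u has_vector_derivative b) (at t) \<and> M *v b + K *v y t + Q (x t) (y t) = 0"
    using \<gamma> unfolding mech_trajectory_def by auto
  have "\<gamma> ` UNIV \<subseteq> graph_manifold U w w'"
    using lsm \<gamma> start unfolding lyapunov_subcenter_manifold_def by (metis UNIV_I is_interval_univ)
  then have "\<gamma> t \<in> graph_manifold U w w'" for t by blast
  then have yu: "y t = w (x t, v t)" "u t = w' (x t, v t)" for t
    unfolding graph_manifold_def \<gamma>_eq by blast+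
  define c where "c = (\<lambda>t. Complex (\<omega>\<^sub>0 * x t) (v t))"
  have ch: "chart (c t) = (x t, v t)" for t using \<omega>\<^sub>0_pos by (simp add: chart_def c_def)
  have re: "Re (c t) / \<omega>\<^sub>0 = x t" for t using \<omega>\<^sub>0_pos by (simp add: c_def)
  have wy: "(\<lambda>t. w (chart (c t))) = y" "(\<lambda>t. w' (chart (c t))) = u"
    by (auto simp: ch yu)
  show ?thesis
  proof (rule that[of c])
    show "\<gamma> = (\<lambda>t. state_of (c t))"
      unfolding \<gamma>_eq state_of_def ch re yu by (simp add: c_def)
    show "oscillation \<omega>\<^sub>0 F c" unfolding oscillation_def
    proof
      fix t
      obtain a where a: "(v has_real_derivative a) (at t)" "a + \<omega>\<^sub>0\<^sup>2 * x t + P (x t) (y t) = 0"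
        using v by blast
      have Fc: "F (c t) = P (x t) (y t)" by (simp add: F_def re ch yu)
      have "((\<lambda>t. \<omega>\<^sub>0 * x t) has_vector_derivative \<omega>\<^sub>0 * v t) (at t)"
        using DERIV_cmult[OF x] by (simp add: has_real_derivative_iff_has_vector_derivative)
      moreover have "(v has_vector_derivative - (\<omega>\<^sub>0\<^sup>2 * x t + F (c t))) (at t)"
      proof -
        have "a = - (\<omega>\<^sub>0\<^sup>2 * x t + F (c t))" using a(2) unfolding Fc by linarith
        then show ?thesis using a(1) by (simp only: has_real_derivative_iff_has_vector_derivative)
      qed
      ultimately show "(c has_vector_derivative - \<i> * (of_real \<omega>\<^sub>0 * c t + of_real (F (c t)))) (at t)"
        unfolding has_vector_derivative_complex_iff
        by (simp add: c_def has_real_derivative_iff_has_vector_derivative power2_eq_square mult.assoc)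
    qed
    fix t
    show "((\<lambda>t. w (chart (c t))) has_vector_derivative w' (chart (c t))) (at t)"
      unfolding wy(1) using y[of t] by (simp add: ch yu)
    obtain b where b: "(u has_vector_derivative b) (at t)" "M *v b + K *v y t + Q (x t) (y t) = 0"
      using u by blast
    have "M *v b = - (K *v y t + Q (x t) (y t))"
      using b(2) by (simp only: eq_neg_iff_add_eq_0 add.assoc)
    then have "matrix_inv M *v (M *v b) = - (matrix_inv M *v (K *v y t) + matrix_inv M *v Q (x t) (y t))"
      by (simp only: linear_neg[OF matrix_vector_mul_linear] matrix_vector_right_distrib)
    then have "b = accel (c t)"
      using matrix_inv_left[OF M_invertible] unfolding accel_def re ch yu unfolding \<Omega>2_eq
      by (simp add: matrix_vector_mul_assoc)
    with b show "((\<lambda>t. w' (chart (c t))) has_vector_derivative accel (c t)) (at t)"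
      unfolding wy(2) by simp
  qed
qed

lemma trajectory_exists:
  assumes "chart z \<in> U"
  obtains \<gamma> c T where "mech_trajectory \<omega>\<^sub>0 M K P Q UNIV \<gamma>" "has_period \<gamma> T"
    "\<gamma> = (\<lambda>t. state_of (c t))" "c 0 = z" "oscillation \<omega>\<^sub>0 F c"
    "\<And>t. ((\<lambda>t. w (chart (c t))) has_vector_derivative w' (chart (c t))) (at t)"
    "\<And>t. ((\<lambda>t. w' (chart (c t))) has_vector_derivative accel (c t)) (at t)"
proof -
  have g: "state_of z \<in> graph_manifold U w w'"
    using assms by (auto simp: state_of_def graph_manifold_def chart_def)
  then obtain \<gamma> T where \<gamma>: "mech_trajectory \<omega>\<^sub>0 M K P Q UNIV \<gamma>" "\<gamma> 0 = state_of z" "has_period \<gamma> T"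
    using lsm unfolding lyapunov_subcenter_manifold_def by blast
  from \<gamma>(2) g have "\<gamma> 0 \<in> graph_manifold U w w'" by simp
  from trajectory_in_chart[OF \<gamma>(1) this] obtain c where c: "\<gamma> = (\<lambda>t. state_of (c t))" "oscillation \<omega>\<^sub>0 F c"
    "\<And>t. ((\<lambda>t. w (chart (c t))) has_vector_derivative w' (chart (c t))) (at t)"
    "\<And>t. ((\<lambda>t. w' (chart (c t))) has_vector_derivative accel (c t)) (at t)" by blast
  have "c 0 = z" using \<gamma>(2) c(1) by (simp add: state_of_inject)
  then show ?thesis using that[of \<gamma> T c] \<gamma> c by blast
qed

text \<open>Norm bound for the change from the complex coordinate to \<open>(x, v)\<close>.\<close>

definition \<Lambda> :: real where "\<Lambda> = 1 / \<omega>\<^sub>0 + 1"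

lemma \<Lambda>_ge_1: "\<Lambda> \<ge> 1"
  using \<omega>\<^sub>0_pos by (simp add: \<Lambda>_def)

lemma chart_bounds:
  shows "\<bar>Re z / \<omega>\<^sub>0\<bar> \<le> \<Lambda> * norm z" "\<bar>Im z\<bar> \<le> \<Lambda> * norm z"
    and "\<bar>Re z / \<omega>\<^sub>0\<bar> + \<bar>Im z\<bar> \<le> \<Lambda> * norm z"
proof -
  have 1: "\<bar>Re z / \<omega>\<^sub>0\<bar> \<le> norm z / \<omega>\<^sub>0" and 2: "\<bar>Im z\<bar> \<le> norm z"
    using abs_Re_le_cmod[of z] abs_Im_le_cmod[of z] \<omega>\<^sub>0_pos by (auto simp: divide_right_mono)
  then show "\<bar>Re z / \<omega>\<^sub>0\<bar> + \<bar>Im z\<bar> \<le> \<Lambda> * norm z" by (simp add: \<Lambda>_def algebra_simps)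
  then show "\<bar>Re z / \<omega>\<^sub>0\<bar> \<le> \<Lambda> * norm z" "\<bar>Im z\<bar> \<le> \<Lambda> * norm z"
    using abs_ge_zero[of "Im z"] abs_ge_zero[of "Re z / \<omega>\<^sub>0"] by linarith+
qed

lemma chart_near_0:
  obtains \<delta> where "\<delta> > 0" "\<And>z. norm z \<le> \<delta> \<Longrightarrow> chart z \<in> U"
proof -
  have "open U" "(0, 0) \<in> U" using lsm by (auto simp: lyapunov_subcenter_manifold_def)
  then obtain e where e: "e > 0" "ball (0, 0) e \<subseteq> U" by (meson openE)
  define \<delta> where "\<delta> = e / (2 * \<Lambda>)"
  show ?thesis
  proof (rule that[of \<delta>])
    show "\<delta> > 0" using e \<Lambda>_ge_1 by (simp add: \<delta>_def)
    fix z :: complex assume z: "norm z \<le> \<delta>"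
    have "norm (chart z) \<le> \<Lambda> * norm z"
      using norm_Pair_le[of "Re z / \<omega>\<^sub>0" "Im z"] chart_bounds(3)[of z] by (simp add: chart_def)
    also have "\<dots> \<le> \<Lambda> * \<delta>" using z \<Lambda>_ge_1 by (intro mult_left_mono) auto
    also have "\<dots> < e" using e \<Lambda>_ge_1 by (simp add: \<delta>_def)
    finally have "dist (chart z) (0, 0) < e" by (simp add: dist_norm chart_def)
    then have "chart z \<in> ball (0, 0) e" by (simp add: dist_commute)
    then show "chart z \<in> U" using e by blast
  qed
qed


abbreviation w_quad :: "complex \<Rightarrow> real ^ 'n" where
  "w_quad \<equiv> quad_form \<omega>\<^sub>0 (W 2 0) (W 1 1) (W 0 2)"

lemma w_bounds:
  obtains C B \<delta> where "C \<ge> 0" "B \<ge> 1" "\<delta> > 0" "\<delta> \<le> 1"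
    "\<And>z. norm z \<le> \<delta> \<Longrightarrow>
       norm (w (chart z) - w_quad z) \<le> C * norm z ^ 3"
    "\<And>z. norm z \<le> \<delta> \<Longrightarrow> norm (w (chart z)) \<le> B * norm z ^ 2"
proof -
  obtain C \<delta> where C: "C \<ge> 0" "\<delta> > 0" "\<And>n x v. \<bar>x\<bar> \<le> n \<Longrightarrow> \<bar>v\<bar> \<le> n \<Longrightarrow> n \<le> \<delta> \<Longrightarrow>
       norm (w (x, v) - (x\<^sup>2 *\<^sub>R W 2 0 + (x * v) *\<^sub>R W 1 1 + v\<^sup>2 *\<^sub>R W 0 2)) \<le> C * n ^ 3"
    using taylor_quadratic[OF taylor] by blast
  obtain D where D: "D \<ge> 0" "\<And>y z. norm (w_quad y -
      w_quad z) \<le> D * (norm y + norm z) * norm (y - z)"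
    using quad_form_lipschitz[OF \<omega>\<^sub>0_pos, of "W 2 0" "W 1 1" "W 0 2"] by blast
  define \<delta>' where "\<delta>' = min 1 (\<delta> / \<Lambda>)"
  have 1: "norm (w (chart z) - w_quad z) \<le> (C * \<Lambda> ^ 3) * norm z ^ 3"
    if "norm z \<le> \<delta>'" for z
  proof -
    have "norm z \<le> \<delta> / \<Lambda>" using that by (simp add: \<delta>'_def)
    then have "\<Lambda> * norm z \<le> \<delta>" using \<Lambda>_ge_1 by (simp add: field_simps)
    from C(3)[OF chart_bounds(1,2) this] show ?thesis
      by (simp add: chart_def quad_form_def power_mult_distrib mult.assoc)
  qed
  show ?thesis
  proof (rule that[of "C * \<Lambda> ^ 3" "C * \<Lambda> ^ 3 + D + 1" \<delta>'])
    show "C * \<Lambda> ^ 3 \<ge> 0" "C * \<Lambda> ^ 3 + D + 1 \<ge> 1" "\<delta>' > 0" "\<delta>' \<le> 1"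
      using C D \<Lambda>_ge_1 by (auto simp: \<delta>'_def)
    fix z :: complex assume z: "norm z \<le> \<delta>'"
    show "norm (w (chart z) - w_quad z) \<le> (C * \<Lambda> ^ 3) * norm z ^ 3"
      by (rule 1[OF z])
    have "norm (w_quad z) \<le> D * norm z ^ 2"
      using D(2)[of z 0] by (simp add: quad_form_def power2_eq_square mult.assoc)
    moreover have "(C * \<Lambda> ^ 3) * norm z ^ 3 \<le> (C * \<Lambda> ^ 3) * norm z ^ 2"
      using z C \<Lambda>_ge_1 by (intro mult_left_mono power_decreasing) (auto simp: \<delta>'_def)
    moreover have "norm (w (chart z)) \<le> norm (w (chart z) - w_quad z)
        + norm (w_quad z)"
      by (metis diff_add_cancel norm_triangle_ineq)
    moreover have "0 \<le> norm z ^ 2" by simp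
    ultimately show "norm (w (chart z)) \<le> (C * \<Lambda> ^ 3 + D + 1) * norm z ^ 2"
      using 1[OF z] unfolding distrib_right by linarith
  qed
qed

lemma nonlin_poly_on_manifold:
  fixes c :: "nat \<Rightarrow> ('n \<Rightarrow> nat) \<Rightarrow> 'b::real_normed_vector"
  assumes c: "\<And>j k. l < j + multi_order k \<Longrightarrow> c j k = 0"
  obtains C \<delta> where "C \<ge> 0" "\<delta> > 0"
    "\<And>z. norm z \<le> \<delta> \<Longrightarrow>
      norm (nonlin_poly l c (Re z / \<omega>\<^sub>0) (w (chart z)) - low_order_part c (Re z / \<omega>\<^sub>0) (w (chart z))) \<le> C * norm z ^ 4"
proof -
  obtain Cw B \<delta> where "Cw \<ge> 0" and B: "B \<ge> 1" "\<delta> > 0" "\<delta> \<le> 1"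
    and "\<And>z. norm z \<le> \<delta> \<Longrightarrow>
       norm (w (chart z) - w_quad z) \<le> Cw * norm z ^ 3"
    and Bw: "\<And>z. norm z \<le> \<delta> \<Longrightarrow> norm (w (chart z)) \<le> B * norm z ^ 2"
    using w_bounds by blast
  obtain C where C: "C \<ge> 0" "\<And>n x y. 0 \<le> n \<Longrightarrow> n \<le> 1 \<Longrightarrow> \<bar>x\<bar> \<le> n \<Longrightarrow> norm y \<le> B * n\<^sup>2 \<Longrightarrow>
      norm (nonlin_poly l c x y - low_order_part c x y) \<le> C * n ^ 4"
    by (rule nonlin_poly_expansion[OF l_le _ B(1)], erule c, blast)
  show ?thesis
  proof (rule that[of "C * \<Lambda> ^ 4" "min \<delta> (1 / \<Lambda>)"])
    show "C * \<Lambda> ^ 4 \<ge> 0" "min \<delta> (1 / \<Lambda>) > 0" using C B \<Lambda>_ge_1 by auto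
    fix z :: complex assume z: "norm z \<le> min \<delta> (1 / \<Lambda>)"
    have n: "0 \<le> \<Lambda> * norm z" "\<Lambda> * norm z \<le> 1" using z \<Lambda>_ge_1 by (auto simp: field_simps)
    have "norm (w (chart z)) \<le> B * norm z ^ 2" using z by (intro Bw) auto
    also have "\<dots> \<le> B * (\<Lambda> * norm z)\<^sup>2"
      using \<Lambda>_ge_1 B mult_right_mono[of 1 \<Lambda> "norm z"] by (intro mult_left_mono power_mono) auto
    finally have y: "norm (w (chart z)) \<le> B * (\<Lambda> * norm z)\<^sup>2" .
    show "norm (nonlin_poly l c (Re z / \<omega>\<^sub>0) (w (chart z)) - low_order_part c (Re z / \<omega>\<^sub>0) (w (chart z))) \<le> C * \<Lambda> ^ 4 * norm z ^ 4"
      using C(2)[OF n chart_bounds(1) y] by (simp add: power_mult_distrib mult.assoc)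
  qed
qed

text \<open>The polynomial \<open>P\<close> starts at second order, and \<open>w\<close> is Lipschitz near the origin because it is analytic.\<close>

lemma F_weak_oscillator:
  obtains L \<epsilon> where "weak_oscillator \<omega>\<^sub>0 L \<epsilon> F"
proof -
  have an: "real_analytic2_on w U" "(0, 0) \<in> U" and w0: "w (0, 0) = 0"
    using lsm by (auto simp: lyapunov_subcenter_manifold_def)
  obtain Lw \<delta> where Lw: "Lw > 0" "\<delta> > 0"
    "\<And>x v y u. \<bar>x\<bar> \<le> \<delta> \<Longrightarrow> \<bar>v\<bar> \<le> \<delta> \<Longrightarrow> \<bar>y\<bar> \<le> \<delta> \<Longrightarrow> \<bar>u\<bar> \<le> \<delta> \<Longrightarrow>
       norm (w (x, v) - w (y, u)) \<le> Lw * (\<bar>x - y\<bar> + \<bar>v - u\<bar>)"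
    using analytic_imp_lipschitz_near_0[OF an] by blast
  obtain C where C: "C > 0"
    "\<And>e x v y u. \<bar>x\<bar> \<le> e \<Longrightarrow> \<bar>v\<bar> \<le> e \<Longrightarrow> norm y \<le> e \<Longrightarrow> norm u \<le> e \<Longrightarrow> 0 < e \<Longrightarrow> e \<le> 1 \<Longrightarrow>
      norm (nonlin_poly l p x y - nonlin_poly l p v u) \<le> C * e * (\<bar>x - v\<bar> + norm (y - u))"
    by (rule nonlin_poly_lipschitz[of l p], blast)
  obtain Cp \<delta>p where "Cp \<ge> 0" and Cp: "\<delta>p > 0" "\<And>z. norm z \<le> \<delta>p \<Longrightarrow>
      norm (nonlin_poly l p (Re z / \<omega>\<^sub>0) (w (chart z)) - low_order_part p (Re z / \<omega>\<^sub>0) (w (chart z))) \<le> Cp * norm z ^ 4"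
    by (rule nonlin_poly_on_manifold, erule p_high, blast)
  define N where "N = \<Lambda> * (1 + Lw)"
  have N: "N > 0" "N \<ge> \<Lambda>" using Lw \<Lambda>_ge_1 by (auto simp: N_def)
  show ?thesis
  proof (rule that[of "C * N * N" "min (\<delta> / \<Lambda>) (1 / N)"], unfold_locales)
    show "F 0 = 0" using Cp(2)[of 0] Cp(1) unfolding F_def low_order_part_def unfolding P_eq by simp
    show "C * N * N > 0" "min (\<delta> / \<Lambda>) (1 / N) > 0" using C N Lw \<Lambda>_ge_1 by auto
    fix e :: real and a b :: complex
    assume e: "e \<le> min (\<delta> / \<Lambda>) (1 / N)" and ab: "norm a \<le> e" "norm b \<le> e"
    have ed: "\<Lambda> * e \<le> \<delta>" "N * e \<le> 1" using e \<Lambda>_ge_1 N by (auto simp: field_simps)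
    show "\<bar>F a - F b\<bar> \<le> C * N * N * e * norm (a - b)"
    proof (cases "e > 0")
      case False
      then have "norm a = 0" "norm b = 0" using ab norm_ge_zero[of a] norm_ge_zero[of b] by linarith+
      then show ?thesis by simp
    next
      case True
      have ch: "\<bar>Re z / \<omega>\<^sub>0\<bar> \<le> \<Lambda> * e" "\<bar>Im z\<bar> \<le> \<Lambda> * e" if "norm z \<le> e" for z
        using chart_bounds(1,2)[of z] mult_left_mono[OF that, of \<Lambda>] \<Lambda>_ge_1 by linarith+
      have Ne: "\<Lambda> * e \<le> N * e" using N True by simp
      have wz: "norm (w (chart z)) \<le> N * e" if "norm z \<le> e" for z
      proof -
        have "norm (w (chart z) - w (0, 0)) \<le> Lw * (\<bar>Re z / \<omega>\<^sub>0 - 0\<bar> + \<bar>Im z - 0\<bar>)"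
          unfolding chart_def using ch[OF that] ed Lw(2) by (intro Lw(3)) auto
        also have "\<dots> \<le> Lw * (\<Lambda> * norm z)"
          using chart_bounds(3)[of z] Lw by (intro mult_left_mono) auto
        also have "\<dots> \<le> Lw * (\<Lambda> * e)" using that Lw \<Lambda>_ge_1 by (intro mult_left_mono) auto
        also have "\<dots> \<le> N * e" using True \<Lambda>_ge_1 by (simp add: N_def algebra_simps)
        finally show ?thesis by (simp add: w0)
      qed
      define dx where "dx = \<bar>Re a / \<omega>\<^sub>0 - Re b / \<omega>\<^sub>0\<bar>"
      define dv where "dv = \<bar>Im a - Im b\<bar>"
      have dd: "dx + dv \<le> \<Lambda> * norm (a - b)"
        using chart_bounds(3)[of "a - b"] by (simp add: dx_def dv_def diff_divide_distrib)
      have nn: "dx \<ge> 0" "dv \<ge> 0" by (auto simp: dx_def dv_def)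
      have "norm (nonlin_poly l p (Re a / \<omega>\<^sub>0) (w (chart a)) - nonlin_poly l p (Re b / \<omega>\<^sub>0) (w (chart b)))
          \<le> C * (N * e) * (dx + norm (w (chart a) - w (chart b)))"
        unfolding dx_def
        by (rule C(2)) (use ch(1)[OF ab(1)] ch(1)[OF ab(2)] wz[OF ab(1)] wz[OF ab(2)] Ne ed True N in \<open>linarith | simp\<close>)+
      then have "\<bar>F a - F b\<bar> \<le> C * (N * e) * (dx + norm (w (chart a) - w (chart b)))"
        unfolding F_def unfolding P_eq by simp
      also have "\<dots> \<le> C * (N * e) * (dx + Lw * (dx + dv))"
      proof (intro mult_left_mono add_left_mono)
        show "norm (w (chart a) - w (chart b)) \<le> Lw * (dx + dv)"
          unfolding dx_def dv_def chart_def
          by (rule Lw(3)) (use ch[OF ab(1)] ch[OF ab(2)] ed in linarith)+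
      qed (use C N True in auto)
      also have "\<dots> \<le> C * (N * e) * (N * norm (a - b))"
      proof (intro mult_left_mono)
        have "dx + Lw * (dx + dv) \<le> (1 + Lw) * (dx + dv)" using nn Lw by (simp add: algebra_simps)
        also have "\<dots> \<le> (1 + Lw) * (\<Lambda> * norm (a - b))" using dd Lw by (intro mult_left_mono) auto
        finally show "dx + Lw * (dx + dv) \<le> N * norm (a - b)" by (simp add: N_def mult_ac)
      qed (use C N True in auto)
      finally show ?thesis by (simp add: mult_ac)
    qed
  qed (rule \<omega>\<^sub>0_pos)
qed

abbreviation m0 :: "real ^ 'n" where "m0 \<equiv> matrix_inv M *v q 2 (\<lambda>_. 0)"

text \<open>Minus the quadratic part of \<open>accel\<close>.\<close>

abbreviation accel_quad :: "complex \<Rightarrow> real ^ 'n" where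
  "accel_quad \<equiv> quad_form \<omega>\<^sub>0 (\<Omega>2 *v W 2 0 + m0) (\<Omega>2 *v W 1 1) (\<Omega>2 *v W 0 2)"

text \<open>To second order the coupling enters only through the term \<open>x\<^sup>2\<close> of \<open>Q\<close>, since \<open>w\<close> itself is of second order.\<close>

lemma accel_expansion:
  obtains C \<delta> where "C \<ge> 0" "\<delta> > 0"
    "\<And>z. norm z \<le> \<delta> \<Longrightarrow>
       norm (accel z + accel_quad z) \<le> C * norm z ^ 3"
proof -
  obtain Cw B \<delta>w where Cw: "Cw \<ge> 0" "B \<ge> 1" "\<delta>w > 0" "\<delta>w \<le> 1"
    "\<And>z. norm z \<le> \<delta>w \<Longrightarrow> norm (w (chart z) - w_quad z) \<le> Cw * norm z ^ 3"
    "\<And>z. norm z \<le> \<delta>w \<Longrightarrow> norm (w (chart z)) \<le> B * norm z ^ 2" using w_bounds by blast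
  obtain Cq \<delta>q where Cq: "Cq \<ge> 0" "\<delta>q > 0" "\<And>z. norm z \<le> \<delta>q \<Longrightarrow>
      norm (nonlin_poly l q (Re z / \<omega>\<^sub>0) (w (chart z)) - low_order_part q (Re z / \<omega>\<^sub>0) (w (chart z))) \<le> Cq * norm z ^ 4"
    by (rule nonlin_poly_on_manifold, erule q_high, blast)
  define S where "S = (\<Sum>i\<in>(UNIV :: 'n set). norm (q 1 (unit_index i)))"
  have S: "S \<ge> 0" by (auto simp: S_def sum_nonneg)
  define D where "D = Cq + \<Lambda> ^ 3 * norm (q 3 (\<lambda>_. 0)) + \<Lambda> * B * S"
  have D: "D \<ge> 0" using Cq Cw S \<Lambda>_ge_1 by (auto simp: D_def)
  have Q: "norm (Q (Re z / \<omega>\<^sub>0) (w (chart z)) - (Re z / \<omega>\<^sub>0)\<^sup>2 *\<^sub>R q 2 (\<lambda>_. 0)) \<le> D * norm z ^ 3"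
    if z: "norm z \<le> min \<delta>w \<delta>q" for z
  proof -
    define x y where "x = Re z / \<omega>\<^sub>0" and "y = w (chart z)"
    have x: "\<bar>x\<bar> \<le> \<Lambda> * norm z" using chart_bounds(1) by (simp add: x_def)
    have y: "\<bar>y $ i\<bar> \<le> B * norm z ^ 2" for i
      using component_le_norm_cart[of y i] Cw(6)[of z] z by (simp add: y_def)
    have "Cq * norm z ^ 4 \<le> Cq * norm z ^ 3"
      using Cq z Cw by (intro mult_left_mono power_decreasing) auto
    then have 1: "norm (Q x y - low_order_part q x y) \<le> Cq * norm z ^ 3"
      using Cq(3)[of z] z by (simp add: Q_eq x_def y_def)
    have "\<bar>x\<bar> ^ 3 \<le> (\<Lambda> * norm z) ^ 3" using x by (intro power_mono) auto
    then have 2: "norm (x ^ 3 *\<^sub>R q 3 (\<lambda>_. 0)) \<le> \<Lambda> ^ 3 * norm (q 3 (\<lambda>_. 0)) * norm z ^ 3"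
      using mult_right_mono[of "\<bar>x\<bar> ^ 3" "(\<Lambda> * norm z) ^ 3" "norm (q 3 (\<lambda>_. 0))"]
      by (simp add: power_abs power_mult_distrib mult_ac)
    have 3: "norm (\<Sum>i\<in>UNIV. (x * y $ i) *\<^sub>R q 1 (unit_index i)) \<le> \<Lambda> * B * S * norm z ^ 3"
    proof -
      have "norm (\<Sum>i\<in>UNIV. (x * y $ i) *\<^sub>R q 1 (unit_index i))
          \<le> (\<Sum>i\<in>UNIV. (\<Lambda> * norm z) * (B * norm z ^ 2) * norm (q 1 (unit_index i)))"
        using x y \<Lambda>_ge_1 Cw(2)
        by (intro sum_norm_le) (auto simp: abs_mult intro!: mult_mono mult_nonneg_nonneg)
      also have "\<dots> = \<Lambda> * B * S * norm z ^ 3"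
        by (simp add: S_def sum_distrib_left power2_eq_square power3_eq_cube mult_ac)
      finally show ?thesis .
    qed
    have "Q x y - x\<^sup>2 *\<^sub>R q 2 (\<lambda>_. 0) = (Q x y - low_order_part q x y) + x ^ 3 *\<^sub>R q 3 (\<lambda>_. 0)
        + (\<Sum>i\<in>UNIV. (x * y $ i) *\<^sub>R q 1 (unit_index i))" by (simp add: low_order_part_def)
    also have "norm \<dots> \<le> Cq * norm z ^ 3 + \<Lambda> ^ 3 * norm (q 3 (\<lambda>_. 0)) * norm z ^ 3 + \<Lambda> * B * S * norm z ^ 3"
      by (intro norm_triangle_le add_mono 1 2 3)
    also have "\<dots> = D * norm z ^ 3" by (simp add: D_def algebra_simps)
    finally show ?thesis by (simp add: x_def y_def)
  qed
  obtain K1 where K1: "K1 > 0" "\<And>v. norm (\<Omega>2 *v v) \<le> norm v * K1"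
    using bounded_linear.pos_bounded[OF matrix_vector_mul_bounded_linear[of \<Omega>2]] by blast
  obtain K2 where K2: "K2 > 0" "\<And>v. norm (matrix_inv M *v v) \<le> norm v * K2"
    using bounded_linear.pos_bounded[OF matrix_vector_mul_bounded_linear[of "matrix_inv M"]] by blast
  show ?thesis
  proof (rule that[of "Cw * K1 + D * K2" "min \<delta>w \<delta>q"])
    show "Cw * K1 + D * K2 \<ge> 0" "min \<delta>w \<delta>q > 0" using Cw Cq D K1 K2 by auto
    fix z :: complex assume z: "norm z \<le> min \<delta>w \<delta>q"
    let ?x = "Re z / \<omega>\<^sub>0"
    have "accel z + accel_quad z
      = - (\<Omega>2 *v (w (chart z) - w_quad z)
         + matrix_inv M *v (Q ?x (w (chart z)) - ?x\<^sup>2 *\<^sub>R q 2 (\<lambda>_. 0)))"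
      by (simp add: accel_def quad_form_def matrix_vector_mult_diff_distrib matrix_vector_right_distrib
          matrix_vector_mult_scaleR algebra_simps)
    also have "norm \<dots> \<le> norm (\<Omega>2 *v (w (chart z) - w_quad z))
         + norm (matrix_inv M *v (Q ?x (w (chart z)) - ?x\<^sup>2 *\<^sub>R q 2 (\<lambda>_. 0)))"
      unfolding norm_minus_cancel by (rule norm_triangle_ineq)
    also have "\<dots> \<le> Cw * norm z ^ 3 * K1 + D * norm z ^ 3 * K2"
      using Q[OF z] Cw(5)[of z] z K1(1) K2(1)
      by (intro add_mono order_trans[OF K1(2)] order_trans[OF K2(2)] mult_right_mono) auto
    also have "\<dots> = (Cw * K1 + D * K2) * norm z ^ 3" by (simp add: algebra_simps)
    finally show "norm (accel z + accel_quad z)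
        \<le> (Cw * K1 + D * K2) * norm z ^ 3" .
  qed
qed

end


section \<open>Minimal periods and invariance at second order\<close>

lemma norm_cis_diff_le: "norm (cis a - cis b) \<le> \<bar>a - b\<bar>"
proof -
  have *: "norm (cis y - cis x) \<le> 1 * (y - x)" if "x \<le> y" for x y
  proof (rule norm_diff_le_of_vector_derivative[OF that])
    fix t
    show "(cis has_vector_derivative \<i> * cis t) (at t)"
      by (auto intro!: derivative_eq_intros simp: complex_eq_iff has_vector_derivative_complex_iff)
  qed (simp add: norm_mult)
  show ?thesis
    using *[of a b] *[of b a] by (cases "a \<le> b") (auto simp: norm_minus_commute)
qed

lemma has_minimal_period_inject:
  assumes "inj f" shows "has_minimal_period (\<lambda>t. f (c t)) T \<longleftrightarrow> has_minimal_period c T"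
  using assms by (simp add: has_minimal_period_def has_period_def inj_eq)

lemma has_period_inject:
  assumes "inj f" shows "has_period (\<lambda>t. f (c t)) T \<longleftrightarrow> has_period c T"
  using assms by (simp add: has_period_def inj_eq)

context weak_oscillator
begin

text \<open>The start phase is advanced by \<open>\<omega> h\<close> in order that the solution is close to \<open>r e\<close> at the middle of the time
interval from \<open>0\<close> to \<open>2 h\<close>.\<close>

lemma close_to_rotation:
  assumes c: "oscillation \<omega> F c" "c 0 = of_real r * (cis (\<omega> * h) * e)" and e: "norm e = 1"
    and r: "small_amplitude r" and t: "0 \<le> t" "t \<le> horizon"
  shows "norm (c t - of_real r * (cis (\<omega> * (h - t)) * e)) \<le> 4 * (horizon * L) * r\<^sup>2"
proof -
  have r0: "r > 0" using r by (simp add: small_amplitude_def)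
  have n0: "norm (c 0) = r" using c(2) e r0 by (simp add: norm_mult)
  have "rotating c t - c 0 = cis (\<omega> * t) * (c t - of_real r * (cis (\<omega> * (h - t)) * e))"
  proof -
    have "cis (\<omega> * t) * cis (\<omega> * (h - t)) = cis (\<omega> * h)" by (simp add: cis_mult algebra_simps)
    then have "cis (\<omega> * t) * (of_real r * (cis (\<omega> * (h - t)) * e)) = c 0"
      unfolding c(2) by (metis mult.assoc mult.left_commute)
    then show ?thesis by (simp add: right_diff_distrib)
  qed
  then have "norm (c t - of_real r * (cis (\<omega> * (h - t)) * e)) = norm (rotating c t - c 0)"
    by (simp add: norm_mult)
  also have "\<dots> \<le> 4 * (horizon * L) * r * r"
    using rotating_almost_constant[OF c(1) r _ t] n0 by simp
  finally show ?thesis by (simp add: power2_eq_square)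
qed

text \<open>Two solutions are considered because the backbone curve admits every trajectory through the start point;
by uniqueness on the horizon they have the same first return.\<close>

lemma common_minimal_period_pos:
  assumes c: "oscillation \<omega> F c" "c 0 = of_real s" "has_period c T"
    and d: "oscillation \<omega> F d" "d 0 = of_real s" "has_period d T'"
    and s: "small_amplitude (2 * s)"
  shows "\<exists>\<tau>. has_minimal_period c \<tau> \<and> has_minimal_period d \<tau> \<and> \<tau> \<le> horizon \<and> \<bar>\<omega> * \<tau> - 2 * pi\<bar> \<le> 1 / 2"
proof -
  have s0: "s > 0" using s by (simp add: small_amplitude_def)
  have sm: "small_amplitude s" using small_amplitude_mono[OF s] s0 by simp
  obtain \<tau> where \<tau>: "first_return c \<tau>" "\<bar>\<omega> * \<tau> - 2 * pi\<bar> \<le> pi / 3"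
    using first_return_exists[OF c(1,2) sm] by blast
  have h: "\<tau> \<le> horizon" using first_return_window(2)[OF c(1,2) sm \<tau>(1)] .
  have "c t = d t" if "0 \<le> t" "t \<le> \<tau>" for t
    using oscillation_unique[OF c(1) d(1) sm] that h c(2) d(2) s0 by simp
  then have "first_return d \<tau>" using \<tau>(1) unfolding first_return_def by auto
  moreover have "\<bar>\<omega> * \<tau> - 2 * pi\<bar> \<le> 1 / 2"
  proof -
    have "norm (cis (\<omega> * \<tau>) - 1) \<le> 8 * (horizon * L) * s"
      using first_return_window(4)[OF c(1,2) sm \<tau>(1)] .
    also have "\<dots> \<le> 1 / 4" using sm by (simp add: small_amplitude_def)
    finally show ?thesis using norm_cis_minus_1_ge[OF \<tau>(2)] by simp
  qed
  ultimately show ?thesis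
    using minimal_period_is_first_return[OF c(1,2) s c(3) \<tau>(1)]
      minimal_period_is_first_return[OF d(1,2) s d(3)] h by blast
qed

lemma common_minimal_period:
  assumes c: "oscillation \<omega> F c" "c 0 = of_real s" "has_period c T"
    and d: "oscillation \<omega> F d" "d 0 = of_real s" "has_period d T'"
    and s: "small_amplitude (2 * \<bar>s\<bar>)"
  shows "\<exists>\<tau>. has_minimal_period c \<tau> \<and> has_minimal_period d \<tau> \<and> \<tau> \<le> horizon \<and> \<bar>\<omega> * \<tau> - 2 * pi\<bar> \<le> 1 / 2"
proof (cases "s > 0")
  case True
  then show ?thesis using common_minimal_period_pos[OF c d] s by simp
next
  case False
  interpret refl: weak_oscillator \<omega> L \<epsilon>\<^sub>0 "\<lambda>z. - F (- z)" by (rule reflected_oscillator)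
  have i: "inj (uminus :: complex \<Rightarrow> complex)" by simp
  have "refl.small_amplitude (2 * - s)"
    using s False by (simp add: small_amplitude_def refl.small_amplitude_def horizon_def refl.horizon_def)
  from refl.common_minimal_period_pos[OF oscillation_uminus[OF c(1)] _ _ oscillation_uminus[OF d(1)] _ _ this, of T T']
  show ?thesis
    using c d by (simp add: has_minimal_period_inject[OF i] has_period_inject[OF i] horizon_def refl.horizon_def)
qed

end

context subcenter_manifold
begin

text \<open>The variable \<open>y\<close> contributes at third order only through \<open>x \<langle>p\<^sub>1\<^sub>I, w\<rangle>\<close>, with \<open>w\<close> replaced by its quadratic part.\<close>

lemma F_expansion:
  assumes "W 1 1 = 0"
  defines "p1 \<equiv> (\<chi> j. p 1 (unit_index j))"
  obtains D \<delta> where "D \<ge> 0" "\<delta> > 0"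
    "\<And>z. norm z \<le> \<delta> \<Longrightarrow>
       \<bar>F z - cubic_restoring \<omega>\<^sub>0 (p 2 (\<lambda>_. 0)) (p 3 (\<lambda>_. 0) + p1 \<bullet> W 2 0) (p1 \<bullet> W 0 2) z\<bar> \<le> D * norm z ^ 4"
proof -
  obtain Cw B \<delta>w where Cw: "Cw \<ge> 0" "B \<ge> 1" "\<delta>w > 0" "\<delta>w \<le> 1"
    "\<And>z. norm z \<le> \<delta>w \<Longrightarrow> norm (w (chart z) - w_quad z) \<le> Cw * norm z ^ 3"
    "\<And>z. norm z \<le> \<delta>w \<Longrightarrow> norm (w (chart z)) \<le> B * norm z ^ 2" using w_bounds by blast
  obtain C \<delta>p where C: "C \<ge> 0" "\<delta>p > 0" "\<And>z. norm z \<le> \<delta>p \<Longrightarrow>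
      norm (nonlin_poly l p (Re z / \<omega>\<^sub>0) (w (chart z)) - low_order_part p (Re z / \<omega>\<^sub>0) (w (chart z))) \<le> C * norm z ^ 4"
    by (rule nonlin_poly_on_manifold, erule p_high, blast)
  show ?thesis
  proof (rule that[of "C + \<Lambda> * norm p1 * Cw" "min \<delta>w \<delta>p"])
    show "C + \<Lambda> * norm p1 * Cw \<ge> 0" "min \<delta>w \<delta>p > 0" using C Cw \<Lambda>_ge_1 by auto
    fix z :: complex assume z: "norm z \<le> min \<delta>w \<delta>p"
    define x where "x = Re z / \<omega>\<^sub>0"
    define R where "R = w (chart z) - w_quad z"
    have sum: "(\<Sum>i\<in>UNIV. (x * w (chart z) $ i) *\<^sub>R p 1 (unit_index i)) = x * (p1 \<bullet> w (chart z))"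
      by (simp add: p1_def inner_vec_def sum_distrib_left mult_ac)
    have 1: "\<bar>F z - (x\<^sup>2 * p 2 (\<lambda>_. 0) + x ^ 3 * p 3 (\<lambda>_. 0) + x * (p1 \<bullet> w (chart z)))\<bar> \<le> C * norm z ^ 4"
      using C(3)[of z] z unfolding F_def low_order_part_def x_def[symmetric] sum unfolding P_eq by simp
    have "\<bar>x * (p1 \<bullet> R)\<bar> \<le> (\<Lambda> * norm z) * (norm p1 * (Cw * norm z ^ 3))"
    proof -
      have "\<bar>p1 \<bullet> R\<bar> \<le> norm p1 * norm R" by (rule Cauchy_Schwarz_ineq2)
      also have "\<dots> \<le> norm p1 * (Cw * norm z ^ 3)"
        using Cw(5)[of z] z by (intro mult_left_mono) (auto simp: R_def)
      finally show ?thesis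
        unfolding abs_mult using chart_bounds(1)[of z] \<Lambda>_ge_1 by (intro mult_mono) (auto simp: x_def)
    qed
    then have 2: "\<bar>x * (p1 \<bullet> R)\<bar> \<le> \<Lambda> * norm p1 * Cw * norm z ^ 4"
      by (simp add: power_numeral_reduce mult_ac)
    have "w (chart z) = R + w_quad z" by (simp add: R_def)
    then have "p1 \<bullet> w (chart z) = p1 \<bullet> R + x\<^sup>2 * (p1 \<bullet> W 2 0) + (Im z)\<^sup>2 * (p1 \<bullet> W 0 2)"
      by (simp add: quad_form_def assms(1)[unfolded One_nat_def] inner_add_right x_def)
    then have "F z - cubic_restoring \<omega>\<^sub>0 (p 2 (\<lambda>_. 0)) (p 3 (\<lambda>_. 0) + p1 \<bullet> W 2 0) (p1 \<bullet> W 0 2) z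
      = (F z - (x\<^sup>2 * p 2 (\<lambda>_. 0) + x ^ 3 * p 3 (\<lambda>_. 0) + x * (p1 \<bullet> w (chart z)))) + x * (p1 \<bullet> R)"
      by (simp add: cubic_restoring_def x_def[symmetric] algebra_simps power2_eq_square power3_eq_cube)
    with 1 2 show "\<bar>F z - cubic_restoring \<omega>\<^sub>0 (p 2 (\<lambda>_. 0)) (p 3 (\<lambda>_. 0) + p1 \<bullet> W 2 0) (p1 \<bullet> W 0 2) z\<bar>
        \<le> (C + \<Lambda> * norm p1 * Cw) * norm z ^ 4"
      by (simp add: distrib_right)
  qed
qed

text \<open>For a solution of amplitude \<open>r\<close>, both \<open>y\<close> and its second derivative are, up to \<open>O(r\<^sup>3)\<close>, equal to \<open>r\<^sup>2\<close> times
a quadratic form of the rotating unit vector. The second difference of \<open>y\<close> over the times \<open>0\<close>, \<open>h\<close>, \<open>2 h\<close> compares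
the two.\<close>

lemma quadratic_invariance:
  assumes e: "norm e = 1"
  shows "\<omega>\<^sub>0\<^sup>2 *\<^sub>R quad_form \<omega>\<^sub>0 ((-2) *\<^sub>R W 2 0 + (2 * \<omega>\<^sub>0\<^sup>2) *\<^sub>R W 0 2) ((-4) *\<^sub>R W 1 1)
           ((2 / \<omega>\<^sub>0\<^sup>2) *\<^sub>R W 2 0 - 2 *\<^sub>R W 0 2) e
       + accel_quad e = 0"
proof -
  obtain L \<epsilon> where wo: "weak_oscillator \<omega>\<^sub>0 L \<epsilon> F" using F_weak_oscillator by blast
  interpret weak_oscillator \<omega>\<^sub>0 L \<epsilon> F by (rule wo)
  define S where "S = w_quad"
  define G where "G = accel_quad"
  define N where "N = quad_form \<omega>\<^sub>0 ((-2) *\<^sub>R W 2 0 + (2 * \<omega>\<^sub>0\<^sup>2) *\<^sub>R W 0 2) ((-4) *\<^sub>R W 1 1)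
           ((2 / \<omega>\<^sub>0\<^sup>2) *\<^sub>R W 2 0 - 2 *\<^sub>R W 0 2)"
  obtain LS where LS: "LS \<ge> 0" "\<And>y z. norm (S y - S z) \<le> LS * (norm y + norm z) * norm (y - z)"
    using quad_form_lipschitz[OF \<omega>\<^sub>0_pos, of "W 2 0" "W 1 1" "W 0 2"] unfolding S_def by blast
  obtain LG where LG: "LG \<ge> 0" "\<And>y z. norm (G y - G z) \<le> LG * (norm y + norm z) * norm (y - z)"
    using quad_form_lipschitz[OF \<omega>\<^sub>0_pos, of "\<Omega>2 *v W 2 0 + m0" "\<Omega>2 *v W 1 1" "\<Omega>2 *v W 0 2"]
    unfolding G_def by blast
  obtain Cw B \<delta>w where Cw: "Cw \<ge> 0" "B \<ge> 1" "\<delta>w > 0" "\<delta>w \<le> 1"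
    "\<And>z. norm z \<le> \<delta>w \<Longrightarrow> norm (w (chart z) - S z) \<le> Cw * norm z ^ 3"
    "\<And>z. norm z \<le> \<delta>w \<Longrightarrow> norm (w (chart z)) \<le> B * norm z ^ 2" using w_bounds unfolding S_def by blast
  obtain Ca \<delta>a where Ca: "Ca \<ge> 0" "\<delta>a > 0" "\<And>z. norm z \<le> \<delta>a \<Longrightarrow> norm (accel z + G z) \<le> Ca * norm z ^ 3"
    using accel_expansion unfolding G_def by blast
  obtain \<delta>U where \<delta>U: "\<delta>U > 0" "\<And>z. norm z \<le> \<delta>U \<Longrightarrow> chart z \<in> U" using chart_near_0 by blast
  define k where "k = 4 * (horizon * L)"
  have k: "k > 0" using horizon_pos L_pos by (simp add: k_def)
  define d where "d = Min {\<epsilon> / 2, 1 / (400 * (horizon * L)), \<delta>w / 2, \<delta>a / 2, \<delta>U}"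
  have d: "d > 0" unfolding d_def
    using \<epsilon>\<^sub>0_pos horizon_pos L_pos Cw(3) Ca(2) \<delta>U(1) by (subst Min_gr_iff) auto
  define A1 where "A1 = 8 * Cw + 3 * LS * k"
  define A2 where "A2 = 8 * Ca + 3 * LG * k"
  have "norm ((sin (\<omega>\<^sub>0 * h))\<^sup>2 *\<^sub>R N e + h\<^sup>2 *\<^sub>R G e) \<le> (2 * LG * \<omega>\<^sub>0) * h ^ 3"
    if h: "0 < h" "h \<le> horizon / 2" for h
  proof (rule le_of_small_error[OF d])
    fix r :: real assume r: "0 < r" "r \<le> d"
    have "d \<le> \<epsilon> / 2" "d \<le> 1 / (400 * (horizon * L))" "d \<le> \<delta>w / 2" "d \<le> \<delta>a / 2" "d \<le> \<delta>U"
      unfolding d_def by (rule Min_le, simp, blast)+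
    with r have rd: "2 * r \<le> \<epsilon>" "r \<le> 1 / (400 * (horizon * L))" "2 * r \<le> \<delta>w" "2 * r \<le> \<delta>a" "r \<le> \<delta>U"
      by linarith+
    have sm: "small_amplitude r"
      using rd(1,2) r horizon_pos L_pos by (auto simp: small_amplitude_def field_simps)
    define z0 where "z0 = of_real r * (cis (\<omega>\<^sub>0 * h) * e)"
    have z0: "norm z0 = r" using r e by (simp add: z0_def norm_mult)
    have z0U: "chart z0 \<in> U" using \<delta>U(2)[of z0] z0 rd(5) by simp
    obtain \<gamma> c T where "mech_trajectory \<omega>\<^sub>0 M K P Q UNIV \<gamma>" "has_period \<gamma> T"
      "\<gamma> = (\<lambda>t. state_of (c t))" and c: "c 0 = z0" "oscillation \<omega>\<^sub>0 F c"
      "\<And>t. ((\<lambda>t. w (chart (c t))) has_vector_derivative w' (chart (c t))) (at t)"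
      "\<And>t. ((\<lambda>t. w' (chart (c t))) has_vector_derivative accel (c t)) (at t)"
      by (rule trajectory_exists[OF z0U]) blast
    define et where "et = (\<lambda>t. cis (\<omega>\<^sub>0 * (h - t)) * e)"
    have et: "norm (et t) = 1" for t using e by (simp add: et_def norm_mult)
    have c2: "norm (c t) \<le> 2 * r" if "0 \<le> t" "t \<le> 2 * h" for t
      using stays_small[OF c(2) sm _ that(1)] that h z0 c(1) by simp
    have cl: "norm (c t - of_real r * et t) \<le> k * r\<^sup>2" if "0 \<le> t" "t \<le> 2 * h" for t
      using close_to_rotation[OF c(2) c(1)[unfolded z0_def] e sm that(1)] that h
      by (simp add: et_def k_def)
    \<comment> \<open>A quadratic form sees the distance \<open>O(r\<^sup>2)\<close> between solution and rotation only at third order.\<close>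
    have quad: "norm (H (c t) - r\<^sup>2 *\<^sub>R H (et t)) \<le> 3 * LH * k * r ^ 3"
      if H: "\<And>y z. norm (H y - H z) \<le> LH * (norm y + norm z) * norm (y - z)"
        "H (of_real r * et t) = r\<^sup>2 *\<^sub>R H (et t)" "LH \<ge> 0" and t: "0 \<le> t" "t \<le> 2 * h"
      for H :: "complex \<Rightarrow> real ^ 'n" and LH t
    proof -
      have "norm (H (c t) - H (of_real r * et t)) \<le> LH * (norm (c t) + norm (of_real r * et t)) * norm (c t - of_real r * et t)"
        by (rule H)
      also have "\<dots> \<le> LH * (2 * r + r) * (k * r\<^sup>2)"
        using c2[OF t] cl[OF t] et r H(3) by (intro mult_mono add_mono) (auto simp: norm_mult)
      finally show ?thesis unfolding H(2) by (simp add: power2_eq_square power3_eq_cube algebra_simps)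
    qed
    have cube: "norm (c t) ^ 3 \<le> 8 * r ^ 3" if "0 \<le> t" "t \<le> 2 * h" for t
      using power_mono[OF c2[OF that], of 3] by (simp add: power_mult_distrib)
    have Y: "norm (w (chart (c t)) - r\<^sup>2 *\<^sub>R S (et t)) \<le> A1 * r ^ 3" if t: "0 \<le> t" "t \<le> 2 * h" for t
    proof -
      have "norm (w (chart (c t)) - S (c t)) \<le> Cw * norm (c t) ^ 3"
        using c2[OF t] rd by (intro Cw(5)) auto
      also have "\<dots> \<le> Cw * (8 * r ^ 3)" using cube[OF t] Cw(1) by (rule mult_left_mono)
      finally have 1: "norm (w (chart (c t)) - S (c t)) \<le> Cw * (8 * r ^ 3)" .
      have 2: "norm (S (c t) - r\<^sup>2 *\<^sub>R S (et t)) \<le> 3 * LS * k * r ^ 3"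
        using t by (intro quad LS) (simp add: S_def quad_form_scale)
      have "w (chart (c t)) - r\<^sup>2 *\<^sub>R S (et t) = (w (chart (c t)) - S (c t)) + (S (c t) - r\<^sup>2 *\<^sub>R S (et t))" by simp
      also have "norm \<dots> \<le> Cw * (8 * r ^ 3) + 3 * LS * k * r ^ 3"
        by (intro norm_triangle_le add_mono 1 2)
      finally show ?thesis by (simp add: A1_def algebra_simps)
    qed
    have Y2: "norm (accel (c t) - (- (r\<^sup>2 *\<^sub>R G e))) \<le> A2 * r ^ 3 + r\<^sup>2 * (2 * LG * \<omega>\<^sub>0 * h)" if t: "0 \<le> t" "t \<le> 2 * h" for t
    proof -
      have "norm (accel (c t) + G (c t)) \<le> Ca * norm (c t) ^ 3"
        using c2[OF t] rd by (intro Ca(3)) auto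
      also have "\<dots> \<le> Ca * (8 * r ^ 3)" using cube[OF t] Ca(1) by (rule mult_left_mono)
      finally have 1: "norm (accel (c t) + G (c t)) \<le> Ca * (8 * r ^ 3)" .
      have 2: "norm (G (c t) - r\<^sup>2 *\<^sub>R G (et t)) \<le> 3 * LG * k * r ^ 3"
        using t by (intro quad LG) (simp add: G_def quad_form_scale)
      have "et t - e = (cis (\<omega>\<^sub>0 * (h - t)) - cis 0) * e" by (simp add: et_def algebra_simps)
      then have "norm (et t - e) = norm (cis (\<omega>\<^sub>0 * (h - t)) - cis 0)" using e by (simp add: norm_mult)
      also have "\<dots> \<le> \<bar>\<omega>\<^sub>0 * (h - t) - 0\<bar>" by (rule norm_cis_diff_le)
      also have "\<dots> \<le> \<omega>\<^sub>0 * h" using t h \<omega>\<^sub>0_pos by (simp add: abs_mult abs_le_iff)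
      finally have en: "norm (et t - e) \<le> \<omega>\<^sub>0 * h" .
      have "norm (G (et t) - G e) \<le> LG * (norm (et t) + norm e) * norm (et t - e)" by (rule LG)
      also have "\<dots> \<le> LG * 2 * (\<omega>\<^sub>0 * h)"
        using en LG(1) et[of t] e by (intro mult_mono) auto
      finally have "norm (G (et t) - G e) \<le> 2 * LG * \<omega>\<^sub>0 * h" by (simp add: mult_ac)
      then have 3: "norm (r\<^sup>2 *\<^sub>R (G (et t) - G e)) \<le> r\<^sup>2 * (2 * LG * \<omega>\<^sub>0 * h)"
        unfolding norm_scaleR by (simp add: mult_left_mono)
      have "accel (c t) - (- (r\<^sup>2 *\<^sub>R G e)) = (accel (c t) + G (c t)) - (G (c t) - r\<^sup>2 *\<^sub>R G (et t)) - r\<^sup>2 *\<^sub>R (G (et t) - G e)"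
        by (simp add: scaleR_diff_right)
      also have "norm \<dots> \<le> norm ((accel (c t) + G (c t)) - (G (c t) - r\<^sup>2 *\<^sub>R G (et t))) + norm (r\<^sup>2 *\<^sub>R (G (et t) - G e))"
        by (rule norm_triangle_ineq4)
      also have "\<dots> \<le> Ca * (8 * r ^ 3) + 3 * LG * k * r ^ 3 + r\<^sup>2 * (2 * LG * \<omega>\<^sub>0 * h)"
        using norm_triangle_ineq4[of "accel (c t) + G (c t)" "G (c t) - r\<^sup>2 *\<^sub>R G (et t)"] 1 2 3 by linarith
      finally show ?thesis by (simp add: A2_def algebra_simps)
    qed
    define y where "y = (\<lambda>t. w (chart (c t)))"
    have sd: "norm (y 0 - 2 *\<^sub>R y h + y (2 * h) - h\<^sup>2 *\<^sub>R (- (r\<^sup>2 *\<^sub>R G e)))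
        \<le> (A2 * r ^ 3 + r\<^sup>2 * (2 * LG * \<omega>\<^sub>0 * h)) * h\<^sup>2"
      unfolding y_def using h Y2 by (intro second_difference_bound[OF _ c(3,4)]) auto
    have SD: "S (et 0) - 2 *\<^sub>R S (et h) + S (et (2 * h)) = (sin (\<omega>\<^sub>0 * h))\<^sup>2 *\<^sub>R N e"
      using quad_form_second_difference[of \<omega>\<^sub>0 "W 2 0" "W 1 1" "W 0 2" "- (\<omega>\<^sub>0 * h)" e] \<omega>\<^sub>0_pos
      by (simp add: S_def N_def et_def algebra_simps)
    define Y0 Y1 where "Y0 = y 0 - 2 *\<^sub>R y h + y (2 * h) - h\<^sup>2 *\<^sub>R (- (r\<^sup>2 *\<^sub>R G e))"
      and "Y1 = (y 0 - r\<^sup>2 *\<^sub>R S (et 0)) - 2 *\<^sub>R (y h - r\<^sup>2 *\<^sub>R S (et h)) + (y (2 * h) - r\<^sup>2 *\<^sub>R S (et (2 * h)))"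
    have "r\<^sup>2 *\<^sub>R ((sin (\<omega>\<^sub>0 * h))\<^sup>2 *\<^sub>R N e + h\<^sup>2 *\<^sub>R G e) = Y0 - Y1"
      unfolding SD[symmetric] Y0_def Y1_def by (simp add: algebra_simps)
    moreover have "norm Y1 \<le> (A1 * r ^ 3 + 2 * (A1 * r ^ 3)) + A1 * r ^ 3"
      unfolding Y1_def
    proof (rule norm_triangle_mono[OF order_trans[OF norm_triangle_ineq4 add_mono]])
      show "norm (2 *\<^sub>R (y h - r\<^sup>2 *\<^sub>R S (et h))) \<le> 2 * (A1 * r ^ 3)"
        using Y[of h] h by (simp add: y_def)
      show "norm (y 0 - r\<^sup>2 *\<^sub>R S (et 0)) \<le> A1 * r ^ 3" "norm (y (2 * h) - r\<^sup>2 *\<^sub>R S (et (2 * h))) \<le> A1 * r ^ 3"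
        using Y[of 0] Y[of "2 * h"] h by (simp_all add: y_def)
    qed
    moreover have "norm (Y0 - Y1) \<le> norm Y0 + norm Y1" by (rule norm_triangle_ineq4)
    ultimately have "norm (r\<^sup>2 *\<^sub>R ((sin (\<omega>\<^sub>0 * h))\<^sup>2 *\<^sub>R N e + h\<^sup>2 *\<^sub>R G e))
        \<le> (A2 * r ^ 3 + r\<^sup>2 * (2 * LG * \<omega>\<^sub>0 * h)) * h\<^sup>2 + ((A1 * r ^ 3 + 2 * (A1 * r ^ 3)) + A1 * r ^ 3)"
      using sd unfolding Y0_def[symmetric] by simp
    then have "r\<^sup>2 * norm ((sin (\<omega>\<^sub>0 * h))\<^sup>2 *\<^sub>R N e + h\<^sup>2 *\<^sub>R G e)
        \<le> r\<^sup>2 * ((2 * LG * \<omega>\<^sub>0) * h ^ 3 + (4 * A1 + A2 * h\<^sup>2) * r)"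
      unfolding norm_scaleR abs_power2
      by (simp only: distrib_left distrib_right power2_eq_square power3_eq_cube mult_ac)
    then show "norm ((sin (\<omega>\<^sub>0 * h))\<^sup>2 *\<^sub>R N e + h\<^sup>2 *\<^sub>R G e)
        \<le> (2 * LG * \<omega>\<^sub>0) * h ^ 3 + (4 * A1 + A2 * h\<^sup>2) * r"
      using r by simp
  qed
  then have "\<omega>\<^sub>0\<^sup>2 *\<^sub>R N e + G e = 0"
    using horizon_pos by (intro quadratic_coefficient_limit[of "horizon / 2"]) auto
  then show ?thesis by (simp add: N_def G_def)
qed

end


section \<open>The backbone curve\<close>

lemma invertible_solve:
  assumes "invertible A" "A *v x = b" shows "x = matrix_inv A *v b"
  using assms(2) matrix_inv_left[OF assms(1)] by (metis matrix_vector_mul_assoc matrix_vector_mul_lid)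

lemma resonant_coefficient_eq:
  fixes \<omega> \<alpha> \<beta> \<gamma> :: real
  assumes "\<omega> > 0"
  shows "(3 * (\<beta> / (8 * \<omega> ^ 3)) + \<gamma> / (8 * \<omega>) - 20 * (\<alpha> / (4 * \<omega>\<^sup>2))\<^sup>2 / (3 * \<omega>)) * \<omega>\<^sup>2
     = (9 * \<beta> * \<omega>\<^sup>2 - 10 * \<alpha>\<^sup>2 + 3 * \<gamma> * \<omega> ^ 4) / (24 * \<omega> ^ 3)"
proof -
  have "3 * (\<beta> / (8 * \<omega> ^ 3)) * \<omega>\<^sup>2 = 9 * \<beta> * \<omega>\<^sup>2 / (24 * \<omega> ^ 3)" by simp
  moreover have "\<gamma> / (8 * \<omega>) * \<omega>\<^sup>2 = 3 * \<gamma> * \<omega> ^ 4 / (24 * \<omega> ^ 3)"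
    using assms by (simp add: field_simps power2_eq_square power3_eq_cube power4_eq_xxxx)
  moreover have "20 * (\<alpha> / (4 * \<omega>\<^sup>2))\<^sup>2 / (3 * \<omega>) * \<omega>\<^sup>2 = 10 * \<alpha>\<^sup>2 / (24 * \<omega> ^ 3)"
    using assms by (simp add: power_divide power_mult_distrib field_simps power2_eq_square power3_eq_cube)
  ultimately show ?thesis
    by (simp only: distrib_right left_diff_distrib add_divide_distrib diff_divide_distrib)
qed

context subcenter_manifold
begin

text \<open>Comparing coefficients of \<open>x\<^sup>2\<close>, \<open>x v\<close> and \<open>v\<^sup>2\<close> gives three vector equations. The second one is homogeneous with
the invertible matrix \<open>\<Omega>2 - 4 \<omega>\<^sub>0\<^sup>2\<close>; eliminating \<open>W 2 0\<close> by the third, the first becomes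
\<open>\<Omega>2 (\<Omega>2 - 4 \<omega>\<^sub>0\<^sup>2) (W 0 2) = 2 M\<^sup>-\<^sup>1 q\<^sub>2\<^sub>0\<close>.\<close>

lemma quadratic_coefficients:
  shows "W 1 1 = 0"
    and "W 0 2 = 2 *\<^sub>R (matrix_inv (\<Omega>2 - mat (4 * \<omega>\<^sub>0\<^sup>2)) *v (matrix_inv \<Omega>2 *v m0))"
    and "W 2 0 = - ((\<Omega>2 - mat (2 * \<omega>\<^sub>0\<^sup>2)) *v (matrix_inv (\<Omega>2 - mat (4 * \<omega>\<^sub>0\<^sup>2)) *v (matrix_inv \<Omega>2 *v m0)))"
proof -
  let ?o = "\<omega>\<^sub>0\<^sup>2"
  have i4: "invertible (\<Omega>2 - mat (4 * ?o))"
    using nonresonance_invertible[of 2] by (simp add: power_mult_distrib)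
  have i0: "invertible \<Omega>2" using nonresonance_invertible[of 0] by simp
  have "quad_form \<omega>\<^sub>0
      (?o *\<^sub>R ((-2) *\<^sub>R W 2 0 + (2 * ?o) *\<^sub>R W 0 2) + (\<Omega>2 *v W 2 0 + m0))
      (?o *\<^sub>R ((-4) *\<^sub>R W 1 1) + \<Omega>2 *v W 1 1)
      (?o *\<^sub>R ((2 / ?o) *\<^sub>R W 2 0 - 2 *\<^sub>R W 0 2) + \<Omega>2 *v W 0 2) e = 0" if "norm e = 1" for e
    using quadratic_invariance[OF that] \<omega>\<^sub>0_pos by (simp add: quad_form_def algebra_simps)
  from quad_form_eq_0D[OF \<omega>\<^sub>0_pos this]
  have A: "?o *\<^sub>R ((-2) *\<^sub>R W 2 0 + (2 * ?o) *\<^sub>R W 0 2) + (\<Omega>2 *v W 2 0 + m0) = 0"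
    and B: "?o *\<^sub>R ((-4) *\<^sub>R W 1 1) + \<Omega>2 *v W 1 1 = 0"
    and C: "?o *\<^sub>R ((2 / ?o) *\<^sub>R W 2 0 - 2 *\<^sub>R W 0 2) + \<Omega>2 *v W 0 2 = 0"
    by auto
  have shift: "(\<Omega>2 - mat s) *v v = \<Omega>2 *v v - s *\<^sub>R v" for s v
    by (simp add: matrix_vector_mult_diff_rdistrib mat_mult_vec)
  have "(\<Omega>2 - mat (4 * ?o)) *v W 1 1 = 0"
    unfolding shift using B by (simp add: algebra_simps)
  then show "W 1 1 = 0" using i4 invertible_iff_ker by blast
  have "2 *\<^sub>R W 2 0 = (2 * ?o) *\<^sub>R W 0 2 - \<Omega>2 *v W 0 2"
    using C \<omega>\<^sub>0_pos by (simp add: algebra_simps)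
  then have half: "W 2 0 = (1 / 2) *\<^sub>R ((2 * ?o) *\<^sub>R W 0 2 - \<Omega>2 *v W 0 2)"
    by (metis scaleR_half_double scaleR_scaleR divide_self_if field_sum_of_halves scaleR_2 mult.commute scaleR_right_distrib)
  have "\<Omega>2 *v ((\<Omega>2 - mat (4 * ?o)) *v W 0 2) = 2 *\<^sub>R m0"
  proof -
    let ?X = "\<Omega>2 *v W 0 2" and ?Y = "\<Omega>2 *v (\<Omega>2 *v W 0 2)"
    have 1: "\<Omega>2 *v W 2 0 = ?o *\<^sub>R (\<Omega>2 *v W 0 2) - (1 / 2) *\<^sub>R (\<Omega>2 *v (\<Omega>2 *v W 0 2))"
      unfolding half by (simp add: algebra_simps matrix_vector_mult_scaleR)
    have 2: "?o *\<^sub>R ((-2) *\<^sub>R W 2 0) = (- 2 * ?o * ?o) *\<^sub>R W 0 2 + ?o *\<^sub>R (\<Omega>2 *v W 0 2)"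
      unfolding half by (simp add: algebra_simps)
    have "m0 - ((1 / 2) *\<^sub>R ?Y - (2 * ?o) *\<^sub>R ?X)
        = ((- 2 * ?o * ?o) *\<^sub>R W 0 2 + ?o *\<^sub>R ?X) + (?o * (2 * ?o)) *\<^sub>R W 0 2
          + (?o *\<^sub>R ?X - (1 / 2) *\<^sub>R ?Y) + m0"
      by (simp add: algebra_simps flip: scaleR_add_left)
    also have "\<dots> = 0"
      using A unfolding 1[symmetric] 2[symmetric] by (simp add: algebra_simps)
    finally have "m0 = (1 / 2) *\<^sub>R ?Y - (2 * ?o) *\<^sub>R ?X" by simp
    then have "2 *\<^sub>R m0 = 2 *\<^sub>R ((1 / 2) *\<^sub>R ?Y - (2 * ?o) *\<^sub>R ?X)" by (rule arg_cong)
    then show ?thesis unfolding shift by (simp add: algebra_simps matrix_vector_mult_scaleR)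
  qed
  then have "(\<Omega>2 - mat (4 * ?o)) *v W 0 2 = matrix_inv \<Omega>2 *v (2 *\<^sub>R m0)"
    by (rule invertible_solve[OF i0])
  then have "W 0 2 = matrix_inv (\<Omega>2 - mat (4 * ?o)) *v (matrix_inv \<Omega>2 *v (2 *\<^sub>R m0))"
    by (rule invertible_solve[OF i4])
  then show W02: "W 0 2 = 2 *\<^sub>R (matrix_inv (\<Omega>2 - mat (4 * ?o)) *v (matrix_inv \<Omega>2 *v m0))"
    by (simp add: matrix_vector_mult_scaleR)
  have "W 2 0 = - ((\<Omega>2 - mat (2 * ?o)) *v ((1 / 2) *\<^sub>R W 0 2))"
    unfolding half shift by (simp add: algebra_simps matrix_vector_mult_scaleR)
  then show "W 2 0 = - ((\<Omega>2 - mat (2 * ?o)) *v (matrix_inv (\<Omega>2 - mat (4 * ?o)) *v (matrix_inv \<Omega>2 *v m0)))"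
    unfolding W02 by simp
qed

definition \<omega>\<^sub>1 :: real where
  "\<omega>\<^sub>1 = (9 * (p 3 (\<lambda>_. 0) + (\<chi> j. p 1 (unit_index j)) \<bullet> W 2 0) * \<omega>\<^sub>0\<^sup>2 - 10 * (p 2 (\<lambda>_. 0))\<^sup>2
     + 3 * ((\<chi> j. p 1 (unit_index j)) \<bullet> W 0 2) * \<omega>\<^sub>0 ^ 4) / (24 * \<omega>\<^sub>0 ^ 3)"

text \<open>Existence of a value \<open>\<Omega>\<close> comes from the periodic orbit through the point, uniqueness from comparing its minimal
period with that of any other trajectory with the same start.\<close>

lemma backbone_near_0:
  "\<exists>C r0. r0 > 0 \<and> (\<forall>r. r \<noteq> 0 \<and> \<bar>r\<bar> \<le> r0 \<longrightarrow>
     (\<exists>\<Omega>. (\<forall>\<Omega>'. (r, \<Omega>') \<in> backbone_curve \<omega>\<^sub>0 M K P Q U w w' \<longleftrightarrow> \<Omega>' = \<Omega>) \<and>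
        \<bar>\<Omega> - (\<omega>\<^sub>0 + \<omega>\<^sub>1 * r\<^sup>2)\<bar> \<le> C * \<bar>r\<bar> ^ 3))"
proof -
  obtain L \<epsilon> where wo: "weak_oscillator \<omega>\<^sub>0 L \<epsilon> F" using F_weak_oscillator by blast
  interpret weak_oscillator \<omega>\<^sub>0 L \<epsilon> F by (rule wo)
  let ?p1 = "(\<chi> j. p 1 (unit_index j)) :: real ^ 'n"
  define \<alpha> \<beta> \<gamma>c where "\<alpha> = p 2 (\<lambda>_. 0)" and "\<beta> = p 3 (\<lambda>_. 0) + ?p1 \<bullet> W 2 0" and "\<gamma>c = ?p1 \<bullet> W 0 2"
  obtain D \<delta>F where D: "D \<ge> 0" "\<delta>F > 0"
    "\<And>z. norm z \<le> \<delta>F \<Longrightarrow> \<bar>F z - cubic_restoring \<omega>\<^sub>0 \<alpha> \<beta> \<gamma>c z\<bar> \<le> D * norm z ^ 4"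
    using F_expansion[OF quadratic_coefficients(1)] unfolding \<alpha>_def \<beta>_def \<gamma>c_def by blast
  define \<sigma> where "\<sigma> = 3 * (\<beta> / (8 * \<omega>\<^sub>0 ^ 3)) + \<gamma>c / (8 * \<omega>\<^sub>0) - 20 * (\<alpha> / (4 * \<omega>\<^sub>0\<^sup>2))\<^sup>2 / (3 * \<omega>\<^sub>0)"
  have "\<exists>K \<delta>. \<delta> > 0 \<and> (\<forall>c T. oscillation \<omega>\<^sub>0 F c \<and> c 0 \<noteq> 0 \<and> norm (c 0) \<le> \<delta> \<and>
       T \<le> horizon \<and> c T = c 0 \<and> \<bar>\<omega>\<^sub>0 * T - 2 * pi\<bar> \<le> 1 / 2 \<longrightarrow>
       \<bar>2 * pi / T - (\<omega>\<^sub>0 + \<sigma> * norm (c 0) ^ 2)\<bar> \<le> K * norm (c 0) ^ 3)"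
    unfolding \<sigma>_def by (rule return_time_expansion[OF D(2) D(1)], erule D(3))
  then obtain C \<delta> where C: "\<delta> > 0" "\<forall>c T. oscillation \<omega>\<^sub>0 F c \<and> c 0 \<noteq> 0 \<and> norm (c 0) \<le> \<delta> \<and>
       T \<le> horizon \<and> c T = c 0 \<and> \<bar>\<omega>\<^sub>0 * T - 2 * pi\<bar> \<le> 1 / 2 \<longrightarrow>
       \<bar>2 * pi / T - (\<omega>\<^sub>0 + \<sigma> * norm (c 0) ^ 2)\<bar> \<le> C * norm (c 0) ^ 3"
    by (elim exE conjE, intro that)
  obtain \<delta>U where \<delta>U: "\<delta>U > 0" "\<And>z. norm z \<le> \<delta>U \<Longrightarrow> chart z \<in> U" using chart_near_0 by blast
  have \<sigma>1: "\<sigma> * \<omega>\<^sub>0\<^sup>2 = \<omega>\<^sub>1"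
    unfolding \<sigma>_def \<omega>\<^sub>1_def \<alpha>_def \<beta>_def \<gamma>c_def by (rule resonant_coefficient_eq[OF \<omega>\<^sub>0_pos])
  \<comment> \<open>The last two entries make \<open>2 s0\<close> a small amplitude.\<close>
  define s0 where "s0 = Min {\<delta>, \<delta>U, \<epsilon> / 4, 1 / (800 * (horizon * L))}"
  have s0: "s0 > 0" unfolding s0_def
    using C(1) \<delta>U(1) \<epsilon>\<^sub>0_pos horizon_pos L_pos by (subst Min_gr_iff) auto
  have "s0 \<le> \<delta>" "s0 \<le> \<delta>U" "s0 \<le> \<epsilon> / 4" "s0 \<le> 1 / (800 * (horizon * L))"
    unfolding s0_def by (rule Min_le, simp, blast)+
  note s0_le = this
  show ?thesis
  proof (rule exI[of _ "C * \<omega>\<^sub>0 ^ 3"], rule exI[of _ "s0 / \<omega>\<^sub>0"], intro conjI allI impI, goal_cases)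
    case 1
    show "s0 / \<omega>\<^sub>0 > 0" using s0 \<omega>\<^sub>0_pos by simp
  next
    case (2 r)
    then have r: "r \<noteq> 0" "\<bar>r\<bar> \<le> s0 / \<omega>\<^sub>0" by auto
    define s where "s = \<omega>\<^sub>0 * r"
    have as: "\<bar>s\<bar> = \<omega>\<^sub>0 * \<bar>r\<bar>" using \<omega>\<^sub>0_pos by (simp add: s_def abs_mult)
    have s: "s \<noteq> 0" "\<bar>s\<bar> \<le> s0" using r \<omega>\<^sub>0_pos unfolding as by (auto simp: s_def field_simps)
    have "\<bar>s\<bar> \<le> 1 / (800 * (horizon * L))" using s s0_le by linarith
    then have sm: "small_amplitude (2 * \<bar>s\<bar>)"
      using s s0_le horizon_pos L_pos unfolding small_amplitude_def by (auto simp: field_simps)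
    have start: "state_of (of_real s) = (r, 0, w (r, 0), w' (r, 0))"
      using \<omega>\<^sub>0_pos by (simp add: state_of_def chart_def s_def)
    have inj: "inj (state_of :: complex \<Rightarrow> 'n state)" by (auto intro: injI simp: state_of_inject)
    have sU: "chart (of_real s) \<in> U" using s s0_le by (intro \<delta>U) simp
    then have rU: "(r, 0) \<in> U" using \<omega>\<^sub>0_pos by (simp add: chart_def s_def)
    obtain \<gamma> c T where \<gamma>: "mech_trajectory \<omega>\<^sub>0 M K P Q UNIV \<gamma>" "has_period \<gamma> T"
      "\<gamma> = (\<lambda>t. state_of (c t))" "c 0 = of_real s" "oscillation \<omega>\<^sub>0 F c"
      by (rule trajectory_exists[OF sU]) blast
    have cT: "has_period c T" using \<gamma>(2) unfolding \<gamma>(3) has_period_inject[OF inj] .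
    obtain \<tau> where \<tau>: "has_minimal_period c \<tau>" "\<tau> \<le> horizon" "\<bar>\<omega>\<^sub>0 * \<tau> - 2 * pi\<bar> \<le> 1 / 2"
      using common_minimal_period[OF \<gamma>(5,4) cT \<gamma>(5,4) cT sm] by blast
    have "c (0 + \<tau>) = c 0" using \<tau>(1) unfolding has_minimal_period_def has_period_def by blast
    then have "\<bar>2 * pi / \<tau> - (\<omega>\<^sub>0 + \<sigma> * norm (c 0) ^ 2)\<bar> \<le> C * norm (c 0) ^ 3"
      using s s0_le \<tau> \<gamma> by (intro C(2)[rule_format]) auto
    moreover have "\<sigma> * norm (c 0) ^ 2 = \<omega>\<^sub>1 * r\<^sup>2"
      unfolding \<gamma>(4) \<sigma>1[symmetric] by (simp add: as power_mult_distrib)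
    moreover have "C * norm (c 0) ^ 3 = C * \<omega>\<^sub>0 ^ 3 * \<bar>r\<bar> ^ 3"
      unfolding \<gamma>(4) by (simp add: as power_mult_distrib)
    ultimately have bound: "\<bar>2 * pi / \<tau> - (\<omega>\<^sub>0 + \<omega>\<^sub>1 * r\<^sup>2)\<bar> \<le> C * \<omega>\<^sub>0 ^ 3 * \<bar>r\<bar> ^ 3" by simp
    have "(r, \<Omega>') \<in> backbone_curve \<omega>\<^sub>0 M K P Q U w w' \<longleftrightarrow> \<Omega>' = 2 * pi / \<tau>" for \<Omega>'
    proof
      assume "\<Omega>' = 2 * pi / \<tau>"
      moreover have "has_minimal_period \<gamma> \<tau>"
        unfolding \<gamma>(3) has_minimal_period_inject[OF inj] by (rule \<tau>)
      moreover have "\<gamma> 0 = (r, 0, w (r, 0), w' (r, 0))" using \<gamma>(3,4) start by simp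
      ultimately show "(r, \<Omega>') \<in> backbone_curve \<omega>\<^sub>0 M K P Q U w w'"
        unfolding backbone_curve_def using rU \<gamma>(1) by blast
    next
      assume "(r, \<Omega>') \<in> backbone_curve \<omega>\<^sub>0 M K P Q U w w'"
      then obtain \<gamma>' T' where \<gamma>': "\<Omega>' = 2 * pi / T'" "mech_trajectory \<omega>\<^sub>0 M K P Q UNIV \<gamma>'"
        "\<gamma>' 0 = (r, 0, w (r, 0), w' (r, 0))" "has_minimal_period \<gamma>' T'"
        unfolding backbone_curve_def by blast
      have "\<gamma>' 0 \<in> graph_manifold U w w'"
        using rU unfolding \<gamma>'(3) graph_manifold_def by blast
      then obtain c' where c': "\<gamma>' = (\<lambda>t. state_of (c' t))" "oscillation \<omega>\<^sub>0 F c'"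
        using trajectory_in_chart[OF \<gamma>'(2)] by blast
      have c'0: "c' 0 = of_real s" using \<gamma>'(3) unfolding c'(1) start[symmetric] state_of_inject .
      have mp: "has_minimal_period c' T'" using \<gamma>'(4) unfolding c'(1) has_minimal_period_inject[OF inj] .
      then have p': "has_period c' T'" by (simp add: has_minimal_period_def)
      obtain \<tau>' where \<tau>': "has_minimal_period c \<tau>'" "has_minimal_period c' \<tau>'"
        using common_minimal_period[OF \<gamma>(5,4) cT c'(2) c'0 p' sm] by blast
      have "T' = \<tau>'" "\<tau>' = \<tau>"
        using mp \<tau>' \<tau>(1) unfolding has_minimal_period_def by (meson order_antisym)+
      then show "\<Omega>' = 2 * pi / \<tau>" using \<gamma>'(1) by simp
    qed
    with bound show "\<exists>\<Omega>. (\<forall>\<Omega>'. (r, \<Omega>') \<in> backbone_curve \<omega>\<^sub>0 M K P Q U w w' \<longleftrightarrow> \<Omega>' = \<Omega>) \<and>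
        \<bar>\<Omega> - (\<omega>\<^sub>0 + \<omega>\<^sub>1 * r\<^sup>2)\<bar> \<le> C * \<omega>\<^sub>0 ^ 3 * \<bar>r\<bar> ^ 3" by blast
  qed
qed

lemma backbone_expansion:
  "\<exists>\<omega> :: real \<Rightarrow> real.
     (\<forall>\<^sub>F r in at 0. \<forall>\<Omega>. (r, \<Omega>) \<in> backbone_curve \<omega>\<^sub>0 M K P Q U w w' \<longleftrightarrow> \<Omega> = \<omega> r) \<and>
     (\<lambda>r. \<omega> r - (\<omega>\<^sub>0 + \<omega>\<^sub>1 * r\<^sup>2)) \<in> O[at 0](\<lambda>r. r ^ 3)"
proof -
  from backbone_near_0 obtain C r0 where r0: "r0 > 0" "\<forall>r. r \<noteq> 0 \<and> \<bar>r\<bar> \<le> r0 \<longrightarrow>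
     (\<exists>\<Omega>. (\<forall>\<Omega>'. (r, \<Omega>') \<in> backbone_curve \<omega>\<^sub>0 M K P Q U w w' \<longleftrightarrow> \<Omega>' = \<Omega>) \<and>
        \<bar>\<Omega> - (\<omega>\<^sub>0 + \<omega>\<^sub>1 * r\<^sup>2)\<bar> \<le> C * \<bar>r\<bar> ^ 3)"
    by (elim exE conjE, intro that)
  \<comment> \<open>A choice function for the values near \<open>0\<close>; elsewhere it is arbitrary.\<close>
  define good where "good r \<Omega> \<longleftrightarrow> (\<forall>\<Omega>'. (r, \<Omega>') \<in> backbone_curve \<omega>\<^sub>0 M K P Q U w w' \<longleftrightarrow> \<Omega>' = \<Omega>) \<and>
        \<bar>\<Omega> - (\<omega>\<^sub>0 + \<omega>\<^sub>1 * r\<^sup>2)\<bar> \<le> C * \<bar>r\<bar> ^ 3" for r \<Omega>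
  define \<omega> where "\<omega> r = (SOME \<Omega>. good r \<Omega>)" for r
  have \<omega>: "good r (\<omega> r)" if "r \<noteq> 0 \<and> \<bar>r\<bar> \<le> r0" for r
    unfolding \<omega>_def using r0(2)[rule_format, OF that] by (intro someI_ex[of "good r"]) (simp only: good_def)
  have ev: "\<forall>\<^sub>F r in at 0. r \<noteq> 0 \<and> \<bar>r\<bar> \<le> r0"
    unfolding eventually_at using r0(1) by (intro exI[of _ r0]) auto
  show ?thesis
  proof (intro exI[of _ \<omega>] conjI)
    show "\<forall>\<^sub>F r in at 0. \<forall>\<Omega>. (r, \<Omega>) \<in> backbone_curve \<omega>\<^sub>0 M K P Q U w w' \<longleftrightarrow> \<Omega> = \<omega> r"
      using ev by eventually_elim (use \<omega> good_def in blast)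
    show "(\<lambda>r. \<omega> r - (\<omega>\<^sub>0 + \<omega>\<^sub>1 * r\<^sup>2)) \<in> O[at 0](\<lambda>r. r ^ 3)"
    proof (rule bigoI[where c = C])
      show "\<forall>\<^sub>F r in at 0. norm (\<omega> r - (\<omega>\<^sub>0 + \<omega>\<^sub>1 * r\<^sup>2)) \<le> C * norm (r ^ 3)"
        using ev by eventually_elim (use \<omega> in \<open>simp add: power_abs good_def\<close>)
    qed
  qed
qed

end

theorem theorem4p1:
  fixes \<omega>\<^sub>0 :: real
    and M K \<Omega>2 :: "real ^ 'n ^ 'n"
    and \<omega>y :: "'n \<Rightarrow> real"
    and l :: nat
    and p :: "nat \<Rightarrow> ('n \<Rightarrow> nat) \<Rightarrow> real"
    and q :: "nat \<Rightarrow> ('n \<Rightarrow> nat) \<Rightarrow> real ^ 'n"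
    and P :: "real \<Rightarrow> real ^ 'n \<Rightarrow> real"
    and Q :: "real \<Rightarrow> real ^ 'n \<Rightarrow> real ^ 'n"
    and U :: "(real \<times> real) set"
    and w w' :: "real \<times> real \<Rightarrow> real ^ 'n"
    and W :: "nat \<Rightarrow> nat \<Rightarrow> real ^ 'n"
  assumes "\<omega>\<^sub>0 > 0"
    and "invertible M"
    and "\<Omega>2 = matrix_inv M ** K"
    and "linear_eigenvalues M K = (\<Union>i. {\<i> * complex_of_real (\<omega>y i), - \<i> * complex_of_real (\<omega>y i)})"
    and nonresonance: "\<And>i. \<omega>y i / \<omega>\<^sub>0 \<notin> \<int>"
    and "2 \<le> l" and "l \<le> 3"
    and "\<And>j k. l < j + multi_order k \<Longrightarrow> p j k = 0"
    and "\<And>j k. l < j + multi_order k \<Longrightarrow> q j k = 0"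
    and "P = nonlin_poly l p"
    and "Q = nonlin_poly l q"
    and lsm: "lyapunov_subcenter_manifold \<omega>\<^sub>0 M K P Q U w w'"
    and taylor: "has_taylor_coeffs_2_3 w W"
  shows "W 2 0 = - ((\<Omega>2 - mat (2 * \<omega>\<^sub>0\<^sup>2)) ** matrix_inv (\<Omega>2 - mat (4 * \<omega>\<^sub>0\<^sup>2))
                     ** matrix_inv \<Omega>2 ** matrix_inv M *v q 2 (\<lambda>_. 0)) \<and>
         W 0 2 = 2 *\<^sub>R (matrix_inv (\<Omega>2 - mat (4 * \<omega>\<^sub>0\<^sup>2))
                     ** matrix_inv \<Omega>2 ** matrix_inv M *v q 2 (\<lambda>_. 0)) \<and>
        (let p20 = p 2 (\<lambda>_. 0);
             p30 = p 3 (\<lambda>_. 0);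
             p1I = (\<chi> j. p 1 (unit_index j));
             hp30 = p1I \<bullet> W 2 0;
             hs12 = p1I \<bullet> W 0 2;
             \<omega>\<^sub>1 = (9 * (p30 + hp30) * \<omega>\<^sub>0\<^sup>2 - 10 * p20\<^sup>2 + 3 * hs12 * \<omega>\<^sub>0 ^ 4) / (24 * \<omega>\<^sub>0 ^ 3)
         in \<exists>\<omega> :: real \<Rightarrow> real.
              (\<forall>\<^sub>F r in at 0. \<forall>\<Omega>. (r, \<Omega>) \<in> backbone_curve \<omega>\<^sub>0 M K P Q U w w' \<longleftrightarrow> \<Omega> = \<omega> r) \<and>
              (\<lambda>r. \<omega> r - (\<omega>\<^sub>0 + \<omega>\<^sub>1 * r\<^sup>2)) \<in> O[at 0](\<lambda>r. r ^ 3))"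
proof -
  interpret subcenter_manifold \<omega>\<^sub>0 M K \<Omega>2 \<omega>y l p q P Q U w w' W
    by unfold_locales (fact assms)+
  show ?thesis
    using quadratic_coefficients(2,3) backbone_expansion
    unfolding Let_def \<omega>\<^sub>1_def by (simp add: matrix_vector_mul_assoc matrix_mul_assoc)
qed

end
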